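(* Assume that we are in the one branch, ramified case: $\mathbf L$ is a field, the maximal ideal of $\mathbf A$ is $\tau\mathbf A$, $\mathbf A/\tau\mathbf A\simeq\mathbf k$ and $t\mathbf A=\tau^3\mathbf A$. Let $v$ be the normalized discrete valuation of $\mathbf A$ (so $v(\tau)=1$), and for integers $r\ge 0$ put $$\mathbf C_{2r}(\alpha)=\mathbf D+t^r\alpha\mathbf D+t^{2r}\mathbf A\quad\text{for }\alpha\in\mathbf A,\ v(\alpha)=1,$$ $$\mathbf C_{2r+1}(\alpha)=\mathbf D+t^r\alpha\mathbf D+t^{2r+1}\mathbf A\quad\text{for }\alpha\in\mathbf A,\ v(\alpha)=2$$ (so $\mathbf C_0(\alpha)=\mathbf A$). Then: (1) every over-ring of $\mathbf A_m$ coincides with $t^k\mathbf C_r(\alpha)+\mathbf D$ for some $k,r$ such that $r+k\le m$ and some $\alpha$ (with $v(\alpha)=1$ if $r$ is even and $v(\alpha)=2$ if $r$ is odd); (2) the rings $\mathbf C_r(\alpha)$ are just all plane curve singularities in this case (i.e. among the cubic rings over $\mathbf D$ in $\mathbf L$).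
   Context: $\mathbf D$ is a complete discrete valuation ring with field of fractions $\mathbf K$, maximal ideal $t\mathbf D$ and residue field $\mathbf k=\mathbf D/t\mathbf D$. $\mathbf L$ is a $3$-dimensional (commutative) semisimple $\mathbf K$-algebra. A cubic ring over $\mathbf D$ (in $\mathbf L$) is a $\mathbf D$-subalgebra of $\mathbf L$ that is a free $\mathbf D$-module of rank $3$. $\mathbf A$ is the integral closure of $\mathbf D$ in $\mathbf L$; it is assumed to be a finitely generated $\mathbf D$-module. For $m\ge0$, $\mathbf A_m=t^m\mathbf A+\mathbf D$. An over-ring of a cubic ring $\mathbf C$ is a cubic ring $\mathbf B$ with $\mathbf C\subseteq\mathbf B\subset\mathbf L$. The embedding dimension of a local noetherian ring $\mathbf C$ with maximal ideal $\mathbf J$ is $\dim_{\mathbf C/\mathbf J}\mathbf J/\mathbf J^2$; a local noetherian ring of Krull dimension $1$ and embedding dimension $2$ is called a plane curve singularity.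
   Formalization: Part (2) is proved for the rings C_r(α) with r ≥ 1 only: C_0(α) = A is a discrete valuation ring of embedding dimension 1, hence not a plane curve singularity under the definition requiring embedding dimension 2. *)

theory Defs
  imports
    "HOL-Algebra.Algebra"
    "HOL-Library.Extended_Nat"
    "Jordan_Normal_Form.Missing_VectorSpace"
begin

text \<open>
  All rings in play are subrings of one ambient field \<open>L\<close>. A subring is given by its carrier \<open>C\<close>;
  regarded as a ring in its own right it is the record \<open>L\<lparr>carrier := C\<rparr>\<close>.
\<close>

definition local_ring :: "('a, 'b) ring_scheme \<Rightarrow> bool" where
  "local_ring R \<longleftrightarrow> cring R \<and> (\<exists>!M. maximalideal M R)"

definition discrete_valuation_ring :: "('a, 'b) ring_scheme \<Rightarrow> bool" where
  "discrete_valuation_ring R \<longleftrightarrow> principal_domain R \<and> local_ring R \<and> \<not> field R"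

text \<open>
  Completeness in the \<open>\<pi>\<close>-adic topology: \<open>R\<close> is the inverse limit of the rings \<open>R / \<pi>\<^sup>n R\<close>.
\<close>

definition adically_complete :: "('a, 'b) ring_scheme \<Rightarrow> 'a \<Rightarrow> bool" where
  "adically_complete R \<pi> \<longleftrightarrow>
     (\<forall>f. (\<forall>n::nat. f n \<in> carrier R \<and> f (Suc n) \<ominus>\<^bsub>R\<^esub> f n \<in> PIdl\<^bsub>R\<^esub> (\<pi> [^]\<^bsub>R\<^esub> n)) \<longrightarrow>
          (\<exists>!x. x \<in> carrier R \<and> (\<forall>n. f n \<ominus>\<^bsub>R\<^esub> x \<in> PIdl\<^bsub>R\<^esub> (\<pi> [^]\<^bsub>R\<^esub> n))))"

text \<open>
  For a discrete valuation ring \<open>R\<close> with maximal ideal \<open>\<pi>R\<close>; the value at zero is \<open>\<infinity>\<close>.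
\<close>

definition normalized_valuation :: "('a, 'b) ring_scheme \<Rightarrow> 'a \<Rightarrow> 'a \<Rightarrow> enat" where
  "normalized_valuation R \<pi> x = (SUP n \<in> {n::nat. x \<in> PIdl\<^bsub>R\<^esub> (\<pi> [^]\<^bsub>R\<^esub> n)}. enat n)"

definition field_of_fractions :: "('a, 'b) ring_scheme \<Rightarrow> 'a set \<Rightarrow> 'a set" where
  "field_of_fractions L D = {a \<otimes>\<^bsub>L\<^esub> inv\<^bsub>L\<^esub> b | a b. a \<in> D \<and> b \<in> D \<and> b \<noteq> \<zero>\<^bsub>L\<^esub>}"

definition integral_closure :: "('a, 'b) ring_scheme \<Rightarrow> 'a set \<Rightarrow> 'a set" where
  "integral_closure L D =
     {x \<in> carrier L. \<exists>p. polynomial\<^bsub>L\<^esub> D p \<and> p \<noteq> [] \<and> lead_coeff p = \<one>\<^bsub>L\<^esub> \<and>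
                         ring.eval L p x = \<zero>\<^bsub>L\<^esub>}"

text \<open>
  \<open>ring.Span\<close> and \<open>ring.combine\<close> make sense over any set of scalars, but \<open>ring.independent\<close> is the
  right notion only over a field; over \<open>D\<close>, freeness is expressed by the absence of relations.
\<close>

definition finitely_generated_over :: "('a, 'b) ring_scheme \<Rightarrow> 'a set \<Rightarrow> 'a set \<Rightarrow> bool" where
  "finitely_generated_over L D M \<longleftrightarrow> (\<exists>Us. set Us \<subseteq> carrier L \<and> M = ring.Span L D Us)"

definition free_of_rank :: "('a, 'b) ring_scheme \<Rightarrow> 'a set \<Rightarrow> nat \<Rightarrow> 'a set \<Rightarrow> bool" where
  "free_of_rank L D n M \<longleftrightarrow>
     (\<exists>Us. length Us = n \<and> set Us \<subseteq> carrier L \<and> M = ring.Span L D Us \<and>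
        (\<forall>Ks. length Ks = n \<and> set Ks \<subseteq> D \<and> ring.combine L Ks Us = \<zero>\<^bsub>L\<^esub> \<longrightarrow> set Ks \<subseteq> {\<zero>\<^bsub>L\<^esub>}))"

definition cubic_ring :: "('a, 'b) ring_scheme \<Rightarrow> 'a set \<Rightarrow> 'a set \<Rightarrow> bool" where
  "cubic_ring L D C \<longleftrightarrow> subring C L \<and> D \<subseteq> C \<and> free_of_rank L D 3 C"

definition over_ring :: "('a, 'b) ring_scheme \<Rightarrow> 'a set \<Rightarrow> 'a set \<Rightarrow> 'a set \<Rightarrow> bool" where
  "over_ring L D C B \<longleftrightarrow> cubic_ring L D B \<and> C \<subseteq> B"

definition krull_dim :: "('a, 'b) ring_scheme \<Rightarrow> enat" where
  "krull_dim R =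
     (SUP Ps \<in> {Ps. Ps \<noteq> [] \<and> (\<forall>P \<in> set Ps. primeideal P R) \<and> sorted_wrt (\<subset>) Ps}.
        enat (length Ps - 1))"

text \<open>
  The \<open>R/J\<close>-module \<open>J/J\<^sup>2\<close>, with \<open>J\<^sup>2 = J \<cdot>\<^bsub>R\<^esub> J\<close>. The scalar product of \<open>J +> a\<close> and \<open>J\<^sup>2 +> x\<close> is
  \<open>J\<^sup>2 +> a \<otimes> x\<close>, which is their product as computed by \<open>rcoset_mult\<close> modulo \<open>J\<^sup>2\<close>. The fields \<open>mult\<close>
  and \<open>one\<close> are required by the record type but play no role in the module structure.
\<close>

definition cotangent_module :: "('a, 'b) ring_scheme \<Rightarrow> 'a set \<Rightarrow> ('a set, 'a set) module" where
  "cotangent_module R J =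
     \<lparr>carrier = {(J \<cdot>\<^bsub>R\<^esub> J) +>\<^bsub>R\<^esub> x | x. x \<in> J},
      monoid.mult = rcoset_mult R (J \<cdot>\<^bsub>R\<^esub> J),
      monoid.one = (J \<cdot>\<^bsub>R\<^esub> J) +>\<^bsub>R\<^esub> \<one>\<^bsub>R\<^esub>,
      ring.zero = J \<cdot>\<^bsub>R\<^esub> J,
      ring.add = set_add R,
      smult = rcoset_mult R (J \<cdot>\<^bsub>R\<^esub> J)\<rparr>"

definition embedding_dim :: "('a, 'b) ring_scheme \<Rightarrow> nat" where
  "embedding_dim R =
     (let J = (THE M. maximalideal M R) in vectorspace.dim (R Quot J) (cotangent_module R J))"

definition plane_curve_singularity :: "('a, 'b) ring_scheme \<Rightarrow> bool" where
  "plane_curve_singularity R \<longleftrightarrow>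
     local_ring R \<and> noetherian_ring R \<and> krull_dim R = 1 \<and> embedding_dim R = 2"

text \<open>The ring \<open>A\<^sub>m = t\<^sup>m A + D\<close>.\<close>

definition A_ring :: "('a, 'b) ring_scheme \<Rightarrow> 'a set \<Rightarrow> 'a set \<Rightarrow> 'a \<Rightarrow> nat \<Rightarrow> 'a set" where
  "A_ring L D A t m = ((t [^]\<^bsub>L\<^esub> m) <#\<^bsub>L\<^esub> A) <+>\<^bsub>L\<^esub> D"

text \<open>
  The ring \<open>C\<^sub>r(\<alpha>)\<close>, for both parities at once: \<open>D + t\<^sup>s\<alpha>D + t\<^sup>rA\<close> with \<open>s = r div 2\<close>. Only the
  condition on the valuation of \<open>\<alpha>\<close> depends on the parity of \<open>r\<close>. For \<open>r = 0\<close> the ring is \<open>A\<close>, a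
  discrete valuation ring, whose embedding dimension is 1; so it is not a plane curve singularity.
\<close>

definition C_ring :: "('a, 'b) ring_scheme \<Rightarrow> 'a set \<Rightarrow> 'a set \<Rightarrow> 'a \<Rightarrow> nat \<Rightarrow> 'a \<Rightarrow> 'a set" where
  "C_ring L D A t r \<alpha> =
     (D <+>\<^bsub>L\<^esub> ((t [^]\<^bsub>L\<^esub> (r div 2) \<otimes>\<^bsub>L\<^esub> \<alpha>) <#\<^bsub>L\<^esub> D)) <+>\<^bsub>L\<^esub> ((t [^]\<^bsub>L\<^esub> r) <#\<^bsub>L\<^esub> A)"

definition admissible :: "'a set \<Rightarrow> ('a \<Rightarrow> enat) \<Rightarrow> nat \<Rightarrow> 'a \<Rightarrow> bool" where
  "admissible A v r \<alpha> \<longleftrightarrow> \<alpha> \<in> A \<and> v \<alpha> = (if even r then 1 else 2)"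

end

theory Submission
  imports Defs
begin

text \<open>
  Nonzero elements of \<open>D\<close> have valuations divisible by 3. So for \<open>\<alpha>, \<gamma>\<close> of valuations 1 and 2, in
  either order, no cancellation occurs in \<open>a + b \<alpha> + c \<gamma>\<close>, and \<open>1, \<alpha>, \<gamma>\<close> is a basis of \<open>A\<close>
  over \<open>D\<close> as \<open>L\<close> has dimension 3. An over-ring \<open>B\<close> of \<open>A\<^sub>m\<close> thus has a basis \<open>1, t\<^sup>e\<alpha>, t\<^sup>h\<gamma>\<close>, and
  because it contains the square of \<open>t\<^sup>e\<alpha>\<close>, of valuation \<open>6e + 2\<close> or \<open>6e + 4\<close>, the exponent \<open>h\<close> is at
  most \<open>2e\<close> or \<open>2e + 1\<close>; the defect in this inequality is the number \<open>k\<close> of the theorem.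
  If \<open>k = 0\<close>, then \<open>B = D[\<beta>]\<close> with \<open>\<beta> = t\<^sup>e\<alpha>\<close>, and unless \<open>B = A\<close>, its maximal ideal \<open>J\<close> has \<open>t, \<beta>\<close> as a
  basis modulo \<open>J\<^sup>2\<close>. If \<open>k > 0\<close>, then \<open>J\<^sup>2 = t J\<close> and the embedding dimension is 3.
\<close>

section \<open>Cotangent spaces and embedding dimension\<close>

text \<open>Two facts give the normal form its flexibility. First, \<open>D\<close> meets every
  residue class of \<open>A\<close> modulo \<tau>, because ramification index 3 already exhausts the
  dimension of \<open>L\<close>; hence leading terms can be cancelled with coefficients from
  \<open>D\<close>, and all over-rings share one residue field. Second, for \<open>e \<le> h\<close>
  the module generated by \<open>1, t\<^sup>e\<alpha>, t\<^sup>h\<gamma>\<close> equals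
  \<open>D + t\<^sup>e\<alpha>D + t\<^sup>hA\<close>, in which \<gamma> no longer occurs. So
  \<gamma> may be chosen as the square of \<alpha> divided by a power of t, and for
  \<open>k = 0\<close> the third generator is exactly \<open>\<beta>\<^sup>2\<close>. For
  \<open>k > 0\<close> the products of two nonconstant generators all lie in
  \<open>t\<^sup>h\<^sup>+\<^sup>1A\<close>, which is contained in \<open>tJ\<close>; for the square
  of \<open>t\<^sup>e\<alpha>\<close> this is the inequality \<open>k > 0\<close> itself. A cubic
  ring is not known in advance to lie in \<open>A\<close>, nor to contain any
  \<open>A\<^sub>m\<close>; both are shown before the normal form is applied to it.\<close>

lemma (in ring) mem_set_add_iff: "x \<in> A <+> B \<longleftrightarrow> (\<exists>a \<in> A. \<exists>b \<in> B. x = a \<oplus> b)"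
  unfolding set_add_def' by blast

lemma mem_l_coset_iff: "x \<in> a <#\<^bsub>G\<^esub> H \<longleftrightarrow> (\<exists>h \<in> H. x = a \<otimes>\<^bsub>G\<^esub> h)"
  unfolding l_coset_def by blast

lemma cgenideal_subring: "PIdl\<^bsub>L\<lparr>carrier := S\<rparr>\<^esub> x = {a \<otimes>\<^bsub>L\<^esub> x | a. a \<in> S}"
  unfolding cgenideal_def by simp

lemma nat_pow_subring: "x [^]\<^bsub>L\<lparr>carrier := S\<rparr>\<^esub> (n::nat) = x [^]\<^bsub>L\<^esub> n"
  by (induct n) (simp_all add: nat_pow_def)

lemma ideal_prod_subsetI:
  assumes "\<And>x y. x \<in> I \<Longrightarrow> y \<in> J \<Longrightarrow> x \<otimes>\<^bsub>R\<^esub> y \<in> N"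
    and "\<And>x y. x \<in> N \<Longrightarrow> y \<in> N \<Longrightarrow> x \<oplus>\<^bsub>R\<^esub> y \<in> N"
  shows "I \<cdot>\<^bsub>R\<^esub> J \<subseteq> N"
proof
  fix x assume "x \<in> I \<cdot>\<^bsub>R\<^esub> J"
  thus "x \<in> N" by (induct rule: ideal_prod.induct) (auto intro: assms)
qed

context cring begin

text \<open>\<open>rcoset_mult\<close> is a union over all pairs of representatives. It collapses to
  one coset because (j + a)(s + x) - a x = j (s + x) + a s, where j (s + x) is a product of two
  elements of \<open>J\<close> and a s stays in the ideal \<open>J \<cdot> J\<close>.\<close>

lemma cotangent_smult:
  assumes J: "ideal J R" and "a \<in> carrier R" "x \<in> J"
  shows "rcoset_mult R (J \<cdot> J) (J +> a) ((J \<cdot> J) +> x) = (J \<cdot> J) +> (a \<otimes> x)"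
proof -
  interpret J: ideal J R by fact
  interpret J2: ideal "J \<cdot> J" R using ideal_prod_is_ideal[OF J J] .
  have x: "x \<in> carrier R" using assms J.Icarr by blast
  have eq: "(J \<cdot> J) +> (a' \<otimes> x') = (J \<cdot> J) +> (a \<otimes> x)"
    if asm: "a' \<in> J +> a" "x' \<in> (J \<cdot> J) +> x" for a' x'
  proof -
    obtain j s where js: "j \<in> J" "a' = j \<oplus> a" "s \<in> J \<cdot> J" "x' = s \<oplus> x"
      using asm by (auto simp: a_r_coset_def r_coset_def)
    have s: "s \<in> J" using js(3) ideal_prod_inter[OF J J] by blast
    note C = J.Icarr[OF js(1)] J.Icarr[OF s] x assms(2)
    have "a' \<otimes> x' = (j \<otimes> (s \<oplus> x) \<oplus> a \<otimes> s) \<oplus> a \<otimes> x"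
      unfolding js using C by algebra
    moreover have "j \<otimes> (s \<oplus> x) \<in> J \<cdot> J"
      using js(1) s assms(3) by (intro ideal_prod.prod) auto
    moreover have "a \<otimes> s \<in> J \<cdot> J" using assms(2) js(3) J2.I_l_closed by blast
    ultimately have "a' \<otimes> x' \<in> (J \<cdot> J) +> (a \<otimes> x)"
      by (auto simp: a_r_coset_def r_coset_def)
    thus ?thesis using J2.a_repr_independence' x assms(2) by blast
  qed
  have "a \<in> J +> a" "x \<in> (J \<cdot> J) +> x" using J.a_rcos_self J2.a_rcos_self assms x by auto
  thus ?thesis unfolding rcoset_mult_def using eq by blast
qed

text \<open>Vectors and scalars are classes of elements of \<open>J\<close> and of \<open>R\<close>,
  and the operations act on representatives, so each module law is the image of a ring law.\<close>

lemma cotangent_module_vectorspace: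
  assumes "maximalideal J R"
  shows "vectorspace (R Quot J) (cotangent_module R J)"
proof -
  interpret M: maximalideal J R by fact
  have J: "ideal J R" ..
  interpret J2: ideal "J \<cdot> J" R using ideal_prod_is_ideal[OF J J] .
  let ?V = "cotangent_module R J" and ?q = "\<lambda>x. (J \<cdot> J) +> x"
  have fld: "field (R Quot J)" using M.quotient_is_field is_cring by blast
  note V = cotangent_module_def[of R J]
  have Jc: "\<And>x. x \<in> J \<Longrightarrow> x \<in> carrier R" using M.Icarr .
  have add: "?q x \<oplus>\<^bsub>?V\<^esub> ?q y = ?q (x \<oplus> y)" if "x \<in> J" "y \<in> J" for x y
    unfolding V using J2.a_rcos_sum that Jc by simp
  have car: "carrier ?V = ?q ` J" unfolding V by auto
  have zero: "\<zero>\<^bsub>?V\<^esub> = ?q \<zero>" unfolding V using a_rcos_zero[OF J2.is_ideal, of \<zero>] by simp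
  have smult: "(J +> a) \<odot>\<^bsub>?V\<^esub> ?q x = ?q (a \<otimes> x)" if "a \<in> carrier R" "x \<in> J" for a x
    unfolding V using cotangent_smult[OF J that] by simp
  have Qc: "carrier (R Quot J) = (\<lambda>a. J +> a) ` carrier R"
    unfolding FactRing_simps by auto
  have "abelian_group ?V"
  proof (rule abelian_groupI)
    fix v w assume "v \<in> carrier ?V" "w \<in> carrier ?V"
    then obtain x y where xy: "x \<in> J" "y \<in> J" "v = ?q x" "w = ?q y" unfolding car by blast
    show "v \<oplus>\<^bsub>?V\<^esub> w \<in> carrier ?V" using xy add car by simp
    show "v \<oplus>\<^bsub>?V\<^esub> w = w \<oplus>\<^bsub>?V\<^esub> v" using xy add Jc by (simp add: a_comm)
    fix u assume "u \<in> carrier ?V"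
    then obtain z where z: "z \<in> J" "u = ?q z" unfolding car by blast
    show "v \<oplus>\<^bsub>?V\<^esub> w \<oplus>\<^bsub>?V\<^esub> u = v \<oplus>\<^bsub>?V\<^esub> (w \<oplus>\<^bsub>?V\<^esub> u)" using xy z add Jc by (simp add: a_assoc)
  next
    show "\<zero>\<^bsub>?V\<^esub> \<in> carrier ?V" unfolding car zero by simp
  next
    fix v assume "v \<in> carrier ?V"
    then obtain x where x: "x \<in> J" "v = ?q x" unfolding car by blast
    show "\<zero>\<^bsub>?V\<^esub> \<oplus>\<^bsub>?V\<^esub> v = v" unfolding zero using x add[of \<zero> x] Jc by simp
    have "?q (\<ominus> x) \<oplus>\<^bsub>?V\<^esub> v = \<zero>\<^bsub>?V\<^esub>" unfolding zero using x add[of "\<ominus> x" x] Jc by (simp add: l_neg)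
    thus "\<exists>y \<in> carrier ?V. y \<oplus>\<^bsub>?V\<^esub> v = \<zero>\<^bsub>?V\<^esub>" unfolding car using x by blast
  qed
  moreover have "cring (R Quot J)" using field.axioms(1)[OF fld] domain.axioms(1) by blast
  ultimately have "module (R Quot J) ?V"
  proof (intro moduleI)
    fix \<alpha> \<beta> v assume "\<alpha> \<in> carrier (R Quot J)" "v \<in> carrier ?V"
    then obtain a x where ax: "a \<in> carrier R" "x \<in> J" "\<alpha> = J +> a" "v = ?q x" unfolding Qc car by blast
    show "\<alpha> \<odot>\<^bsub>?V\<^esub> v \<in> carrier ?V" using ax smult car M.I_l_closed by simp
    {
      assume "\<beta> \<in> carrier (R Quot J)"
      then obtain b where b: "b \<in> carrier R" "\<beta> = J +> b" unfolding Qc by blast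
      have "\<alpha> \<oplus>\<^bsub>R Quot J\<^esub> \<beta> = J +> (a \<oplus> b)"
        unfolding FactRing_def using ax b M.a_rcos_sum by simp
      thus "(\<alpha> \<oplus>\<^bsub>R Quot J\<^esub> \<beta>) \<odot>\<^bsub>?V\<^esub> v = (\<alpha> \<odot>\<^bsub>?V\<^esub> v) \<oplus>\<^bsub>?V\<^esub> (\<beta> \<odot>\<^bsub>?V\<^esub> v)"
        using ax b smult add M.I_l_closed Jc by (simp add: l_distr)
      have "\<alpha> \<otimes>\<^bsub>R Quot J\<^esub> \<beta> = J +> (a \<otimes> b)"
        unfolding FactRing_def using ax b M.rcoset_mult_add by simp
      thus "(\<alpha> \<otimes>\<^bsub>R Quot J\<^esub> \<beta>) \<odot>\<^bsub>?V\<^esub> v = \<alpha> \<odot>\<^bsub>?V\<^esub> (\<beta> \<odot>\<^bsub>?V\<^esub> v)"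
        using ax b smult M.I_l_closed Jc by (simp add: m_assoc)
    }
    fix w assume "w \<in> carrier ?V"
    then obtain y where y: "y \<in> J" "w = ?q y" unfolding car by blast
    show "\<alpha> \<odot>\<^bsub>?V\<^esub> (v \<oplus>\<^bsub>?V\<^esub> w) = (\<alpha> \<odot>\<^bsub>?V\<^esub> v) \<oplus>\<^bsub>?V\<^esub> (\<alpha> \<odot>\<^bsub>?V\<^esub> w)"
      using ax y smult add M.I_l_closed Jc by (simp add: r_distr)
  next
    fix v assume "v \<in> carrier ?V"
    then obtain x where x: "x \<in> J" "v = ?q x" unfolding car by blast
    have "\<one>\<^bsub>R Quot J\<^esub> = J +> \<one>" unfolding FactRing_def by simp
    thus "\<one>\<^bsub>R Quot J\<^esub> \<odot>\<^bsub>?V\<^esub> v = v" using x smult[of \<one> x] Jc by simp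
  qed
  thus ?thesis using fld by (rule vectorspace.intro)
qed

text \<open>Moves the dimension count back into \<open>R\<close>: generation and independence are
  tested on elements of \<open>J\<close> modulo \<open>J \<cdot> J\<close>, with coefficients modulo
  \<open>J\<close>.\<close>

lemma embedding_dim_eqI:
  assumes max: "maximalideal J R" and unique: "\<And>M. maximalideal M R \<Longrightarrow> M = J"
    and f: "\<And>i. i < n \<Longrightarrow> f i \<in> J"
    and span: "\<And>x. x \<in> J \<Longrightarrow>
      \<exists>c. c \<in> {..<n} \<rightarrow> carrier R \<and> x \<ominus> (\<Oplus>i\<in>{..<n}. c i \<otimes> f i) \<in> J \<cdot> J"
    and indep: "\<And>c. \<lbrakk> c \<in> {..<n} \<rightarrow> carrier R; (\<Oplus>i\<in>{..<n}. c i \<otimes> f i) \<in> J \<cdot> J \<rbrakk> \<Longrightarrow> c \<in> {..<n} \<rightarrow> J"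
  shows "embedding_dim R = n"
proof -
  interpret M: maximalideal J R by fact
  have J: "ideal J R" ..
  interpret J2: ideal "J \<cdot> J" R using ideal_prod_is_ideal[OF J J] .
  let ?V = "cotangent_module R J" and ?q = "\<lambda>x. (J \<cdot> J) +> x"
  interpret V: vectorspace "R Quot J" ?V using cotangent_module_vectorspace[OF max] .
  note Vd = cotangent_module_def[of R J]
  have Jc: "\<And>x. x \<in> J \<Longrightarrow> x \<in> carrier R" using M.Icarr .
  have car: "carrier ?V = ?q ` J" unfolding Vd by auto
  have Qc: "carrier (R Quot J) = (\<lambda>a. J +> a) ` carrier R"
    unfolding FactRing_simps by auto
  have zero: "\<zero>\<^bsub>?V\<^esub> = ?q \<zero>" unfolding Vd using a_rcos_zero[OF J2.is_ideal, of \<zero>] by simp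
  have q_eq: "?q x = ?q y \<longleftrightarrow> x \<ominus> y \<in> J \<cdot> J" if "x \<in> J" "y \<in> J" for x y
    using quotient_eq_iff_same_a_r_cos[OF J2.is_ideal, of x y] that Jc by simp
  have fc: "\<And>i. i < n \<Longrightarrow> f i \<in> carrier R" using f Jc by blast
  have sumJ: "(\<Oplus>i\<in>S. h i) \<in> J" if "finite S" "h \<in> S \<rightarrow> J" for h S
    using that by (induct S) (auto simp: Pi_def Jc finsum_insert)
  have qsum: "(\<Oplus>\<^bsub>?V\<^esub>i\<in>S. ?q (h i)) = ?q (\<Oplus>i\<in>S. h i)" if "finite S" "h \<in> S \<rightarrow> J" for h S
    using that
  proof (induct S)
    case empty
    thus ?case using zero by simp
  next
    case (insert i S)
    have hS: "h \<in> S \<rightarrow> J" "h i \<in> J" using insert(4) by auto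
    have "(\<Oplus>\<^bsub>?V\<^esub>k\<in>insert i S. ?q (h k)) = ?q (h i) \<oplus>\<^bsub>?V\<^esub> (\<Oplus>\<^bsub>?V\<^esub>k\<in>S. ?q (h k))"
      using insert(1,2) hS car by (intro V.finsum_insert) auto
    also have "\<dots> = ?q (h i) \<oplus>\<^bsub>?V\<^esub> ?q (\<Oplus>k\<in>S. h k)" using insert(3) hS by simp
    also have "\<dots> = ?q (h i \<oplus> (\<Oplus>k\<in>S. h k))"
      unfolding Vd using J2.a_rcos_sum hS(2) sumJ[OF insert(1) hS(1)] Jc by simp
    also have "h i \<oplus> (\<Oplus>k\<in>S. h k) = (\<Oplus>k\<in>insert i S. h k)"
      using insert(1,2) hS(2) Jc hS(1)[THEN funcset_mem] by (intro finsum_insert[symmetric]) auto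
    finally show ?case .
  qed
  define g where "g i = ?q (f i)" for i
  have inj: "inj_on g {..<n}"
  proof (rule inj_onI)
    fix i j assume ij: "i \<in> {..<n}" "j \<in> {..<n}" "g i = g j"
    show "i = j"
    proof (rule ccontr)
      assume "i \<noteq> j"
      \<comment> \<open>Two equal classes would make \<open>f i \<ominus> f j\<close> a relation
        whose coefficient 1 lies outside \<open>J\<close>.\<close>
      define c where "c k = (if i = k then \<one> else if j = k then \<ominus> \<one> else \<zero>)" for k
      have c: "c \<in> {..<n} \<rightarrow> carrier R" unfolding c_def by auto
      have "(\<Oplus>k\<in>{..<n}. c k \<otimes> f k) =
        (\<Oplus>k\<in>{..<n}. (if i = k then f k else \<zero>) \<oplus> (if j = k then \<ominus> f k else \<zero>))"
        unfolding c_def using fc \<open>i \<noteq> j\<close> by (intro finsum_cong') (auto simp: l_minus)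
      also have "\<dots> = (\<Oplus>k\<in>{..<n}. if i = k then f k else \<zero>) \<oplus> (\<Oplus>k\<in>{..<n}. if j = k then \<ominus> f k else \<zero>)"
        using fc by (intro finsum_addf) auto
      also have "\<dots> = f i \<oplus> \<ominus> f j"
        using ij fc add.finprod_singleton[of i "{..<n}" f] add.finprod_singleton[of j "{..<n}" "\<lambda>k. \<ominus> f k"]
        by (simp add: finsum_def Pi_def)
      also have "\<dots> \<in> J \<cdot> J" using q_eq[of "f i" "f j"] ij f unfolding g_def minus_eq by auto
      finally have "c \<in> {..<n} \<rightarrow> J" using indep c by blast
      hence "\<one> \<in> J" using ij unfolding c_def by (auto simp: Pi_def split: if_splits)
      thus False using M.one_imp_carrier M.I_notcarr by auto
    qed
  qed
  have lincomb: "V.lincomb a (g ` {..<n}) = ?q (\<Oplus>i\<in>{..<n}. c i \<otimes> f i)"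
    if "\<And>i. i < n \<Longrightarrow> c i \<in> carrier R \<and> a (g i) = J +> c i" for a c
  proof -
    have s: "a (g i) \<odot>\<^bsub>?V\<^esub> g i = ?q (c i \<otimes> f i)" if "i < n" for i
      unfolding g_def Vd using cotangent_smult[OF J, of "c i" "f i"] \<open>i < n\<close> that f
      using \<open>\<And>i. i < n \<Longrightarrow> c i \<in> carrier R \<and> a (g i) = J +> c i\<close>[of i] by (simp add: g_def)
    have cf: "c i \<otimes> f i \<in> J" if "i < n" for i
      using M.I_l_closed f \<open>\<And>i. i < n \<Longrightarrow> c i \<in> carrier R \<and> a (g i) = J +> c i\<close> that by blast
    have "V.lincomb a (g ` {..<n}) = (\<Oplus>\<^bsub>?V\<^esub>i\<in>{..<n}. a (g i) \<odot>\<^bsub>?V\<^esub> g i)"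
      unfolding V.lincomb_def using s cf car by (intro V.add.finprod_reindex[folded finsum_def] inj) auto
    also have "\<dots> = (\<Oplus>\<^bsub>?V\<^esub>i\<in>{..<n}. ?q (c i \<otimes> f i))"
      using s cf car by (intro V.finsum_cong') auto
    also have "\<dots> = ?q (\<Oplus>i\<in>{..<n}. c i \<otimes> f i)"
      using cf by (intro qsum) auto
    finally show ?thesis .
  qed
  have gV: "g ` {..<n} \<subseteq> carrier ?V" unfolding car g_def using f by auto
  have "V.lin_indpt (g ` {..<n})"
  proof (rule V.finite_lin_indpt2)
    fix a assume a: "a \<in> g ` {..<n} \<rightarrow> carrier (R Quot J)" "V.lincomb a (g ` {..<n}) = \<zero>\<^bsub>?V\<^esub>"
    have "\<forall>i. \<exists>c. i < n \<longrightarrow> c \<in> carrier R \<and> a (g i) = J +> c"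
      using a(1) unfolding Qc by (auto simp: Pi_def)
    then obtain c where c: "\<And>i. i < n \<Longrightarrow> c i \<in> carrier R \<and> a (g i) = J +> c i" by metis
    have cf: "(\<lambda>i. c i \<otimes> f i) \<in> {..<n} \<rightarrow> J"
      using M.I_l_closed f c by auto
    have "?q (\<Oplus>i\<in>{..<n}. c i \<otimes> f i) = ?q \<zero>"
      using a(2) lincomb[of c a, OF c] zero by simp
    hence "(\<Oplus>i\<in>{..<n}. c i \<otimes> f i) \<ominus> \<zero> \<in> J \<cdot> J"
      using q_eq sumJ[OF _ cf] by auto
    hence "(\<Oplus>i\<in>{..<n}. c i \<otimes> f i) \<in> J \<cdot> J"
      using Jc[OF sumJ[OF _ cf]] by (simp add: minus_eq)
    hence "c \<in> {..<n} \<rightarrow> J" using indep c by auto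
    hence "a (g i) = J" if "i < n" for i using c[OF that] that a_rcos_zero[OF J] by auto
    thus "\<forall>v \<in> g ` {..<n}. a v = \<zero>\<^bsub>R Quot J\<^esub>" unfolding FactRing_def by auto
  qed (use gV in auto)
  moreover have "V.gen_set (g ` {..<n})"
  proof
    show "V.span (g ` {..<n}) \<subseteq> carrier ?V" using V.span_is_subset2 gV by blast
    show "carrier ?V \<subseteq> V.span (g ` {..<n})"
    proof
      fix v assume "v \<in> carrier ?V"
      then obtain x where x: "x \<in> J" "v = ?q x" unfolding car by blast
      obtain c where c: "c \<in> {..<n} \<rightarrow> carrier R" "x \<ominus> (\<Oplus>i\<in>{..<n}. c i \<otimes> f i) \<in> J \<cdot> J"
        using span[OF x(1)] by blast
      \<comment> \<open>A coefficient function of \<open>lincomb\<close> takes vectors as arguments,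
        hence the passage through the inverse of the injective \<open>g\<close>.\<close>
      define a where "a w = J +> c (inv_into {..<n} g w)" for w
      have a: "c i \<in> carrier R \<and> a (g i) = J +> c i" if "i < n" for i
        unfolding a_def using inv_into_f_f[OF inj, of i] that c by auto
      have cf: "(\<lambda>i. c i \<otimes> f i) \<in> {..<n} \<rightarrow> J"
        using M.I_l_closed f c by auto
      have "v = V.lincomb a (g ` {..<n})"
        using lincomb[of c a, OF a] x(2) c(2) q_eq[OF x(1) sumJ[OF _ cf]] by simp
      moreover have "a \<in> g ` {..<n} \<rightarrow> carrier (R Quot J)" using a unfolding Qc by auto
      ultimately show "v \<in> V.span (g ` {..<n})" using V.finite_span[OF _ gV] by blast
    qed
  qed
  ultimately have basis: "V.basis (g ` {..<n})" unfolding V.basis_def using gV by blast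
  have "V.dim = card (g ` {..<n})" by (rule V.dim_basis[OF _ basis]) simp
  hence "V.dim = n" using card_image[OF inj] by simp
  moreover have "(THE M. maximalideal M R) = J" by (intro the_equality max unique)
  ultimately show ?thesis unfolding embedding_dim_def by simp
qed

lemma add_diff_cancel_l: "\<lbrakk> x \<in> carrier R; y \<in> carrier R \<rbrakk> \<Longrightarrow> x \<oplus> y \<ominus> x = y"
  by algebra

lemma add_minus_cancel_r: "\<lbrakk> x \<in> carrier R; y \<in> carrier R \<rbrakk> \<Longrightarrow> x = x \<oplus> y \<oplus> \<ominus> y"
  by algebra

text \<open>Changing a coefficient by an element of \<open>J\<close> changes the sum by an element
  of \<open>J \<cdot> J\<close>, so coefficients from a set \<open>E\<close> of representatives of
  the residue field suffice. For the rings below, \<open>E\<close> is \<open>D\<close>.\<close>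

lemma embedding_dim_representativesI:
  assumes max: "maximalideal J R" and unique: "\<And>M. maximalideal M R \<Longrightarrow> M = J"
    and E: "E \<subseteq> carrier R" "\<And>a. a \<in> carrier R \<Longrightarrow> \<exists>d \<in> E. \<exists>j \<in> J. a = d \<oplus> j"
    and f: "\<And>i. i < n \<Longrightarrow> f i \<in> J"
    and span: "\<And>x. x \<in> J \<Longrightarrow> \<exists>c \<in> {..<n} \<rightarrow> E. \<exists>s \<in> J \<cdot> J. x = (\<Oplus>i\<in>{..<n}. c i \<otimes> f i) \<oplus> s"
    and indep: "\<And>c. \<lbrakk> c \<in> {..<n} \<rightarrow> E; (\<Oplus>i\<in>{..<n}. c i \<otimes> f i) \<in> J \<cdot> J \<rbrakk> \<Longrightarrow> c \<in> {..<n} \<rightarrow> J"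
  shows "embedding_dim R = n"
proof (rule embedding_dim_eqI[OF max unique f])
  interpret M: maximalideal J R by fact
  have J: "ideal J R" ..
  interpret J2: ideal "J \<cdot> J" R using ideal_prod_is_ideal[OF J J] .
  have fc: "\<And>i. i < n \<Longrightarrow> f i \<in> carrier R" using f M.Icarr by blast
  {
    fix x assume x: "x \<in> J"
    then obtain c s where c: "c \<in> {..<n} \<rightarrow> E" "s \<in> J \<cdot> J" "x = (\<Oplus>i\<in>{..<n}. c i \<otimes> f i) \<oplus> s"
      using span by blast
    have cc: "c \<in> {..<n} \<rightarrow> carrier R" using c(1) E(1) by auto
    have "(\<Oplus>i\<in>{..<n}. c i \<otimes> f i) \<in> carrier R" using cc fc by (intro finsum_closed) auto
    moreover have "s \<in> carrier R" using c(2) J2.Icarr by blast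
    ultimately have "x \<ominus> (\<Oplus>i\<in>{..<n}. c i \<otimes> f i) = s" unfolding c(3) by (rule add_diff_cancel_l)
    thus "\<exists>c. c \<in> {..<n} \<rightarrow> carrier R \<and> x \<ominus> (\<Oplus>i\<in>{..<n}. c i \<otimes> f i) \<in> J \<cdot> J"
      using cc c(2) by auto
  }
  fix c assume c: "c \<in> {..<n} \<rightarrow> carrier R" "(\<Oplus>i\<in>{..<n}. c i \<otimes> f i) \<in> J \<cdot> J"
  have "\<forall>i. \<exists>d j. i < n \<longrightarrow> d \<in> E \<and> j \<in> J \<and> c i = d \<oplus> j" using c(1) E(2) by (auto simp: Pi_def) blast
  then obtain d j where dj: "\<And>i. i < n \<Longrightarrow> d i \<in> E \<and> j i \<in> J \<and> c i = d i \<oplus> j i" by metis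
  have dc: "\<And>i. i < n \<Longrightarrow> d i \<in> carrier R" and jc: "\<And>i. i < n \<Longrightarrow> j i \<in> carrier R"
    using dj E(1) M.Icarr by blast+
  have jf: "(\<Oplus>i\<in>{..<k}. j i \<otimes> f i) \<in> J \<cdot> J" if "k \<le> n" for k
    using that
  proof (induct k)
    case 0
    thus ?case using J2.zero_closed by simp
  next
    case (Suc k)
    have "(\<Oplus>i\<in>{..<Suc k}. j i \<otimes> f i) = j k \<otimes> f k \<oplus> (\<Oplus>i\<in>{..<k}. j i \<otimes> f i)"
      unfolding lessThan_Suc using Suc(2) jc fc by (intro finsum_insert) auto
    moreover have "j k \<otimes> f k \<in> J \<cdot> J" using dj f Suc(2) by (intro ideal_prod.prod) auto
    ultimately show ?case using Suc by (simp add: J2.a_closed)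
  qed
  have "(\<Oplus>i\<in>{..<n}. c i \<otimes> f i) = (\<Oplus>i\<in>{..<n}. d i \<otimes> f i \<oplus> j i \<otimes> f i)"
    using dj dc jc fc by (intro finsum_cong') (auto simp: l_distr)
  also have "\<dots> = (\<Oplus>i\<in>{..<n}. d i \<otimes> f i) \<oplus> (\<Oplus>i\<in>{..<n}. j i \<otimes> f i)"
    using dc jc fc by (intro finsum_addf) auto
  finally have sum: "(\<Oplus>i\<in>{..<n}. c i \<otimes> f i) = (\<Oplus>i\<in>{..<n}. d i \<otimes> f i) \<oplus> (\<Oplus>i\<in>{..<n}. j i \<otimes> f i)" .
  have "(\<Oplus>i\<in>{..<n}. d i \<otimes> f i) \<in> carrier R" using dc fc by (intro finsum_closed) auto
  moreover have "(\<Oplus>i\<in>{..<n}. j i \<otimes> f i) \<in> carrier R" using jf J2.Icarr by blast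
  ultimately have "(\<Oplus>i\<in>{..<n}. d i \<otimes> f i) = (\<Oplus>i\<in>{..<n}. c i \<otimes> f i) \<oplus> \<ominus> (\<Oplus>i\<in>{..<n}. j i \<otimes> f i)"
    unfolding sum by (rule add_minus_cancel_r)
  hence "(\<Oplus>i\<in>{..<n}. d i \<otimes> f i) \<in> J \<cdot> J"
    using J2.a_closed[OF c(2) J2.a_inv_closed[OF jf[OF order_refl]]] by simp
  hence "d \<in> {..<n} \<rightarrow> J" using indep[of d] dj by auto
  thus "c \<in> {..<n} \<rightarrow> J" using dj by (auto intro!: M.a_closed)
qed

lemma embedding_dim_eq_1I:
  assumes max: "maximalideal J R" and unique: "\<And>M. maximalideal M R \<Longrightarrow> M = J"
    and E: "E \<subseteq> carrier R" "\<And>a. a \<in> carrier R \<Longrightarrow> \<exists>d \<in> E. \<exists>j \<in> J. a = d \<oplus> j"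
    and x: "x \<in> J"
    and span: "\<And>w. w \<in> J \<Longrightarrow> \<exists>a \<in> E. \<exists>s \<in> J \<cdot> J. w = a \<otimes> x \<oplus> s"
    and indep: "\<And>a. \<lbrakk> a \<in> E; a \<otimes> x \<in> J \<cdot> J \<rbrakk> \<Longrightarrow> a \<in> J"
  shows "embedding_dim R = 1"
proof (rule embedding_dim_representativesI[OF max unique E, where f = "\<lambda>_. x"])
  interpret M: maximalideal J R by fact
  have xc: "x \<in> carrier R" using x M.Icarr by blast
  have sum: "(\<Oplus>i\<in>{..<1}. c i \<otimes> x) = c 0 \<otimes> x" if "c \<in> {..<1::nat} \<rightarrow> E" for c
  proof -
    have "c 0 \<in> carrier R" using that E(1) by auto
    thus ?thesis using xc by (simp add: lessThan_Suc)
  qed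
  fix w assume "w \<in> J"
  then obtain a s where as: "a \<in> E" "s \<in> J \<cdot> J" "w = a \<otimes> x \<oplus> s" using span by blast
  thus "\<exists>c\<in>{..<1::nat} \<rightarrow> E. \<exists>s\<in>J \<cdot> J. w = (\<Oplus>i\<in>{..<1}. c i \<otimes> x) \<oplus> s"
    using sum[of "\<lambda>_. a"] by (intro bexI[of _ "\<lambda>_. a"] bexI[of _ s]) auto
next
  interpret M: maximalideal J R by fact
  have xc: "x \<in> carrier R" using x M.Icarr by blast
  fix c assume c: "c \<in> {..<1::nat} \<rightarrow> E" "(\<Oplus>i\<in>{..<1}. c i \<otimes> x) \<in> J \<cdot> J"
  have c0: "c 0 \<in> E" using c(1) by auto
  hence "c 0 \<in> carrier R" using E(1) by auto
  hence "(\<Oplus>i\<in>{..<1}. c i \<otimes> x) = c 0 \<otimes> x" using xc by (simp add: lessThan_Suc)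
  thus "c \<in> {..<1::nat} \<rightarrow> J" using indep[OF c0] c(2) by auto
qed (use x in auto)

lemma embedding_dim_eq_2I:
  assumes max: "maximalideal J R" and unique: "\<And>M. maximalideal M R \<Longrightarrow> M = J"
    and E: "E \<subseteq> carrier R" "\<And>a. a \<in> carrier R \<Longrightarrow> \<exists>d \<in> E. \<exists>j \<in> J. a = d \<oplus> j"
    and xy: "x \<in> J" "y \<in> J"
    and span: "\<And>w. w \<in> J \<Longrightarrow> \<exists>a \<in> E. \<exists>b \<in> E. \<exists>s \<in> J \<cdot> J. w = a \<otimes> x \<oplus> b \<otimes> y \<oplus> s"
    and indep: "\<And>a b. \<lbrakk> a \<in> E; b \<in> E; a \<otimes> x \<oplus> b \<otimes> y \<in> J \<cdot> J \<rbrakk> \<Longrightarrow> a \<in> J \<and> b \<in> J"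
  shows "embedding_dim R = 2"
proof -
  interpret M: maximalideal J R by fact
  have xyc: "x \<in> carrier R" "y \<in> carrier R" using xy M.Icarr by blast+
  define f where "f i = (if i = 0 then x else y)" for i :: nat
  have two: "{..<2::nat} = {0, 1}" by auto
  have sum: "(\<Oplus>i\<in>{..<2}. c i \<otimes> f i) = c 0 \<otimes> x \<oplus> c 1 \<otimes> y" if c: "c \<in> {..<2::nat} \<rightarrow> E" for c
  proof -
    have "c 0 \<in> carrier R" "c 1 \<in> carrier R" using c E(1) by (auto simp: two)
    thus ?thesis using xyc unfolding two f_def by (simp add: finsum_insert)
  qed
  show ?thesis
  proof (rule embedding_dim_representativesI[OF max unique E, where f = f])
    fix w assume "w \<in> J"
    then obtain a b s where as: "a \<in> E" "b \<in> E" "s \<in> J \<cdot> J" "w = a \<otimes> x \<oplus> b \<otimes> y \<oplus> s" using span by blast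
    have "(\<lambda>i::nat. if i = 0 then a else b) \<in> {..<2} \<rightarrow> E" using as by auto
    thus "\<exists>c\<in>{..<2::nat} \<rightarrow> E. \<exists>s\<in>J \<cdot> J. w = (\<Oplus>i\<in>{..<2}. c i \<otimes> f i) \<oplus> s"
      using sum[of "\<lambda>i. if i = 0 then a else b"] as by (intro bexI[of _ "\<lambda>i. if i = 0 then a else b"] bexI[of _ s]) auto
  next
    fix c assume c: "c \<in> {..<2::nat} \<rightarrow> E" "(\<Oplus>i\<in>{..<2}. c i \<otimes> f i) \<in> J \<cdot> J"
    have "c 0 \<in> E" "c 1 \<in> E" using c(1) by (auto simp: two)
    hence "c 0 \<in> J \<and> c 1 \<in> J" using indep c(2) unfolding sum[OF c(1)] by blast
    thus "c \<in> {..<2::nat} \<rightarrow> J" by (auto simp: two)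
  qed (use xy in \<open>auto simp: f_def\<close>)
qed

lemma embedding_dim_eq_3I:
  assumes max: "maximalideal J R" and unique: "\<And>M. maximalideal M R \<Longrightarrow> M = J"
    and E: "E \<subseteq> carrier R" "\<And>a. a \<in> carrier R \<Longrightarrow> \<exists>d \<in> E. \<exists>j \<in> J. a = d \<oplus> j"
    and xyz: "x \<in> J" "y \<in> J" "z \<in> J"
    and span: "\<And>w. w \<in> J \<Longrightarrow> \<exists>a \<in> E. \<exists>b \<in> E. \<exists>c \<in> E. \<exists>s \<in> J \<cdot> J. w = a \<otimes> x \<oplus> b \<otimes> y \<oplus> c \<otimes> z \<oplus> s"
    and indep: "\<And>a b c. \<lbrakk> a \<in> E; b \<in> E; c \<in> E; a \<otimes> x \<oplus> b \<otimes> y \<oplus> c \<otimes> z \<in> J \<cdot> J \<rbrakk> \<Longrightarrow> a \<in> J \<and> b \<in> J \<and> c \<in> J"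
  shows "embedding_dim R = 3"
proof -
  interpret M: maximalideal J R by fact
  have xyzc: "x \<in> carrier R" "y \<in> carrier R" "z \<in> carrier R" using xyz M.Icarr by blast+
  define f where "f i = (if i = 0 then x else if i = 1 then y else z)" for i :: nat
  have three: "{..<3::nat} = {0, 1, 2}" by auto
  have sum: "(\<Oplus>i\<in>{..<3}. c i \<otimes> f i) = c 0 \<otimes> x \<oplus> c 1 \<otimes> y \<oplus> c 2 \<otimes> z" if c: "c \<in> {..<3::nat} \<rightarrow> E" for c
  proof -
    have "c 0 \<in> carrier R" "c 1 \<in> carrier R" "c 2 \<in> carrier R" using c E(1) by (auto simp: three)
    thus ?thesis using xyzc unfolding three f_def by (simp add: finsum_insert a_assoc)
  qed
  show ?thesis
  proof (rule embedding_dim_representativesI[OF max unique E, where f = f])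
    fix w assume "w \<in> J"
    then obtain a b c s where as: "a \<in> E" "b \<in> E" "c \<in> E" "s \<in> J \<cdot> J"
      "w = a \<otimes> x \<oplus> b \<otimes> y \<oplus> c \<otimes> z \<oplus> s" using span by blast
    define k where "k i = (if i = 0 then a else if i = 1 then b else c)" for i :: nat
    have k: "k \<in> {..<3} \<rightarrow> E" unfolding k_def using as by auto
    have "w = (\<Oplus>i\<in>{..<3}. k i \<otimes> f i) \<oplus> s" unfolding sum[OF k] as(5) by (simp add: k_def)
    thus "\<exists>c\<in>{..<3::nat} \<rightarrow> E. \<exists>s\<in>J \<cdot> J. w = (\<Oplus>i\<in>{..<3}. c i \<otimes> f i) \<oplus> s"
      using k as(4) by blast
  next
    fix c assume c: "c \<in> {..<3::nat} \<rightarrow> E" "(\<Oplus>i\<in>{..<3}. c i \<otimes> f i) \<in> J \<cdot> J"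
    have "c 0 \<in> E" "c 1 \<in> E" "c 2 \<in> E" using c(1) by (auto simp: three)
    hence "c 0 \<in> J \<and> c 1 \<in> J \<and> c 2 \<in> J" using indep c(2) unfolding sum[OF c(1)] by blast
    thus "c \<in> {..<3::nat} \<rightarrow> J" by (auto simp: three)
  qed (use xyz in \<open>auto simp: f_def\<close>)
qed

end

section \<open>Integral elements, fractions and discrete valuation rings\<close>

context field begin

text \<open>Coefficients are listed from the highest degree, so the last one, \<open>c\<close>, is
  the constant term. If it is nonzero, the equation shows that x divides it; if it is zero, x can be
  cancelled and the monic polynomial becomes shorter.\<close>

lemma integral_divides_D:
  assumes D: "subring D R" and A: "subring A R" "D \<subseteq> A" and x: "x \<in> A" "x \<noteq> \<zero>"
    and p: "set p \<subseteq> D" "p \<noteq> []" "lead_coeff p = \<one>" "eval p x = \<zero>"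
  shows "\<exists>y \<in> A. \<exists>d \<in> D. d \<noteq> \<zero> \<and> x \<otimes> y = d"
proof -
  note clA = subringE(1,2,3)[OF A(1)] subringE(5-7)[OF A(1)]
  have DR: "D \<subseteq> carrier R" using A clA(1) by blast
  have xR: "x \<in> carrier R" using x(1) clA(1) by blast
  have ev: "eval q x \<in> A" if "set q \<subseteq> D" for q
    using that
  proof (induct q rule: rev_induct)
    case Nil thus ?case using clA(2) by simp
  next
    case (snoc c q)
    have "eval (q @ [c]) x = eval q x \<otimes> x \<oplus> c"
      using snoc(2) DR xR by (intro eval_append_aux) auto
    moreover have "c \<in> A" using snoc(2) A(2) by auto
    ultimately show ?case using snoc clA(5,6) x(1) by auto
  qed
  show ?thesis using p
  proof (induct p rule: rev_induct)
    case Nil thus ?case by simp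
  next
    case (snoc c q)
    have c: "c \<in> D" "set q \<subseteq> D" using snoc(2) by auto
    have cR: "c \<in> carrier R" "eval q x \<in> carrier R" using c DR ev[OF c(2)] clA(1) by auto
    have e: "eval q x \<otimes> x \<oplus> c = \<zero>"
      using eval_append_aux[OF subset_trans[OF c(2) DR] cR(1) xR] snoc(5) by simp
    show ?case
    proof (cases "c = \<zero>")
      case True
      hence "eval q x \<otimes> x = \<zero>" using e cR xR by simp
      hence z: "eval q x = \<zero>" using integral_iff[OF cR(2) xR] x(2) by blast
      have "q \<noteq> []" using snoc(4) True one_not_zero by auto
      thus ?thesis using snoc(1)[OF c(2) _ _ z] snoc(4) by auto
    next
      case False
      have "x \<otimes> (\<ominus> eval q x) = c \<ominus> (eval q x \<otimes> x \<oplus> c)" using cR xR by algebra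
      also have "\<dots> = c" unfolding e using cR by (simp add: minus_eq)
      finally show ?thesis using clA(4)[OF ev[OF c(2)]] c(1) False by blast
    qed
  qed
qed

lemma subfield_field_of_fractions:
  assumes D: "subring D R" shows "subfield (field_of_fractions R D) R"
proof -
  note cl = subringE(2,3)[OF D] subringE(5-7)[OF D]
  have DR: "\<And>d. d \<in> D \<Longrightarrow> d \<in> carrier R" using subringE(1)[OF D] by blast
  let ?K = "field_of_fractions R D"
  have K_I: "a \<otimes> inv b \<in> ?K" if "a \<in> D" "b \<in> D" "b \<noteq> \<zero>" for a b
    unfolding field_of_fractions_def using that by blast
  have iv: "inv b \<in> carrier R" "b \<otimes> inv b = \<one>" "inv b \<noteq> \<zero>" if "b \<in> D" "b \<noteq> \<zero>" for b
  proof -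
    have "b \<in> Units R" using that DR field_Units by auto
    thus "inv b \<in> carrier R" "b \<otimes> inv b = \<one>" by auto
    thus "inv b \<noteq> \<zero>" using DR[OF that(1)] one_not_zero by auto
  qed
  have inv_eqI: "inv z = w" if "z \<in> carrier R" "w \<in> carrier R" "z \<otimes> w = \<one>" for z w
    using comm_inv_char that by blast
  have inv_mult: "inv (b \<otimes> d) = inv b \<otimes> inv d" if bd: "b \<in> D" "b \<noteq> \<zero>" "d \<in> D" "d \<noteq> \<zero>" for b d
  proof (rule inv_eqI)
    note i = iv[OF bd(1,2)] iv[OF bd(3,4)]
    have "(b \<otimes> d) \<otimes> (inv b \<otimes> inv d) = (b \<otimes> inv b) \<otimes> (d \<otimes> inv d)"
      using i(1,4) DR[OF bd(1)] DR[OF bd(3)] by algebra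
    thus "(b \<otimes> d) \<otimes> (inv b \<otimes> inv d) = \<one>" using i by simp
  qed (use iv bd DR in auto)
  have "subring ?K R"
  proof (rule subringI)
    show "?K \<subseteq> carrier R" unfolding field_of_fractions_def using iv DR by auto
    have "\<one> = \<one> \<otimes> inv \<one>" using iv[of \<one>] cl(2) one_not_zero by simp
    thus "\<one> \<in> ?K" using K_I[of \<one> \<one>] cl(2) one_not_zero by simp
    fix x assume "x \<in> ?K"
    then obtain a b where ab: "a \<in> D" "b \<in> D" "b \<noteq> \<zero>" "x = a \<otimes> inv b" unfolding field_of_fractions_def by blast
    note i = iv[OF ab(2,3)]
    have "\<ominus> x = (\<ominus> a) \<otimes> inv b" unfolding ab(4) using i(1) DR[OF ab(1)] by algebra
    thus "\<ominus> x \<in> ?K" using K_I cl(3) ab by simp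
    fix y assume "y \<in> ?K"
    then obtain c d where cd: "c \<in> D" "d \<in> D" "d \<noteq> \<zero>" "y = c \<otimes> inv d" unfolding field_of_fractions_def by blast
    note j = iv[OF cd(2,3)]
    note C = DR[OF ab(1)] DR[OF ab(2)] DR[OF cd(1)] DR[OF cd(2)] i(1) j(1)
    have bd: "b \<otimes> d \<in> D" "b \<otimes> d \<noteq> \<zero>" using cl(4) ab cd C integral_iff by auto
    have "x \<otimes> y = (a \<otimes> c) \<otimes> inv (b \<otimes> d)"
      unfolding inv_mult[OF ab(2,3) cd(2,3)] ab(4) cd(4) using C by algebra
    thus "x \<otimes> y \<in> ?K" using K_I[OF cl(4)[OF ab(1) cd(1)] bd] by simp
    have "x \<oplus> y = a \<otimes> (d \<otimes> inv d) \<otimes> inv b \<oplus> c \<otimes> (b \<otimes> inv b) \<otimes> inv d"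
      unfolding i(2) j(2) ab(4) cd(4) using C by simp
    also have "\<dots> = (a \<otimes> d \<oplus> c \<otimes> b) \<otimes> inv (b \<otimes> d)"
      unfolding inv_mult[OF ab(2,3) cd(2,3)] using C by algebra
    finally show "x \<oplus> y \<in> ?K"
      using K_I[OF cl(5)[OF cl(4)[OF ab(1) cd(2)] cl(4)[OF cd(1) ab(2)]] bd] by simp
  qed
  thus ?thesis
  proof (rule subfieldI')
    fix x assume "x \<in> ?K - {\<zero>}"
    then obtain a b where ab: "a \<in> D" "b \<in> D" "b \<noteq> \<zero>" "x = a \<otimes> inv b" "x \<noteq> \<zero>"
      unfolding field_of_fractions_def by blast
    note i = iv[OF ab(2,3)]
    have a0: "a \<noteq> \<zero>" using ab(4,5) i(1) by auto
    note j = iv[OF ab(1) a0]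
    have "inv x = b \<otimes> inv a"
    proof (rule inv_eqI)
      have "x \<otimes> (b \<otimes> inv a) = (a \<otimes> inv a) \<otimes> (b \<otimes> inv b)"
        unfolding ab(4) using i(1) j(1) DR[OF ab(1)] DR[OF ab(2)] by algebra
      thus "x \<otimes> (b \<otimes> inv a) = \<one>" using i j by simp
    qed (use ab(4) i(1) j(1) DR[OF ab(1)] DR[OF ab(2)] in auto)
    thus "inv x \<in> ?K" using K_I[OF ab(2,1) a0] by simp
  qed
qed

lemma common_denominator:
  assumes D: "subring D R" and "set Ks \<subseteq> field_of_fractions R D"
  shows "\<exists>d \<in> D. d \<noteq> \<zero> \<and> (\<forall>k \<in> set Ks. d \<otimes> k \<in> D)"
  using assms(2)
proof (induct Ks)
  case Nil
  thus ?case using subringE(3)[OF D] by (intro bexI[of _ \<one>]) auto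
next
  case (Cons k Ks)
  have DR: "\<And>d. d \<in> D \<Longrightarrow> d \<in> carrier R" using subringE(1)[OF D] by blast
  obtain d where d: "d \<in> D" "d \<noteq> \<zero>" "\<forall>k \<in> set Ks. d \<otimes> k \<in> D" using Cons by auto
  obtain a b where ab: "a \<in> D" "b \<in> D" "b \<noteq> \<zero>" "k = a \<otimes> inv b"
    using Cons(2) unfolding field_of_fractions_def by auto
  have "b \<in> Units R" using ab DR field_Units by auto
  hence i: "inv b \<in> carrier R" "b \<otimes> inv b = \<one>" by auto
  have KR: "field_of_fractions R D \<subseteq> carrier R"
    using subfieldE(3)[OF subfield_field_of_fractions[OF D]] .
  have "(b \<otimes> d) \<otimes> k = d \<otimes> a \<otimes> (b \<otimes> inv b)"
    unfolding ab(4) using i(1) DR ab d by (simp add: m_ac)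
  hence "(b \<otimes> d) \<otimes> k \<in> D" using i DR ab d subringE(6)[OF D] by simp
  moreover have "(b \<otimes> d) \<otimes> k' \<in> D" if k': "k' \<in> set Ks" for k'
  proof -
    have "k' \<in> carrier R" using k' Cons(2) KR by auto
    hence "(b \<otimes> d) \<otimes> k' = b \<otimes> (d \<otimes> k')" using DR ab d by (simp add: m_assoc)
    thus ?thesis using d(3) k' ab(2) subringE(6)[OF D] by simp
  qed
  moreover have "b \<otimes> d \<in> D" "b \<otimes> d \<noteq> \<zero>" using ab d DR subringE(6)[OF D] integral_iff by auto
  ultimately show ?case by (intro bexI[of _ "b \<otimes> d"]) auto
qed

text \<open>A relation over the fraction field, multiplied by a common denominator, stays nontrivial
  since \<open>L\<close> has no zero divisors. Later arguments then meet coefficients in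
  \<open>D\<close> only.\<close>

lemma four_dependent_over_subring:
  assumes D: "subring D R" and dim: "dimension 3 (field_of_fractions R D) (carrier R)"
    and wxyz: "w \<in> carrier R" "x \<in> carrier R" "y \<in> carrier R" "z \<in> carrier R"
  shows "\<exists>a \<in> D. \<exists>b \<in> D. \<exists>c \<in> D. \<exists>d \<in> D. \<not> (a = \<zero> \<and> b = \<zero> \<and> c = \<zero> \<and> d = \<zero>) \<and>
    a \<otimes> w \<oplus> b \<otimes> x \<oplus> c \<otimes> y \<oplus> d \<otimes> z = \<zero>"
proof -
  let ?K = "field_of_fractions R D" and ?Us = "[w, x, y, z]"
  have sub: "subfield ?K R" by (rule subfield_field_of_fractions[OF D])
  have Us: "set ?Us \<subseteq> carrier R" using wxyz by simp
  have "\<not> independent ?K ?Us"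
    using independent_length_le_dimension[OF sub dim _ Us] by auto
  then obtain Ks where Ks: "length Ks = length ?Us" "combine Ks ?Us = \<zero>" "set Ks \<subseteq> ?K" "set Ks \<noteq> {\<zero>}"
    using dependent_imp_non_trivial_combine[OF sub Us] by blast
  obtain d where d: "d \<in> D" "d \<noteq> \<zero>" "\<forall>k \<in> set Ks. d \<otimes> k \<in> D" using common_denominator[OF D Ks(3)] by blast
  have dR: "d \<in> carrier R" using d(1) subringE(1)[OF D] by blast
  obtain a b c e where abce: "Ks = [a, b, c, e]"
    using Ks(1) by (auto simp: numeral_eq_Suc length_Suc_conv)
  have KR: "a \<in> carrier R" "b \<in> carrier R" "c \<in> carrier R" "e \<in> carrier R"
    using Ks(3) subfieldE(3)[OF sub] unfolding abce by auto
  have "(d \<otimes> a) \<otimes> w \<oplus> (d \<otimes> b) \<otimes> x \<oplus> (d \<otimes> c) \<otimes> y \<oplus> (d \<otimes> e) \<otimes> z =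
      d \<otimes> (a \<otimes> w \<oplus> (b \<otimes> x \<oplus> (c \<otimes> y \<oplus> (e \<otimes> z \<oplus> \<zero>))))"
    using KR dR wxyz by (simp add: r_distr m_assoc a_assoc)
  also have "\<dots> = \<zero>" using Ks(2) dR unfolding abce by simp
  finally have sum: "(d \<otimes> a) \<otimes> w \<oplus> (d \<otimes> b) \<otimes> x \<oplus> (d \<otimes> c) \<otimes> y \<oplus> (d \<otimes> e) \<otimes> z = \<zero>" .
  have "\<not> (a = \<zero> \<and> b = \<zero> \<and> c = \<zero> \<and> e = \<zero>)" using Ks(4) unfolding abce by auto
  hence nz: "\<not> (d \<otimes> a = \<zero> \<and> d \<otimes> b = \<zero> \<and> d \<otimes> c = \<zero> \<and> d \<otimes> e = \<zero>)"
    using integral_iff[OF dR] KR d(2) by blast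
  have "d \<otimes> a \<in> D" "d \<otimes> b \<in> D" "d \<otimes> c \<in> D" "d \<otimes> e \<in> D" using d(3) unfolding abce by auto
  thus ?thesis using sum nz by blast
qed

lemma integral_closure_contains:
  assumes D: "subring D R" shows "D \<subseteq> integral_closure R D"
proof
  fix d assume d: "d \<in> D"
  have dR: "d \<in> carrier R" using d subringE(1)[OF D] by blast
  have "polynomial D [\<one>, \<ominus> d]" unfolding polynomial_def using subringE(3,5)[OF D] d by auto
  moreover have "eval [\<one>, \<ominus> d] d = \<zero>" using dR by (simp add: r_neg)
  ultimately show "d \<in> integral_closure R D"
    unfolding integral_closure_def using dR by (intro CollectI conjI exI[of _ "[\<one>, \<ominus> d]"]) auto
qed

end

text \<open>If t were 0, the zero ideal would be maximal and \<open>D\<close> a field. A nonzero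
  nonunit has an irreducible divisor, which in a principal domain generates a maximal ideal; as
  there is only one, this is the ideal of t.\<close>

lemma discrete_valuation_ring_cases:
  assumes L: "field L" and D: "subring D L" and dvr: "discrete_valuation_ring (L\<lparr>carrier := D\<rparr>)"
    and t: "t \<in> D" "maximalideal (PIdl\<^bsub>L\<lparr>carrier := D\<rparr>\<^esub> t) (L\<lparr>carrier := D\<rparr>)"
  shows "t \<noteq> \<zero>\<^bsub>L\<^esub>"
    and "d \<in> D \<Longrightarrow> (\<exists>b \<in> D. d = t \<otimes>\<^bsub>L\<^esub> b) \<or> (\<exists>b \<in> D. d \<otimes>\<^bsub>L\<^esub> b = \<one>\<^bsub>L\<^esub>)"
proof -
  interpret L: field L by fact
  let ?D = "L\<lparr>carrier := D\<rparr>"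
  interpret D: principal_domain ?D using dvr unfolding discrete_valuation_ring_def by blast
  show t0: "t \<noteq> \<zero>\<^bsub>L\<^esub>"
  proof
    assume "t = \<zero>\<^bsub>L\<^esub>"
    hence "a \<otimes>\<^bsub>L\<^esub> t = \<zero>\<^bsub>L\<^esub>" if "a \<in> D" for a using that subringE(1)[OF D] by auto
    hence "PIdl\<^bsub>?D\<^esub> t = {\<zero>\<^bsub>?D\<^esub>}"
      unfolding cgenideal_subring using subringE(2)[OF D] by force
    hence "field ?D" using D.zeromaximalideal_fieldI t(2) by simp
    thus False using dvr unfolding discrete_valuation_ring_def by blast
  qed
  assume d: "d \<in> D"
  show "(\<exists>b \<in> D. d = t \<otimes>\<^bsub>L\<^esub> b) \<or> (\<exists>b \<in> D. d \<otimes>\<^bsub>L\<^esub> b = \<one>\<^bsub>L\<^esub>)"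
  proof (cases "d \<in> Units ?D")
    case True
    thus ?thesis unfolding Units_def by auto
  next
    case False
    show ?thesis
    proof (cases "d = \<zero>\<^bsub>L\<^esub>")
      case True
      hence "d = t \<otimes>\<^bsub>L\<^esub> \<zero>\<^bsub>L\<^esub>" using t(1) subringE(1)[OF D] by auto
      thus ?thesis using subringE(2)[OF D] by blast
    next
      case nz: False
      obtain b where b: "b \<in> carrier ?D" "ring_irreducible\<^bsub>?D\<^esub> b" "b divides\<^bsub>?D\<^esub> d"
      proof (rule D.exists_irreducible_divisor)
        show "d \<in> carrier ?D - {\<zero>\<^bsub>?D\<^esub>}" using nz d by simp
        show "d \<notin> Units ?D" by (rule False)
      qed
      have "maximalideal (PIdl\<^bsub>?D\<^esub> b) ?D" using D.irreducible_imp_maximalideal b by blast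
      hence eq: "PIdl\<^bsub>?D\<^esub> b = PIdl\<^bsub>?D\<^esub> t"
        using dvr t(2) unfolding discrete_valuation_ring_def local_ring_def by blast
      obtain c where c: "c \<in> D" "d = b \<otimes>\<^bsub>L\<^esub> c" using b(3) unfolding factor_def by auto
      have "b \<in> PIdl\<^bsub>?D\<^esub> t" using D.cgenideal_self[OF b(1)] eq by blast
      then obtain a where a: "a \<in> D" "b = a \<otimes>\<^bsub>L\<^esub> t" unfolding cgenideal_subring by blast
      have DL: "\<And>x. x \<in> D \<Longrightarrow> x \<in> carrier L" using subringE(1)[OF D] by blast
      have "d = t \<otimes>\<^bsub>L\<^esub> (a \<otimes>\<^bsub>L\<^esub> c)" unfolding c(2) a(2) using DL a(1) c(1) t(1) by (simp add: L.m_ac)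
      thus ?thesis using subringE(6)[OF D a(1) c(1)] by blast
    qed
  qed
qed

text \<open>Both 0 and d are limits of the constant sequence 0, and limits are unique.\<close>

lemma adically_complete_separated:
  assumes D: "subring D L" and L: "field L" and c: "adically_complete (L\<lparr>carrier := D\<rparr>) t" and t: "t \<in> D"
    and d: "d \<in> D" "\<And>n::nat. \<exists>b \<in> D. d = t [^]\<^bsub>L\<^esub> n \<otimes>\<^bsub>L\<^esub> b"
  shows "d = \<zero>\<^bsub>L\<^esub>"
proof -
  interpret L: field L by fact
  let ?D = "L\<lparr>carrier := D\<rparr>"
  interpret D: domain ?D using L.subdomain_is_domain L.subdomainI' D by blast
  have DL: "\<And>x. x \<in> D \<Longrightarrow> x \<in> carrier L" using subringE(1)[OF D] by blast
  have tn: "t [^]\<^bsub>L\<^esub> (n::nat) \<in> D" for n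
    by (induct n) (use subringE(3,6)[OF D] t in auto)
  have z: "\<zero>\<^bsub>L\<^esub> \<in> D" using subringE(2)[OF D] .
  have mem: "x \<in> PIdl\<^bsub>?D\<^esub> (t [^]\<^bsub>?D\<^esub> n) \<longleftrightarrow> (\<exists>b \<in> D. x = t [^]\<^bsub>L\<^esub> n \<otimes>\<^bsub>L\<^esub> b)" for x and n :: nat
  proof -
    have comm: "b \<otimes>\<^bsub>L\<^esub> t [^]\<^bsub>L\<^esub> n = t [^]\<^bsub>L\<^esub> n \<otimes>\<^bsub>L\<^esub> b" if "b \<in> D" for b
      using L.m_comm[OF DL[OF that] DL[OF tn]] .
    have "x \<in> PIdl\<^bsub>?D\<^esub> (t [^]\<^bsub>?D\<^esub> n) \<longleftrightarrow> (\<exists>b. b \<in> D \<and> x = b \<otimes>\<^bsub>L\<^esub> t [^]\<^bsub>L\<^esub> n)"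
      unfolding cgenideal_subring nat_pow_subring by blast
    thus ?thesis by (simp add: comm Bex_def cong: conj_cong)
  qed
  have ideal: "ideal (PIdl\<^bsub>?D\<^esub> (t [^]\<^bsub>?D\<^esub> n)) ?D" for n :: nat
    by (rule D.cgenideal_ideal) (use tn in \<open>simp add: nat_pow_subring\<close>)
  have zero_mem: "\<zero>\<^bsub>?D\<^esub> \<in> PIdl\<^bsub>?D\<^esub> (t [^]\<^bsub>?D\<^esub> n)" for n :: nat
    using additive_subgroup.zero_closed[OF ideal.axioms(1)[OF ideal]] .
  have neg_mem: "\<zero>\<^bsub>?D\<^esub> \<ominus>\<^bsub>?D\<^esub> x \<in> PIdl\<^bsub>?D\<^esub> (t [^]\<^bsub>?D\<^esub> n)"
    if "x \<in> PIdl\<^bsub>?D\<^esub> (t [^]\<^bsub>?D\<^esub> n)" "x \<in> D" for x and n :: nat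
    unfolding a_minus_def
    by (rule additive_subgroup.a_closed[OF ideal.axioms(1)[OF ideal] zero_mem
      additive_subgroup.a_inv_closed[OF ideal.axioms(1)[OF ideal] that(1)]])
  have ex1: "\<exists>!x. x \<in> carrier ?D \<and> (\<forall>n::nat. \<zero>\<^bsub>?D\<^esub> \<ominus>\<^bsub>?D\<^esub> x \<in> PIdl\<^bsub>?D\<^esub> (t [^]\<^bsub>?D\<^esub> n))"
    using c[unfolded adically_complete_def, rule_format, of "\<lambda>_. \<zero>\<^bsub>?D\<^esub>"] neg_mem[OF zero_mem] z by simp
  have "d \<in> carrier ?D \<and> (\<forall>n::nat. \<zero>\<^bsub>?D\<^esub> \<ominus>\<^bsub>?D\<^esub> d \<in> PIdl\<^bsub>?D\<^esub> (t [^]\<^bsub>?D\<^esub> n))"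
    using d(1) neg_mem[OF iffD2[OF mem d(2)] d(1)] by simp
  moreover have "\<zero>\<^bsub>?D\<^esub> \<in> carrier ?D \<and> (\<forall>n::nat. \<zero>\<^bsub>?D\<^esub> \<ominus>\<^bsub>?D\<^esub> \<zero>\<^bsub>?D\<^esub> \<in> PIdl\<^bsub>?D\<^esub> (t [^]\<^bsub>?D\<^esub> n))"
    using neg_mem[OF zero_mem] z by simp
  ultimately have "d = \<zero>\<^bsub>?D\<^esub>" using ex1 by blast
  thus ?thesis by simp
qed

section \<open>The valuation of a totally ramified cubic extension\<close>

text \<open>
  Condition \<open>four_dependent\<close> says that \<open>L\<close> has dimension at most 3 over the fractions of \<open>D\<close>, with
  denominators cleared.
\<close>

locale totally_ramified_cubic = field L for L (structure) +
  fixes D A :: "'a set" and t \<tau> :: 'a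
  assumes D_subring: "subring D L" and A_subring: "subring A L" and D_le_A: "D \<subseteq> A"
    and t_in_D: "t \<in> D" and t_nonzero: "t \<noteq> \<zero>" and tau_in_A: "\<tau> \<in> A"
    and t_tau: "\<exists>e \<in> A. \<exists>e' \<in> A. e \<otimes> e' = \<one> \<and> t = \<tau> [^] (3::nat) \<otimes> e"
    and tau_nonunit: "a \<in> A \<Longrightarrow> \<tau> \<otimes> a \<noteq> \<one>"
    and A_cases: "a \<in> A \<Longrightarrow> (\<exists>b \<in> A. a = \<tau> \<otimes> b) \<or> (\<exists>b \<in> A. a \<otimes> b = \<one>)"
    and D_cases: "d \<in> D \<Longrightarrow> (\<exists>b \<in> D. d = t \<otimes> b) \<or> (\<exists>b \<in> D. d \<otimes> b = \<one>)"
    and divides_t_pow: "\<lbrakk> a \<in> A; a \<noteq> \<zero> \<rbrakk> \<Longrightarrow> \<exists>n::nat. \<exists>b \<in> A. a \<otimes> b = t [^] n"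
    and four_dependent: "\<lbrakk> w \<in> carrier L; x \<in> carrier L; y \<in> carrier L; z \<in> carrier L \<rbrakk> \<Longrightarrow>
      \<exists>a \<in> D. \<exists>b \<in> D. \<exists>c \<in> D. \<exists>d \<in> D. \<not> (a = \<zero> \<and> b = \<zero> \<and> c = \<zero> \<and> d = \<zero>) \<and>
        a \<otimes> w \<oplus> b \<otimes> x \<oplus> c \<otimes> y \<oplus> d \<otimes> z = \<zero>"
begin

lemma A_carrier [simp]: "a \<in> A \<Longrightarrow> a \<in> carrier L"
  and D_A [simp]: "d \<in> D \<Longrightarrow> d \<in> A"
  and D_carrier [simp]: "d \<in> D \<Longrightarrow> d \<in> carrier L"
  using subringE(1)[OF A_subring] D_le_A by auto

lemmas A_closed [simp, intro] = subringE(2,3)[OF A_subring] subringE(5-7)[OF A_subring]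
lemmas D_closed [simp, intro] = subringE(2,3)[OF D_subring] subringE(5-7)[OF D_subring]
lemmas [simp, intro] = t_in_D tau_in_A

lemma A_minus [simp, intro]: "\<lbrakk> a \<in> A; b \<in> A \<rbrakk> \<Longrightarrow> a \<ominus> b \<in> A"
  and D_minus [simp, intro]: "\<lbrakk> c \<in> D; d \<in> D \<rbrakk> \<Longrightarrow> c \<ominus> d \<in> D"
  unfolding minus_eq by auto

lemma A_pow [simp, intro]: "a \<in> A \<Longrightarrow> a [^] (n::nat) \<in> A"
  and D_pow [simp, intro]: "d \<in> D \<Longrightarrow> d [^] (n::nat) \<in> D"
  by (induct n) auto

text \<open>Serves both parities at once: p is the valuation of \<alpha>, q that of \<gamma>, and p
  - 1 is the parity of r.\<close>

abbreviation complementary :: "nat \<Rightarrow> nat \<Rightarrow> bool" where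
  "complementary p q \<equiv> p = 1 \<and> q = 2 \<or> p = 2 \<and> q = 1"

lemma t_carrier: "t \<in> carrier L" and t_pow_carrier: "t [^] (n::nat) \<in> carrier L"
  by auto

definition unit :: "'a \<Rightarrow> bool" where
  "unit u \<longleftrightarrow> u \<in> A \<and> (\<exists>u' \<in> A. u \<otimes> u' = \<one>)"

definition F :: "nat \<Rightarrow> 'a set" where
  "F n = {\<tau> [^] n \<otimes> a | a. a \<in> A}"

text \<open>
  \<open>F n\<close> consists of the elements of valuation at least \<open>n\<close>, including zero, whereas \<open>has_val x n\<close>
  says that \<open>x\<close> has valuation exactly \<open>n\<close>.
\<close>

definition has_val :: "'a \<Rightarrow> nat \<Rightarrow> bool" where
  "has_val x n \<longleftrightarrow> (\<exists>u. unit u \<and> x = \<tau> [^] n \<otimes> u)"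

lemma unit_A [simp]: "unit u \<Longrightarrow> u \<in> A"
  unfolding unit_def by auto

lemma unit_one [simp]: "unit \<one>" unfolding unit_def by auto

lemma unit_mult [simp]:
  assumes "unit u" "unit w" shows "unit (u \<otimes> w)"
proof -
  obtain u' w' where "u' \<in> A" "w' \<in> A" "u \<otimes> u' = \<one>" "w \<otimes> w' = \<one>"
    using assms unfolding unit_def by blast
  moreover have "(u \<otimes> w) \<otimes> (u' \<otimes> w') = (u \<otimes> u') \<otimes> (w \<otimes> w')"
    using A_carrier[OF calculation(1)] A_carrier[OF calculation(2)] unit_A[OF assms(1), THEN A_carrier]
      unit_A[OF assms(2), THEN A_carrier] by algebra
  ultimately show ?thesis using assms unfolding unit_def by auto
qed

lemma F_zero [simp]: "F 0 = A"
proof -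
  have "x \<in> F 0" if "x \<in> A" for x
    unfolding F_def using that by (intro CollectI exI[of _ x]) simp
  thus ?thesis unfolding F_def by auto
qed

lemma F_A [simp]: "x \<in> F n \<Longrightarrow> x \<in> A"
  unfolding F_def by auto

lemma F_I: "a \<in> A \<Longrightarrow> \<tau> [^] n \<otimes> a \<in> F n"
  unfolding F_def by auto

lemma F_Suc_le: "F (Suc n) \<subseteq> F n"
proof
  fix x assume "x \<in> F (Suc n)"
  then obtain a where a: "a \<in> A" "x = \<tau> [^] Suc n \<otimes> a" unfolding F_def by blast
  hence "x = \<tau> [^] n \<otimes> (\<tau> \<otimes> a)" by (simp add: m_assoc)
  thus "x \<in> F n" using a unfolding F_def by auto
qed

lemma F_antimono: "m \<le> n \<Longrightarrow> F n \<subseteq> F m"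
  by (rule lift_Suc_antimono_le[of F, OF F_Suc_le])

lemma F_mono: "\<lbrakk> x \<in> F n; m \<le> n \<rbrakk> \<Longrightarrow> x \<in> F m"
  using F_antimono by blast

lemma F_closed [simp, intro]:
  "\<zero> \<in> F n"
  "x \<in> F n \<Longrightarrow> y \<in> F n \<Longrightarrow> x \<oplus> y \<in> F n"
  "x \<in> F n \<Longrightarrow> \<ominus> x \<in> F n"
  "x \<in> F n \<Longrightarrow> a \<in> A \<Longrightarrow> x \<otimes> a \<in> F n"
  "x \<in> F n \<Longrightarrow> a \<in> A \<Longrightarrow> a \<otimes> x \<in> F n"
proof -
  show "\<zero> \<in> F n" using F_I[of \<zero> n] by simp
  assume "x \<in> F n"
  then obtain b where b: "b \<in> A" "x = \<tau> [^] n \<otimes> b" unfolding F_def by blast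
  { assume "y \<in> F n"
    then obtain c where c: "c \<in> A" "y = \<tau> [^] n \<otimes> c" unfolding F_def by blast
    have "x \<oplus> y = \<tau> [^] n \<otimes> (b \<oplus> c)" using b c by (simp add: r_distr)
    thus "x \<oplus> y \<in> F n" using F_I b c by auto }
  have "\<ominus> x = \<tau> [^] n \<otimes> (\<ominus> b)" using b by (simp add: r_minus)
  thus "\<ominus> x \<in> F n" using F_I b by auto
  assume a: "a \<in> A"
  have "x \<otimes> a = \<tau> [^] n \<otimes> (b \<otimes> a)" using b a by (simp add: m_assoc)
  thus xa: "x \<otimes> a \<in> F n" using F_I b a by auto
  have "a \<otimes> x = x \<otimes> a" using b a by (simp add: m_comm)
  thus "a \<otimes> x \<in> F n" using xa by simp
qed

lemma F_minus [simp, intro]: "x \<in> F n \<Longrightarrow> y \<in> F n \<Longrightarrow> x \<ominus> y \<in> F n"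
  unfolding minus_eq by auto

lemma F_mult:
  assumes "x \<in> F m" "y \<in> F n" shows "x \<otimes> y \<in> F (m + n)"
proof -
  obtain a b where ab: "a \<in> A" "b \<in> A" "x = \<tau> [^] m \<otimes> a" "y = \<tau> [^] n \<otimes> b"
    using assms unfolding F_def by blast
  have "x \<otimes> y = \<tau> [^] (m + n) \<otimes> (a \<otimes> b)"
    using ab by (simp add: nat_pow_mult[symmetric] m_ac)
  thus ?thesis using F_I ab by auto
qed

lemma F_cancel_add: "\<lbrakk> x \<in> A; y \<in> F n; x \<oplus> y \<in> F n \<rbrakk> \<Longrightarrow> x \<in> F n"
proof -
  assume a: "x \<in> A" "y \<in> F n" "x \<oplus> y \<in> F n"
  have "x = (x \<oplus> y) \<ominus> y" using A_carrier[OF a(1)] A_carrier[OF F_A[OF a(2)]] by algebra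
  thus "x \<in> F n" using F_minus[OF a(3,2)] by simp
qed

lemma tau_nonzero: "\<tau> \<noteq> \<zero>"
  using t_tau t_nonzero by (auto simp: numeral_3_eq_3)

lemma tau_pow_nonzero [simp]: "\<tau> [^] (n::nat) \<noteq> \<zero>"
  using tau_nonzero by (induct n) (auto simp: integral_iff)

lemma t_pow_nonzero [simp]: "t [^] (n::nat) \<noteq> \<zero>"
  using t_nonzero by (induct n) (auto simp: integral_iff)

lemma unit_notin_F: "unit u \<Longrightarrow> u \<notin> F 1"
proof
  assume u: "unit u" "u \<in> F 1"
  then obtain u' a where u': "u' \<in> A" "u \<otimes> u' = \<one>" "a \<in> A" "u = \<tau> \<otimes> a"
    unfolding unit_def F_def by auto
  have "\<tau> \<otimes> (a \<otimes> u') = \<one>" using u' by (simp add: m_assoc)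
  thus False using tau_nonunit[of "a \<otimes> u'"] u' by auto
qed

lemma A_unit_or_F: "a \<in> A \<Longrightarrow> a \<in> F 1 \<or> unit a"
  using A_cases[of a] unfolding unit_def F_def by auto

text \<open>Turns inequalities of valuations into membership in the filtration. Were m > n,
  cancelling \<open>\<tau> [^] n\<close> would leave a unit divisible by \<tau>.\<close>

lemma has_val_F: assumes "has_val x n" shows "x \<in> F m \<longleftrightarrow> m \<le> n"
proof
  obtain u where u: "unit u" "x = \<tau> [^] n \<otimes> u" using assms unfolding has_val_def by blast
  show "m \<le> n \<Longrightarrow> x \<in> F m" using F_mono[of x n m] F_I[of u n] u by simp
  assume "x \<in> F m"
  show "m \<le> n"
  proof (rule ccontr)
    assume "\<not> m \<le> n"
    hence "x \<in> F (Suc n)" using F_mono[OF \<open>x \<in> F m\<close>] by simp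
    then obtain a where a: "a \<in> A" "x = \<tau> [^] Suc n \<otimes> a" unfolding F_def by blast
    hence "\<tau> [^] n \<otimes> u = \<tau> [^] n \<otimes> (\<tau> \<otimes> a)" using u by (simp add: m_assoc)
    hence "u = \<tau> \<otimes> a" using m_lcancel[of "\<tau> [^] n" u "\<tau> \<otimes> a"] u a by simp
    hence "u \<in> F 1" using a F_I[of a 1] by simp
    thus False using unit_notin_F u by blast
  qed
qed

lemma has_val_A [simp]: "has_val x n \<Longrightarrow> x \<in> A"
  unfolding has_val_def by auto

lemma has_val_carrier [simp]: "has_val x n \<Longrightarrow> x \<in> carrier L"
  using has_val_A A_carrier by blast

lemma has_val_nonzero: "has_val x n \<Longrightarrow> x \<noteq> \<zero>"
  using has_val_F[of x n "Suc n"] by auto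

lemma has_val_mult:
  assumes "has_val x m" "has_val y n" shows "has_val (x \<otimes> y) (m + n)"
proof -
  obtain a b where ab: "unit a" "unit b" "x = \<tau> [^] m \<otimes> a" "y = \<tau> [^] n \<otimes> b"
    using assms unfolding has_val_def by blast
  have "x \<otimes> y = \<tau> [^] (m + n) \<otimes> (a \<otimes> b)"
    using ab by (simp add: nat_pow_mult[symmetric] m_ac)
  moreover have "unit (a \<otimes> b)" using ab by simp
  ultimately show ?thesis unfolding has_val_def by blast
qed

lemma has_val_tau: "has_val \<tau> 1"
  unfolding has_val_def by (rule exI[of _ \<one>]) simp

lemma has_val_tau_square: "has_val (\<tau> \<otimes> \<tau>) 2"
  using has_val_mult[OF has_val_tau has_val_tau] by (simp add: numeral_2_eq_2)

lemma has_val_one: "has_val \<one> 0"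
  unfolding has_val_def by (rule exI[of _ \<one>]) simp

lemma has_val_t: "has_val t 3"
  using t_tau unfolding has_val_def unit_def by blast

lemma t_in_F: "t \<in> F 1" "t \<in> F 3"
  using has_val_F[OF has_val_t] by simp_all

lemma has_val_pow: "has_val x m \<Longrightarrow> has_val (x [^] (n::nat)) (m * n)"
proof (induct n)
  case (Suc n)
  thus ?case using has_val_mult[of "x [^] n" "m * n" x m] by (simp add: add.commute)
qed (simp add: has_val_one)

lemma has_val_t_pow: "has_val (t [^] (n::nat)) (3 * n)"
  using has_val_pow[OF has_val_t] by simp

lemma has_valI: assumes "x \<in> F n" "x \<notin> F (Suc n)" shows "has_val x n"
proof -
  obtain a where a: "a \<in> A" "x = \<tau> [^] n \<otimes> a" using assms unfolding F_def by blast
  have "a \<notin> F 1"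
  proof
    assume "a \<in> F 1"
    hence "x \<in> F (n + 1)" using F_mult[of "\<tau> [^] n" n a 1] F_I[of \<one> n] a by simp
    thus False using assms by simp
  qed
  thus ?thesis using A_unit_or_F a unfolding has_val_def by blast
qed

lemma has_val_iff: "has_val x n \<longleftrightarrow> x \<in> F n \<and> x \<notin> F (Suc n)"
  using has_valI[of x n] has_val_F[of x n n] has_val_F[of x n "Suc n"] by auto

text \<open>x divides some \<open>t [^] N\<close>, whose valuation is 3N, so
  \<open>x \<in> F n\<close> forces n \<le> 3N and a greatest such n exists.\<close>

lemma has_val_ex: assumes "x \<in> A" "x \<noteq> \<zero>" shows "\<exists>n. has_val x n"
proof -
  obtain N b where b: "b \<in> A" "x \<otimes> b = t [^] (N::nat)" using divides_t_pow assms by blast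
  have *: "n \<le> 3 * N" if "x \<in> F n" for n
  proof -
    have "t [^] N \<in> F n" using that b F_closed(4)[of x n b] by simp
    thus ?thesis using has_val_F[OF has_val_t_pow] by simp
  qed
  define n where "n = (GREATEST n. x \<in> F n)"
  have "x \<in> F n" unfolding n_def using GreatestI_nat[of "\<lambda>n. x \<in> F n" 0 "3*N"] * assms by auto
  moreover have "x \<notin> F (Suc n)"
    using Greatest_le_nat[of "\<lambda>n. x \<in> F n" "Suc n" "3*N"] * unfolding n_def by auto
  ultimately show ?thesis using has_valI by blast
qed

lemma F_Inter: "\<lbrakk> x \<in> A; \<And>n. x \<in> F n \<rbrakk> \<Longrightarrow> x = \<zero>"
  using has_val_ex has_val_iff by blast

text \<open>The difference n - p is truncated; for n < p the conclusion is only
  \<open>y \<in> A\<close>, since \<open>F 0 = A\<close>.\<close>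

lemma F_cancel_mult:
  assumes "has_val x p" "y \<in> A" "y \<otimes> x \<in> F n" shows "y \<in> F (n - p)"
proof (cases "y = \<zero>")
  case False
  then obtain q where q: "has_val y q" using has_val_ex assms by blast
  have "n \<le> q + p" using has_val_F[OF has_val_mult[OF q assms(1)]] assms(3) by simp
  thus ?thesis using has_val_F[OF q] by simp
qed auto

lemma F_eq_t_pow: "F (3 * n) = {t [^] n \<otimes> a | a. a \<in> A}"
proof
  show "{t [^] n \<otimes> a | a. a \<in> A} \<subseteq> F (3 * n)"
    using has_val_F[OF has_val_t_pow[of n], of "3*n"] by auto
  obtain u where u: "unit u" "t [^] n = \<tau> [^] (3 * n) \<otimes> u"
    using has_val_t_pow unfolding has_val_def by blast
  then obtain u' where u': "u' \<in> A" "u \<otimes> u' = \<one>" unfolding unit_def by blast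
  show "F (3 * n) \<subseteq> {t [^] n \<otimes> a | a. a \<in> A}"
  proof
    fix x assume "x \<in> F (3 * n)"
    then obtain a where a: "a \<in> A" "x = \<tau> [^] (3 * n) \<otimes> a" unfolding F_def by blast
    have "t [^] n \<otimes> (u' \<otimes> a) = \<tau> [^] (3 * n) \<otimes> (u \<otimes> u') \<otimes> a"
      using u u'(1) a by (simp add: m_assoc)
    hence "x = t [^] n \<otimes> (u' \<otimes> a)" using u' a by simp
    thus "x \<in> {t [^] n \<otimes> a | a. a \<in> A}" using u' a by auto
  qed
qed

lemma D_F1: assumes "d \<in> D" "d \<in> F 1" shows "\<exists>b \<in> D. d = t \<otimes> b"
proof -
  have "\<not> (\<exists>b \<in> D. d \<otimes> b = \<one>)"
    using unit_notin_F[of d] assms D_A unfolding unit_def by blast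
  thus ?thesis using D_cases assms by blast
qed

lemma has_val_unique: "\<lbrakk> has_val x m; has_val x n \<rbrakk> \<Longrightarrow> m = n"
  using has_val_F[of x m m] has_val_F[of x m n] has_val_F[of x n n] has_val_F[of x n m] by simp

text \<open>The condition says that q is at most n/3 rounded up. The rounding is free because an
  element of \<open>D\<close> of positive valuation is already divisible by t, which has valuation
  3.\<close>

lemma D_F_t_pow:
  assumes "d \<in> D" "d \<in> F n" "3 * q \<le> n + 2" shows "\<exists>b \<in> D. d = t [^] q \<otimes> b"
  using assms
proof (induct q arbitrary: d n)
  case 0 thus ?case by (intro bexI[of _ d]) auto
next
  case (Suc q)
  have "d \<in> F 1" using F_mono[OF Suc(3), of 1] Suc(4) by simp
  then obtain b where b: "b \<in> D" "d = t \<otimes> b" using D_F1 Suc by blast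
  have "b \<in> F (n - 3)" using F_cancel_mult[OF has_val_t, of b n] b Suc(3) by (simp add: m_comm)
  moreover have "3 * q \<le> (n - 3) + 2" using Suc(4) by arith
  ultimately obtain c where c: "c \<in> D" "b = t [^] q \<otimes> c" using Suc(1)[OF b(1)] by blast
  have "d = t [^] Suc q \<otimes> c" using b c by (simp add: m_ac)
  thus ?case using c by blast
qed

lemma D_has_val: assumes "d \<in> D" "has_val d n" shows "3 dvd n"
proof -
  \<comment> \<open>This is n/3 rounded up: divisibility of d by \<open>t [^] q\<close> gives 3q
    \<le> n, hence equality.\<close>
  define q where "q = (n + 2) div 3"
  have "d \<in> F n" using assms has_val_F by simp
  then obtain b where b: "b \<in> D" "d = t [^] q \<otimes> b"
    using D_F_t_pow[OF assms(1), of n q] unfolding q_def by auto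
  hence "d \<in> F (3 * q)" unfolding F_eq_t_pow by auto
  hence "3 * q \<le> n" using has_val_F assms by blast
  hence "n = 3 * q" unfolding q_def by presburger
  thus ?thesis by simp
qed

text \<open>A nonzero product has valuation congruent to p modulo 3, so it cannot be exactly
  n.\<close>

lemma term_F_Suc:
  assumes "d \<in> D" "has_val x p" "d \<otimes> x \<in> F n" "n mod 3 \<noteq> p mod 3"
  shows "d \<otimes> x \<in> F (Suc n)"
proof (cases "d = \<zero>")
  case True thus ?thesis using assms by simp
next
  case False
  then obtain m where m: "has_val d m" using has_val_ex assms D_A by blast
  have v: "has_val (d \<otimes> x) (m + p)" using has_val_mult m assms by blast
  have "3 dvd m" using D_has_val m assms by blast
  hence "n \<noteq> m + p" using assms(4) by (auto elim!: dvdE)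
  moreover have "n \<le> m + p" using has_val_F[OF v] assms by blast
  ultimately show ?thesis using has_val_F[OF v] by simp
qed

section \<open>Valuations of coordinates\<close>

text \<open>
  Nonzero elements of \<open>D\<close> have valuations divisible by 3, so the nonzero terms of a sum
  \<open>a + b \<alpha> + c \<gamma>\<close> have pairwise distinct valuations and cannot cancel.
\<close>

lemma coords_F:
  assumes "has_val \<alpha> p" "has_val \<gamma> q" "complementary p q"
    and "a \<in> D" "b \<in> D" "c \<in> D" "a \<oplus> b \<otimes> \<alpha> \<oplus> c \<otimes> \<gamma> \<in> F n"
  shows "a \<in> F n \<and> b \<otimes> \<alpha> \<in> F n \<and> c \<otimes> \<gamma> \<in> F n"
  using assms(7)
proof (induct n)
  case 0
  thus ?case using assms(1,2,4-6) by auto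
next
  case (Suc n)
  define x y z where "x = a" "y = b \<otimes> \<alpha>" "z = c \<otimes> \<gamma>"
  have A: "x \<in> A" "y \<in> A" "z \<in> A" using assms(1,2,4-6) unfolding x_y_z_def by auto
  note C = A[THEN A_carrier]
  have sum: "x \<oplus> y \<oplus> z \<in> F (Suc n)" using Suc(2) unfolding x_y_z_def by simp
  have "x \<oplus> y \<oplus> z \<in> F n" using F_mono[OF sum] by simp
  hence IH: "x \<in> F n" "y \<in> F n" "z \<in> F n" using Suc(1) unfolding x_y_z_def by auto
  have x: "n mod 3 \<noteq> 0 \<Longrightarrow> x \<in> F (Suc n)"
    using term_F_Suc[OF assms(4) has_val_one, of n] IH(1) assms(4) unfolding x_y_z_def by simp
  have y: "n mod 3 \<noteq> p \<Longrightarrow> y \<in> F (Suc n)"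
    using term_F_Suc[OF assms(5,1), of n] IH(2) assms(3) unfolding x_y_z_def by auto
  have z: "n mod 3 \<noteq> q \<Longrightarrow> z \<in> F (Suc n)"
    using term_F_Suc[OF assms(6,2), of n] IH(3) assms(3) unfolding x_y_z_def by auto
  \<comment> \<open>Only the term whose valuations are congruent to n modulo 3 could have valuation
    exactly n. The other two lie in \<open>F (Suc n)\<close>, as does the sum, hence so does this
    one.\<close>
  consider "n mod 3 = 0" | "n mod 3 = p" | "n mod 3 = q" using assms(3) by linarith
  hence "x \<in> F (Suc n) \<and> y \<in> F (Suc n) \<and> z \<in> F (Suc n)"
  proof cases
    case 1
    hence yz: "y \<in> F (Suc n)" "z \<in> F (Suc n)" using y z assms(3) by auto
    have "x \<oplus> (y \<oplus> z) \<in> F (Suc n)" using sum C by (simp add: a_assoc)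
    thus ?thesis using F_cancel_add[OF A(1)] yz by blast
  next
    case 2
    hence xz: "x \<in> F (Suc n)" "z \<in> F (Suc n)" using x z assms(3) by auto
    have "y \<oplus> (x \<oplus> z) \<in> F (Suc n)" using sum C by (simp add: a_ac)
    thus ?thesis using F_cancel_add[OF A(2)] xz by blast
  next
    case 3
    hence xy: "x \<in> F (Suc n)" "y \<in> F (Suc n)" using x y assms(3) by auto
    have "z \<oplus> (x \<oplus> y) \<in> F (Suc n)" using sum C by (simp add: a_ac)
    thus ?thesis using F_cancel_add[OF A(3)] xy by blast
  qed
  thus ?case unfolding x_y_z_def .
qed

text \<open>Removing \<alpha> or \<gamma> lowers the bound 3n by at most 2, and the rounding up in
  \<open>D_F_t_pow\<close> recovers the loss.\<close>

lemma coords_t_pow: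
  assumes "has_val \<alpha> p" "has_val \<gamma> q" "complementary p q"
    and "a \<in> D" "b \<in> D" "c \<in> D" "a \<oplus> b \<otimes> \<alpha> \<oplus> c \<otimes> \<gamma> \<in> F (3 * n)"
  shows "\<exists>a' \<in> D. \<exists>b' \<in> D. \<exists>c' \<in> D. a = t [^] n \<otimes> a' \<and> b = t [^] n \<otimes> b' \<and> c = t [^] n \<otimes> c'"
proof -
  have "b \<in> F (3 * n - p)" "c \<in> F (3 * n - q)" "a \<in> F (3 * n)"
    using coords_F[OF assms] F_cancel_mult assms(1,2,4-6) by auto
  thus ?thesis
    using D_F_t_pow[OF assms(4), of "3*n" n] D_F_t_pow[OF assms(5), of "3*n-p" n]
      D_F_t_pow[OF assms(6), of "3*n-q" n] assms(3) by auto
qed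

lemma coords_zero:
  assumes "has_val \<alpha> p" "has_val \<gamma> q" "complementary p q"
    and "a \<in> D" "b \<in> D" "c \<in> D" "a \<oplus> b \<otimes> \<alpha> \<oplus> c \<otimes> \<gamma> = \<zero>"
  shows "a = \<zero> \<and> b = \<zero> \<and> c = \<zero>"
proof -
  have *: "a \<in> F n \<and> b \<otimes> \<alpha> \<in> F n \<and> c \<otimes> \<gamma> \<in> F n" for n
    using coords_F[OF assms(1-6), of n] assms(7) by simp
  have "a = \<zero>" "b \<otimes> \<alpha> = \<zero>" "c \<otimes> \<gamma> = \<zero>"
    using * F_Inter assms(1,2,4-6) by auto
  thus ?thesis using has_val_nonzero[OF assms(1)] has_val_nonzero[OF assms(2)] assms(1,2,4-6)
    by (simp add: integral_iff)
qed

lemma D_factor: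
  assumes "d \<in> D" "d \<noteq> \<zero>"
  shows "\<exists>q::nat. \<exists>u \<in> D. \<exists>u' \<in> D. u \<otimes> u' = \<one> \<and> d = t [^] q \<otimes> u"
proof -
  obtain n where n: "has_val d n" using has_val_ex assms D_A by blast
  obtain q where q: "n = 3 * q" using D_has_val[OF assms(1) n] by blast
  have "d \<in> F n" using n has_val_F by simp
  then obtain u where u: "u \<in> D" "d = t [^] q \<otimes> u" using D_F_t_pow[OF assms(1), of n q] q by auto
  have "\<not> (\<exists>b \<in> D. u = t \<otimes> b)"
  proof
    assume "\<exists>b \<in> D. u = t \<otimes> b"
    then obtain b where b: "b \<in> D" "u = t \<otimes> b" by blast
    have "d = t [^] Suc q \<otimes> b" using u b by (simp add: m_assoc)
    hence "d \<in> F (3 * Suc q)" using F_eq_t_pow[of "Suc q"] b D_A by blast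
    thus False using has_val_F[OF n] q by simp
  qed
  then obtain u' where "u' \<in> D" "u \<otimes> u' = \<one>" using D_cases[OF u(1)] by blast
  thus ?thesis using u by blast
qed

text \<open>
  If \<open>u\<close> were not congruent to an element of \<open>D\<close>, then \<open>1, \<tau>, \<tau>\<^sup>2, u\<close> would be independent:
  all coefficients of a relation are divisible by \<open>t\<close>, hence by every power of \<open>t\<close>.
\<close>

lemma A_residue: assumes "u \<in> A" shows "\<exists>d \<in> D. \<exists>x \<in> F 1. u = d \<oplus> x"
proof (rule ccontr)
  assume contra: "\<not> ?thesis"
  have pq: "(1::nat) = 1 \<and> (2::nat) = 2 \<or> (1::nat) = 2 \<and> (2::nat) = 1" by simp
  have *: "a \<in> F n \<and> b \<in> F n \<and> c \<in> F n \<and> e \<in> F n"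
    if "a \<in> D" "b \<in> D" "c \<in> D" "e \<in> D" "a \<otimes> \<one> \<oplus> b \<otimes> \<tau> \<oplus> c \<otimes> (\<tau> \<otimes> \<tau>) \<oplus> e \<otimes> u = \<zero>" for n a b c e
    using that
  proof (induct n arbitrary: a b c e)
    case 0 thus ?case by simp
  next
    case (Suc n)
    note C = Suc(2-5)[THEN D_carrier] A_carrier[OF assms] A_carrier[OF tau_in_A] t_carrier
    \<comment> \<open>With e invertible, the relation could be solved for u, giving an element of
      \<open>D\<close> plus an element of \<open>F 1\<close>.\<close>
    have nonunit: "\<not> (\<exists>e' \<in> D. e \<otimes> e' = \<one>)"
    proof
      assume "\<exists>e' \<in> D. e \<otimes> e' = \<one>"
      then obtain e' where e': "e' \<in> D" "e \<otimes> e' = \<one>" by blast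
      define x where "x = \<ominus> (e' \<otimes> (b \<otimes> \<tau> \<oplus> c \<otimes> (\<tau> \<otimes> \<tau>)))"
      have tF: "\<tau> \<in> F 1" using has_val_F[OF has_val_tau] by simp
      have x: "x \<in> F 1" unfolding x_def using Suc(2-5) e' tF by auto
      have "u = (e \<otimes> e') \<otimes> u" using e' assms by simp
      also have "\<dots> = \<ominus> (e' \<otimes> a) \<oplus> x \<oplus> e' \<otimes> (a \<otimes> \<one> \<oplus> b \<otimes> \<tau> \<oplus> c \<otimes> (\<tau> \<otimes> \<tau>) \<oplus> e \<otimes> u)"
        unfolding x_def using C D_carrier[OF e'(1)] by algebra
      also have "\<dots> = \<ominus> (e' \<otimes> a) \<oplus> x" unfolding Suc(6) using C e' x by simp
      finally have "u = \<ominus> (e' \<otimes> a) \<oplus> x" .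
      thus False using contra x Suc(2) e'(1) by blast
    qed
    then obtain e1 where e1: "e1 \<in> D" "e = t \<otimes> e1" using D_cases[OF Suc(5)] by blast
    \<comment> \<open>As e is divisible by t, the other three terms sum to an element of
      \<open>F 3\<close>, so their coefficients are multiples of t as well and the whole relation
      can be divided by t.\<close>
    have "a \<oplus> b \<otimes> \<tau> \<oplus> c \<otimes> (\<tau> \<otimes> \<tau>) = (a \<otimes> \<one> \<oplus> b \<otimes> \<tau> \<oplus> c \<otimes> (\<tau> \<otimes> \<tau>) \<oplus> e \<otimes> u) \<ominus> t \<otimes> (e1 \<otimes> u)"
      using C D_carrier[OF e1(1)] unfolding e1(2) by algebra
    also have "\<dots> = t [^] (1::nat) \<otimes> (\<ominus> (e1 \<otimes> u))" unfolding Suc(6) using C D_carrier[OF e1(1)]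
      by (simp add: minus_eq r_minus)
    finally have "a \<oplus> b \<otimes> \<tau> \<oplus> c \<otimes> (\<tau> \<otimes> \<tau>) \<in> F (3 * 1)"
      unfolding F_eq_t_pow[of 1] using e1 assms by auto
    then obtain a1 b1 c1 where abc: "a1 \<in> D" "b1 \<in> D" "c1 \<in> D"
      "a = t \<otimes> a1" "b = t \<otimes> b1" "c = t \<otimes> c1"
      using coords_t_pow[OF has_val_tau has_val_tau_square pq Suc(2-4), of 1] by auto
    have "t \<otimes> (a1 \<otimes> \<one> \<oplus> b1 \<otimes> \<tau> \<oplus> c1 \<otimes> (\<tau> \<otimes> \<tau>) \<oplus> e1 \<otimes> u) = \<zero>"
      using Suc(6) C abc(1-3)[THEN D_carrier] D_carrier[OF e1(1)] unfolding abc(4-6) e1(2)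
      by (simp add: r_distr m_assoc)
    hence "a1 \<otimes> \<one> \<oplus> b1 \<otimes> \<tau> \<oplus> c1 \<otimes> (\<tau> \<otimes> \<tau>) \<oplus> e1 \<otimes> u = \<zero>"
      using C abc(1-3)[THEN D_carrier] D_carrier[OF e1(1)] t_nonzero by (simp add: integral_iff)
    hence IH: "a1 \<in> F n" "b1 \<in> F n" "c1 \<in> F n" "e1 \<in> F n" using Suc(1) abc e1 by blast+
    have "t \<otimes> x \<in> F (Suc n)" if "x \<in> F n" for x
    proof -
      have "t \<in> F 1" using t_in_F by simp
      thus ?thesis using F_mult[of t 1 x n] that by simp
    qed
    thus ?case using IH abc e1 by simp
  qed
  obtain a b c e where abce: "a \<in> D" "b \<in> D" "c \<in> D" "e \<in> D"
    "\<not> (a = \<zero> \<and> b = \<zero> \<and> c = \<zero> \<and> e = \<zero>)"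
    "a \<otimes> \<one> \<oplus> b \<otimes> \<tau> \<oplus> c \<otimes> (\<tau> \<otimes> \<tau>) \<oplus> e \<otimes> u = \<zero>"
    using four_dependent[of \<one> \<tau> "\<tau> \<otimes> \<tau>" u] assms by auto
  have "a = \<zero>" "b = \<zero>" "c = \<zero>" "e = \<zero>"
    using *[OF abce(1-4,6)] F_Inter abce(1-4) D_A by blast+
  thus False using abce(5) by blast
qed

text \<open>In a relation between 1, \<alpha>, \<gamma> and x the coefficient of x cannot vanish, by
  \<open>coords_zero\<close>; up to a unit of \<open>D\<close> it is a power of t.\<close>

lemma L_basis:
  assumes "has_val \<alpha> p" "has_val \<gamma> q" "complementary p q" "x \<in> carrier L"
  shows "\<exists>n::nat. \<exists>a \<in> D. \<exists>b \<in> D. \<exists>c \<in> D. t [^] n \<otimes> x = a \<oplus> b \<otimes> \<alpha> \<oplus> c \<otimes> \<gamma>"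
proof -
  obtain a b c e where abce: "a \<in> D" "b \<in> D" "c \<in> D" "e \<in> D"
    "\<not> (a = \<zero> \<and> b = \<zero> \<and> c = \<zero> \<and> e = \<zero>)"
    "a \<otimes> \<one> \<oplus> b \<otimes> \<alpha> \<oplus> c \<otimes> \<gamma> \<oplus> e \<otimes> x = \<zero>"
    using four_dependent[of \<one> \<alpha> \<gamma> x] assms by auto
  have "e \<noteq> \<zero>"
  proof
    assume "e = \<zero>"
    hence "a \<oplus> b \<otimes> \<alpha> \<oplus> c \<otimes> \<gamma> = \<zero>" using abce assms by simp
    thus False using coords_zero[OF assms(1-3) abce(1-3)] abce(5) \<open>e = \<zero>\<close> by blast
  qed
  then obtain q u u' where u: "u \<in> D" "u' \<in> D" "u \<otimes> u' = \<one>" "e = t [^] (q::nat) \<otimes> u"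
    using D_factor[OF abce(4)] by blast
  note C = abce(1-4)[THEN D_carrier] u(1,2)[THEN D_carrier] assms(1,2)[THEN has_val_carrier] assms(4)
    nat_pow_closed[OF t_carrier, of q]
  have "t [^] q \<otimes> x = (u \<otimes> u') \<otimes> (t [^] q \<otimes> x)" using C u by simp
  also have "\<dots> = \<ominus> (u' \<otimes> a) \<oplus> \<ominus> (u' \<otimes> b) \<otimes> \<alpha> \<oplus> \<ominus> (u' \<otimes> c) \<otimes> \<gamma> \<oplus>
      u' \<otimes> (a \<otimes> \<one> \<oplus> b \<otimes> \<alpha> \<oplus> c \<otimes> \<gamma> \<oplus> e \<otimes> x)"
    unfolding u(4) using C by algebra
  also have "\<dots> = \<ominus> (u' \<otimes> a) \<oplus> \<ominus> (u' \<otimes> b) \<otimes> \<alpha> \<oplus> \<ominus> (u' \<otimes> c) \<otimes> \<gamma>"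
    unfolding abce(6) using C by simp
  finally show ?thesis using abce u by blast
qed

text \<open>The coordinates of \<open>t [^] n \<otimes> x\<close>, an element of
  \<open>F (3 * n)\<close>, are multiples of \<open>t [^] n\<close> and can be divided by
  it.\<close>

lemma A_basis:
  assumes "has_val \<alpha> p" "has_val \<gamma> q" "complementary p q" "x \<in> A"
  shows "\<exists>a \<in> D. \<exists>b \<in> D. \<exists>c \<in> D. x = a \<oplus> b \<otimes> \<alpha> \<oplus> c \<otimes> \<gamma>"
proof -
  obtain n a b c where abc: "a \<in> D" "b \<in> D" "c \<in> D" "t [^] (n::nat) \<otimes> x = a \<oplus> b \<otimes> \<alpha> \<oplus> c \<otimes> \<gamma>"
    using L_basis[OF assms(1-3), of x] assms(4) by auto
  have "a \<oplus> b \<otimes> \<alpha> \<oplus> c \<otimes> \<gamma> \<in> F (3 * n)"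
    unfolding F_eq_t_pow abc(4)[symmetric] using assms(4) by auto
  then obtain a' b' c' where abc': "a' \<in> D" "b' \<in> D" "c' \<in> D"
    "a = t [^] n \<otimes> a'" "b = t [^] n \<otimes> b'" "c = t [^] n \<otimes> c'"
    using coords_t_pow[OF assms(1-3) abc(1-3)] by blast
  have "t [^] n \<otimes> x = t [^] n \<otimes> (a' \<oplus> b' \<otimes> \<alpha> \<oplus> c' \<otimes> \<gamma>)"
    unfolding abc(4) using abc' assms(1,2) by (simp add: r_distr m_assoc)
  hence "x = a' \<oplus> b' \<otimes> \<alpha> \<oplus> c' \<otimes> \<gamma>"
    using m_lcancel[of "t [^] n" x] abc'(1-3) assms by simp
  thus ?thesis using abc' by blast
qed

lemma t_pow_mult_in_A: assumes "x \<in> carrier L" shows "\<exists>n::nat. t [^] n \<otimes> x \<in> A"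
proof -
  obtain n a b c where "a \<in> D" "b \<in> D" "c \<in> D" "t [^] (n::nat) \<otimes> x = a \<oplus> b \<otimes> \<tau> \<oplus> c \<otimes> (\<tau> \<otimes> \<tau>)"
    using L_basis[OF has_val_tau has_val_tau_square _ assms] by auto
  hence "t [^] n \<otimes> x \<in> A" by simp
  thus ?thesis by blast
qed

lemma has_val_divide:
  assumes "has_val x (3 * n + m)" shows "\<exists>y. has_val y m \<and> x = t [^] n \<otimes> y"
proof -
  have "x \<in> F (3 * n)" using has_val_F[OF assms] by simp
  then obtain y where y: "y \<in> A" "x = t [^] n \<otimes> y" unfolding F_eq_t_pow by blast
  have "y \<noteq> \<zero>" using has_val_nonzero[OF assms] y by auto
  then obtain k where k: "has_val y k" using has_val_ex y by blast
  have "k = m" using has_val_unique[OF has_val_mult[OF has_val_t_pow k], of n "3*n+m"] assms y by simp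
  thus ?thesis using k y by blast
qed

text \<open>2p = 3(p - 1) + (3 - p): squares of elements of valuation 1 and 2 have valuations 2 and
  4 = 3 + 1. This is where the summand p - 1 in the exponents comes from.\<close>

lemma has_val_square_factor:
  assumes "has_val \<alpha> p" "p = 1 \<or> p = 2"
  shows "\<exists>\<gamma>. has_val \<gamma> (3 - p) \<and> \<alpha> \<otimes> \<alpha> = t [^] (p - 1) \<otimes> \<gamma>"
  using assms(2) has_val_divide[of "\<alpha> \<otimes> \<alpha>" "p - 1" "3 - p"] has_val_mult[OF assms(1,1)]
  by (auto simp: numeral_2_eq_2 numeral_3_eq_3)

section \<open>Over-rings\<close>

text \<open>Normal form shared by the over-rings and by the rings \<open>C_ring\<close> with their
  shifts; there \<beta> and \<omega> are multiples of \<alpha> and \<gamma> by powers of t.\<close>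

definition tri :: "'a \<Rightarrow> 'a \<Rightarrow> 'a set" where
  "tri \<beta> \<omega> = {a \<oplus> b \<otimes> \<beta> \<oplus> c \<otimes> \<omega> | a b c. a \<in> D \<and> b \<in> D \<and> c \<in> D}"

lemma tri_I: "\<lbrakk> a \<in> D; b \<in> D; c \<in> D \<rbrakk> \<Longrightarrow> a \<oplus> b \<otimes> \<beta> \<oplus> c \<otimes> \<omega> \<in> tri \<beta> \<omega>"
  unfolding tri_def by blast

text \<open>In the basis 1, \<alpha>, \<gamma> of \<open>A\<close> the first two terms of
  \<open>t [^] h \<otimes> x\<close> are absorbed by \<open>D\<close> and by the multiples of
  \<open>t [^] e \<otimes> \<alpha>\<close>, as e \<le> h. In particular the module is the same for
  all \<gamma> of valuation q.\<close>

lemma tri_eq_with_A: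
  assumes "has_val \<alpha> p" "has_val \<gamma> q" "complementary p q" "e \<le> (h::nat)"
  shows "tri (t [^] e \<otimes> \<alpha>) (t [^] h \<otimes> \<gamma>) =
    {d \<oplus> d' \<otimes> (t [^] e \<otimes> \<alpha>) \<oplus> t [^] h \<otimes> x | d d' x. d \<in> D \<and> d' \<in> D \<and> x \<in> A}"
proof (intro equalityI subsetI)
  fix y assume "y \<in> tri (t [^] e \<otimes> \<alpha>) (t [^] h \<otimes> \<gamma>)"
  then obtain a b c where abc: "a \<in> D" "b \<in> D" "c \<in> D" "y = a \<oplus> b \<otimes> (t [^] e \<otimes> \<alpha>) \<oplus> c \<otimes> (t [^] h \<otimes> \<gamma>)"
    unfolding tri_def by blast
  moreover have "c \<otimes> (t [^] h \<otimes> \<gamma>) = t [^] h \<otimes> (c \<otimes> \<gamma>)"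
    using D_carrier[OF abc(3)] has_val_carrier[OF assms(2)] t_pow_carrier[of h] by algebra
  moreover have "c \<otimes> \<gamma> \<in> A" using abc assms by simp
  ultimately show "y \<in> {d \<oplus> d' \<otimes> (t [^] e \<otimes> \<alpha>) \<oplus> t [^] h \<otimes> x | d d' x. d \<in> D \<and> d' \<in> D \<and> x \<in> A}"
    by auto
next
  fix y assume "y \<in> {d \<oplus> d' \<otimes> (t [^] e \<otimes> \<alpha>) \<oplus> t [^] h \<otimes> x | d d' x. d \<in> D \<and> d' \<in> D \<and> x \<in> A}"
  then obtain d d' x where dx: "d \<in> D" "d' \<in> D" "x \<in> A" "y = d \<oplus> d' \<otimes> (t [^] e \<otimes> \<alpha>) \<oplus> t [^] h \<otimes> x"
    by blast
  obtain a b c where abc: "a \<in> D" "b \<in> D" "c \<in> D" "x = a \<oplus> b \<otimes> \<alpha> \<oplus> c \<otimes> \<gamma>"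
    using A_basis[OF assms(1-3) dx(3)] by blast
  define u where "u = t [^] (h - e)"
  have u: "u \<in> D" "t [^] h = u \<otimes> t [^] e"
    unfolding u_def using assms(4) by (auto simp: nat_pow_mult)
  define w where "w = t [^] e"
  have w: "w \<in> D" unfolding w_def by simp
  note C = dx(1,2)[THEN D_carrier] abc(1-3)[THEN D_carrier] u(1)[THEN D_carrier] w[THEN D_carrier]
    assms(1,2)[THEN has_val_carrier]
  have "y = (d \<oplus> u \<otimes> w \<otimes> a) \<oplus> (d' \<oplus> u \<otimes> b) \<otimes> (w \<otimes> \<alpha>) \<oplus> c \<otimes> (u \<otimes> w \<otimes> \<gamma>)"
    unfolding dx(4) abc(4) u(2) w_def[symmetric] using C by algebra
  also have "\<dots> \<in> tri (w \<otimes> \<alpha>) (u \<otimes> w \<otimes> \<gamma>)"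
    using dx abc u w by (intro tri_I) auto
  finally show "y \<in> tri (t [^] e \<otimes> \<alpha>) (t [^] h \<otimes> \<gamma>)" unfolding u(2) w_def .
qed

lemma C_ring_eq_tri:
  assumes "has_val \<alpha> p" "has_val \<gamma> q" "complementary p q" "r = 2 * s + (p - 1)"
  shows "C_ring L D A t r \<alpha> = tri (t [^] s \<otimes> \<alpha>) (t [^] r \<otimes> \<gamma>)"
proof -
  have s: "r div 2 = s" "s \<le> r" using assms(3,4) by auto
  have comm: "(t [^] s \<otimes> \<alpha>) \<otimes> d = d \<otimes> (t [^] s \<otimes> \<alpha>)" if "d \<in> D" for d
    using has_val_carrier[OF assms(1)] that by (simp add: m_comm)
  have iff: "x \<in> C_ring L D A t r \<alpha> \<longleftrightarrow>
      (\<exists>d \<in> D. \<exists>d' \<in> D. \<exists>a \<in> A. x = d \<oplus> d' \<otimes> (t [^] s \<otimes> \<alpha>) \<oplus> t [^] r \<otimes> a)" for x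
  proof -
    have "x \<in> C_ring L D A t r \<alpha> \<longleftrightarrow>
        (\<exists>d \<in> D. \<exists>d' \<in> D. \<exists>a \<in> A. x = d \<oplus> (t [^] s \<otimes> \<alpha>) \<otimes> d' \<oplus> t [^] r \<otimes> a)"
      unfolding C_ring_def s mem_set_add_iff mem_l_coset_iff Bex_def by blast
    thus ?thesis using comm by simp
  qed
  show ?thesis
    unfolding tri_eq_with_A[OF assms(1-3) s(2)] by (rule Set.set_eqI) (simp only: iff mem_Collect_eq, blast)
qed

text \<open>Multiplication by \<open>t [^] k\<close> raises both exponents by k; adding
  \<open>D\<close> restores the generator 1.\<close>

lemma shifted_C_ring_eq_tri:
  assumes "has_val \<alpha> p" "has_val \<gamma> q" "complementary p q" "r = 2 * s + (p - 1)"
  shows "(t [^] k <#\<^bsub>L\<^esub> C_ring L D A t r \<alpha>) <+>\<^bsub>L\<^esub> D = tri (t [^] (k + s) \<otimes> \<alpha>) (t [^] (k + r) \<otimes> \<gamma>)"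
proof (intro equalityI subsetI)
  note C0 = assms(1,2)[THEN has_val_carrier]
  have *: "t [^] k \<otimes> (a \<oplus> b \<otimes> (t [^] s \<otimes> \<alpha>) \<oplus> c \<otimes> (t [^] r \<otimes> \<gamma>)) \<oplus> d =
    (t [^] k \<otimes> a \<oplus> d) \<oplus> b \<otimes> (t [^] (k + s) \<otimes> \<alpha>) \<oplus> c \<otimes> (t [^] (k + r) \<otimes> \<gamma>)"
    if "a \<in> D" "b \<in> D" "c \<in> D" "d \<in> D" for a b c d
  proof -
    define x y where "x = t [^] s \<otimes> \<alpha>" "y = t [^] r \<otimes> \<gamma>"
    have xy: "x \<in> carrier L" "y \<in> carrier L" unfolding x_y_def using C0 by auto
    have "t [^] (k + s) \<otimes> \<alpha> = t [^] k \<otimes> x" "t [^] (k + r) \<otimes> \<gamma> = t [^] k \<otimes> y"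
      unfolding x_y_def using C0 by (auto simp: nat_pow_mult[symmetric] m_assoc)
    moreover have "t [^] k \<otimes> (a \<oplus> b \<otimes> x \<oplus> c \<otimes> y) \<oplus> d =
        (t [^] k \<otimes> a \<oplus> d) \<oplus> b \<otimes> (t [^] k \<otimes> x) \<oplus> c \<otimes> (t [^] k \<otimes> y)"
      using that[THEN D_carrier] xy t_pow_carrier[of k] by algebra
    ultimately show ?thesis unfolding x_y_def by simp
  qed
  have mem: "y \<in> (t [^] k <#\<^bsub>L\<^esub> C_ring L D A t r \<alpha>) <+>\<^bsub>L\<^esub> D \<longleftrightarrow>
      (\<exists>z \<in> C_ring L D A t r \<alpha>. \<exists>d \<in> D. y = t [^] k \<otimes> z \<oplus> d)" for y
    unfolding mem_set_add_iff mem_l_coset_iff Bex_def by blast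
  {
    fix y assume "y \<in> (t [^] k <#\<^bsub>L\<^esub> C_ring L D A t r \<alpha>) <+>\<^bsub>L\<^esub> D"
    then obtain z d where zd: "z \<in> C_ring L D A t r \<alpha>" "d \<in> D" "y = t [^] k \<otimes> z \<oplus> d"
      unfolding mem by blast
    obtain a b c where abc: "a \<in> D" "b \<in> D" "c \<in> D" "z = a \<oplus> b \<otimes> (t [^] s \<otimes> \<alpha>) \<oplus> c \<otimes> (t [^] r \<otimes> \<gamma>)"
      using zd(1) unfolding C_ring_eq_tri[OF assms] tri_def by blast
    show "y \<in> tri (t [^] (k + s) \<otimes> \<alpha>) (t [^] (k + r) \<otimes> \<gamma>)"
      unfolding zd(3) abc(4) *[OF abc(1-3) zd(2)] using abc(1-3) zd(2) by (intro tri_I) auto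
  }
  {
    fix y assume "y \<in> tri (t [^] (k + s) \<otimes> \<alpha>) (t [^] (k + r) \<otimes> \<gamma>)"
    then obtain a b c where abc: "a \<in> D" "b \<in> D" "c \<in> D"
      "y = a \<oplus> b \<otimes> (t [^] (k + s) \<otimes> \<alpha>) \<oplus> c \<otimes> (t [^] (k + r) \<otimes> \<gamma>)"
      unfolding tri_def by blast
    define z where "z = \<zero> \<oplus> b \<otimes> (t [^] s \<otimes> \<alpha>) \<oplus> c \<otimes> (t [^] r \<otimes> \<gamma>)"
    have "y = t [^] k \<otimes> z \<oplus> a"
      unfolding z_def using *[of \<zero> b c a] abc by simp
    moreover have "z \<in> C_ring L D A t r \<alpha>"
      unfolding C_ring_eq_tri[OF assms] z_def using abc by (intro tri_I) auto
    ultimately show "y \<in> (t [^] k <#\<^bsub>L\<^esub> C_ring L D A t r \<alpha>) <+>\<^bsub>L\<^esub> D"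
      unfolding mem using abc(1) by blast
  }
qed

text \<open>Otherwise d would itself have valuation n, which is not a multiple of 3.\<close>

lemma not_congruent_D:
  assumes "has_val y n" "\<not> 3 dvd n" "d \<in> D" "z \<in> F (Suc n)" shows "y \<noteq> d \<oplus> z"
proof
  assume y: "y = d \<oplus> z"
  have "d \<in> A" "z \<in> A" using assms F_A by auto
  have "z \<in> F n" "y \<in> F n" using assms(1,4) F_mono[of z "Suc n" n] has_val_F by auto
  hence "d \<in> F n" using F_cancel_add[OF \<open>d \<in> A\<close>] y by blast
  moreover have "d \<notin> F (Suc n)" using y assms(4) has_val_iff[of y n] assms(1) by auto
  ultimately have "has_val d n" by (rule has_valI)
  thus False using D_has_val assms by blast
qed

text \<open>
  Here \<open>e\<close> is maximal with \<open>B \<subseteq> t\<^sup>eA + D\<close> and \<open>h\<close> is minimal with \<open>t\<^sup>hA \<subseteq> B\<close>. The element \<open>\<alpha>\<close> is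
  taken of valuation 1 if possible. The upper bound for \<open>h\<close> holds because the square of
  \<open>t\<^sup>e\<alpha>\<close> lies in \<open>B\<close>.
\<close>

theorem over_ring_shape:
  assumes B: "subring B L" "D \<subseteq> B" "B \<subseteq> A" and m: "\<And>x. x \<in> A \<Longrightarrow> t [^] m \<otimes> x \<in> B"
  obtains e h \<alpha> \<gamma> p q where "has_val \<alpha> p" "has_val \<gamma> q" "complementary p q"
    "e + (p - 1) \<le> h" "h \<le> 2 * e + (p - 1)" "h \<le> m" "B = tri (t [^] e \<otimes> \<alpha>) (t [^] h \<otimes> \<gamma>)"
proof -
  note cl = subringE(2,3)[OF B(1)] subringE(5-7)[OF B(1)]
  have DB: "\<And>d. d \<in> D \<Longrightarrow> d \<in> B" and BA: "\<And>b. b \<in> B \<Longrightarrow> b \<in> A" using B by auto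
  have cm: "b \<ominus> c \<in> B" if "b \<in> B" "c \<in> B" for b c unfolding minus_eq using that by (intro cl)
  have comb: "x \<oplus> y \<otimes> z \<oplus> y' \<otimes> z' \<in> B" if "x \<in> D" "y \<in> D" "y' \<in> D" "z \<in> B" "z' \<in> B" for x y y' z z'
    using that DB by (simp add: cl)
  define P where "P e \<longleftrightarrow> (\<forall>b \<in> B. \<exists>d \<in> D. \<exists>x \<in> A. b = d \<oplus> t [^] e \<otimes> x)" for e :: nat
  \<comment> \<open>The valuation 3i + 1 of \<open>t [^] i \<otimes> \<tau>\<close> keeps it out of
    \<open>D + t\<^sup>i\<^sup>+\<^sup>1A\<close>. This bounds e by m, and later by h.\<close>
  have small: "e \<le> i" if asm: "P e" "t [^] i \<otimes> \<tau> \<in> B" for e i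
  proof (rule ccontr)
    assume "\<not> e \<le> i"
    obtain d x where dx: "d \<in> D" "x \<in> A" "t [^] i \<otimes> \<tau> = d \<oplus> t [^] e \<otimes> x"
      using asm unfolding P_def by blast
    have v: "has_val (t [^] i \<otimes> \<tau>) (3 * i + 1)" using has_val_mult[OF has_val_t_pow has_val_tau] .
    have "\<not> (3::nat) dvd (3 * i + 1)" by presburger
    moreover have "t [^] e \<otimes> x \<in> F (3 * e)" unfolding F_eq_t_pow using dx by blast
    hence "t [^] e \<otimes> x \<in> F (Suc (3 * i + 1))" using F_mono[of _ "3 * e" "Suc (3 * i + 1)"] \<open>\<not> e \<le> i\<close> by simp
    ultimately show False using not_congruent_D[OF v _ dx(1)] dx(3) by blast
  qed
  have "P 0" unfolding P_def
  proof
    fix b assume "b \<in> B"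
    hence "b \<in> A" "b = \<zero> \<oplus> t [^] (0::nat) \<otimes> b" using BA by auto
    thus "\<exists>d \<in> D. \<exists>x \<in> A. b = d \<oplus> t [^] (0::nat) \<otimes> x" by blast
  qed
  define e where "e = (GREATEST e. P e)"
  have bound: "\<And>i. P i \<Longrightarrow> i \<le> m" using small m by blast
  have Pe: "P e" unfolding e_def by (rule GreatestI_nat[of P 0 m, OF \<open>P 0\<close>]) (use bound in blast)
  have nPe: "\<not> P (Suc e)"
    using Greatest_le_nat[of P "Suc e" m] bound unfolding e_def by auto
  have ex: "\<exists>\<alpha> p. has_val \<alpha> p \<and> (p = 1 \<or> p = 2) \<and> t [^] e \<otimes> \<alpha> \<in> B"
  proof -
    obtain b where b: "b \<in> B" "\<And>d x. d \<in> D \<Longrightarrow> x \<in> A \<Longrightarrow> b \<noteq> d \<oplus> t [^] Suc e \<otimes> x"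
      using nPe unfolding P_def by blast
    obtain d y where dy: "d \<in> D" "y \<in> A" "b = d \<oplus> t [^] e \<otimes> y" using Pe b(1) unfolding P_def by blast
    obtain a a1 a2 where a: "a \<in> D" "a1 \<in> D" "a2 \<in> D" "y = a \<oplus> a1 \<otimes> \<tau> \<oplus> a2 \<otimes> (\<tau> \<otimes> \<tau>)"
      using A_basis[OF has_val_tau has_val_tau_square _ dy(2)] by auto
    \<comment> \<open>Dropping the constant coordinate changes b by an element of \<open>D\<close>
      and leaves positive valuation. The valuation is at most 2, since an \<alpha> in tA would put b
      into \<open>D + t\<^sup>e\<^sup>+\<^sup>1A\<close>.\<close>
    define \<alpha> where "\<alpha> = a1 \<otimes> \<tau> \<oplus> a2 \<otimes> (\<tau> \<otimes> \<tau>)"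
    have \<alpha>: "\<alpha> \<in> A" unfolding \<alpha>_def using a by auto
    have y: "y = a \<oplus> \<alpha>" unfolding a(4) \<alpha>_def using a by (simp add: a_assoc)
    note C = A_carrier[OF \<alpha>] D_carrier[OF a(1)] D_carrier[OF dy(1)] t_pow_carrier[of e]
    have "t [^] e \<otimes> \<alpha> = b \<ominus> (d \<oplus> t [^] e \<otimes> a)"
      unfolding dy(3) y using C by algebra
    hence in_B: "t [^] e \<otimes> \<alpha> \<in> B" using cm[OF b(1) DB[of "d \<oplus> t [^] e \<otimes> a"]] dy a by auto
    have "\<tau> \<in> F 1" using has_val_F[OF has_val_tau] by simp
    hence F1: "\<alpha> \<in> F 1" unfolding \<alpha>_def using a by auto
    have "\<alpha> \<notin> F 3"
    proof
      assume "\<alpha> \<in> F 3"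
      then obtain x where x: "x \<in> A" "\<alpha> = t \<otimes> x" using F_eq_t_pow[of 1] by auto
      have "b = (d \<oplus> t [^] e \<otimes> a) \<oplus> t [^] e \<otimes> \<alpha>" unfolding dy(3) y using C by algebra
      also have "t [^] e \<otimes> \<alpha> = t [^] Suc e \<otimes> x" using x by (simp add: m_assoc)
      finally show False using b(2)[of "d \<oplus> t [^] e \<otimes> a" x] x dy a by auto
    qed
    hence "has_val \<alpha> 1 \<or> has_val \<alpha> 2"
      using has_valI[of \<alpha> 1] has_valI[of \<alpha> 2] F1 by (auto simp: numeral_2_eq_2 numeral_3_eq_3)
    thus ?thesis using in_B by blast
  qed
  \<comment> \<open>If valuation 2 has to be used, \<open>t [^] e \<otimes> \<tau>\<close> is not in
    \<open>B\<close>, so h > e. This makes \<open>h - e - (p - 1)\<close>, the s of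
    \<open>C_ring\<close>, a true difference.\<close>
  have "\<exists>\<alpha> p. has_val \<alpha> p \<and> (p = 1 \<or> p = 2) \<and> t [^] e \<otimes> \<alpha> \<in> B \<and> (p = 2 \<longrightarrow> t [^] e \<otimes> \<tau> \<notin> B)"
  proof (cases "t [^] e \<otimes> \<tau> \<in> B")
    case True
    thus ?thesis using has_val_tau by (intro exI[of _ \<tau>] exI[of _ 1]) simp
  next
    case False
    thus ?thesis using ex by blast
  qed
  then obtain \<alpha> p where \<alpha>: "has_val \<alpha> p" "p = 1 \<or> p = 2" "t [^] e \<otimes> \<alpha> \<in> B"
    "p = 2 \<Longrightarrow> t [^] e \<otimes> \<tau> \<notin> B"
    by blast
  obtain \<gamma> where \<gamma>: "has_val \<gamma> (3 - p)" "\<alpha> \<otimes> \<alpha> = t [^] (p - 1) \<otimes> \<gamma>"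
    using has_val_square_factor[OF \<alpha>(1,2)] by blast
  have pq: "complementary p (3 - p)" using \<alpha>(2) by auto
  note C = has_val_carrier[OF \<alpha>(1)] has_val_carrier[OF \<gamma>(1)] t_pow_carrier[of e]
    t_pow_carrier[of "p - 1"]
  define Q where "Q h \<longleftrightarrow> (\<forall>x \<in> A. t [^] h \<otimes> x \<in> B)" for h :: nat
  \<comment> \<open>For i \<ge> e the terms with 1 and \<alpha> are in \<open>B\<close> anyway, so
    \<gamma> alone decides whether \<open>B\<close> contains \<open>t\<^sup>iA\<close>.\<close>
  have QI: "Q i" if "t [^] i \<otimes> \<gamma> \<in> B" "e \<le> i" for i
    unfolding Q_def
  proof
    fix x assume "x \<in> A"
    then obtain a b c where abc: "a \<in> D" "b \<in> D" "c \<in> D" "x = a \<oplus> b \<otimes> \<alpha> \<oplus> c \<otimes> \<gamma>"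
      using A_basis[OF \<alpha>(1) \<gamma>(1) pq] by blast
    define u where "u = t [^] (i - e)"
    have u: "u \<in> D" "t [^] i = u \<otimes> t [^] e"
      unfolding u_def using that(2) by (auto simp: nat_pow_mult)
    have "t [^] i \<otimes> x = t [^] i \<otimes> a \<oplus> (u \<otimes> b) \<otimes> (t [^] e \<otimes> \<alpha>) \<oplus> c \<otimes> (t [^] i \<otimes> \<gamma>)"
      unfolding abc(4) u(2) using abc(1-3)[THEN D_carrier] u(1)[THEN D_carrier] C(1-3) by algebra
    also have "\<dots> \<in> B"
      using abc(1-3) u(1) \<alpha>(3) that(1) by (intro comb) auto
    finally show "t [^] i \<otimes> x \<in> B" .
  qed
  define h where "h = (LEAST h. Q h)"
  have Qh: "Q h" unfolding h_def by (rule LeastI[of Q m]) (use m Q_def in blast)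
  have h_le: "h \<le> i" if "Q i" for i unfolding h_def using that by (rule Least_le)
  have h1: "h \<le> 2 * e + (p - 1)"
  proof (rule h_le, rule QI)
    have "t [^] (2 * e + (p - 1)) \<otimes> \<gamma> = t [^] e \<otimes> t [^] e \<otimes> (t [^] (p - 1) \<otimes> \<gamma>)"
    proof -
      have "2 * e + (p - 1) = e + (e + (p - 1))" by simp
      hence "t [^] (2 * e + (p - 1)) = t [^] e \<otimes> (t [^] e \<otimes> t [^] (p - 1))"
        by (simp only: nat_pow_mult D_carrier t_in_D)
      thus ?thesis using C by (simp add: m_assoc)
    qed
    also have "\<dots> = (t [^] e \<otimes> \<alpha>) \<otimes> (t [^] e \<otimes> \<alpha>)"
      unfolding \<gamma>(2)[symmetric] using C(1,3) by algebra
    finally show "t [^] (2 * e + (p - 1)) \<otimes> \<gamma> \<in> B" using cl(4)[OF \<alpha>(3) \<alpha>(3)] by simp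
  qed simp
  have tauB: "t [^] h \<otimes> \<tau> \<in> B" using Qh unfolding Q_def by simp
  have h2: "e + (p - 1) \<le> h"
    using small[OF Pe tauB] \<alpha>(2,4) tauB by (cases "h = e") auto
  have eq: "B = tri (t [^] e \<otimes> \<alpha>) (t [^] h \<otimes> \<gamma>)"
  proof (intro equalityI subsetI)
    fix b assume b: "b \<in> B"
    obtain d y where dy: "d \<in> D" "y \<in> A" "b = d \<oplus> t [^] e \<otimes> y" using Pe b(1) unfolding P_def by blast
    obtain a a1 a2 where a: "a \<in> D" "a1 \<in> D" "a2 \<in> D" "y = a \<oplus> a1 \<otimes> \<alpha> \<oplus> a2 \<otimes> \<gamma>"
      using A_basis[OF \<alpha>(1) \<gamma>(1) pq dy(2)] by blast
    note Ca = C(1-3) a(1-3)[THEN D_carrier] dy(1)[THEN D_carrier]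
    have b1: "b = (d \<oplus> t [^] e \<otimes> a) \<oplus> a1 \<otimes> (t [^] e \<otimes> \<alpha>) \<oplus> t [^] e \<otimes> a2 \<otimes> \<gamma>"
      unfolding dy(3) a(4) using Ca by algebra
    \<comment> \<open>Minimality of h: if \<open>a2\<close> is a unit times \<open>t [^] j\<close>,
      then \<open>B\<close> contains \<open>t [^] (e + j) \<otimes> \<gamma>\<close>, so h \<le> e +
      j.\<close>
    have "\<exists>c \<in> D. t [^] e \<otimes> a2 \<otimes> \<gamma> = c \<otimes> (t [^] h \<otimes> \<gamma>)"
    proof (cases "a2 = \<zero>")
      case True
      thus ?thesis using C by (intro bexI[of _ \<zero>]) auto
    next
      case False
      then obtain j u u' where u: "u \<in> D" "u' \<in> D" "u \<otimes> u' = \<one>" "a2 = t [^] (j::nat) \<otimes> u"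
        using D_factor[OF a(3)] by blast
      note Cu = u(1,2)[THEN D_carrier] t_pow_carrier[of j]
      have "t [^] (e + j) \<otimes> \<gamma> = (u \<otimes> u') \<otimes> (t [^] (e + j) \<otimes> \<gamma>)"
        unfolding u(3) using C by simp
      also have "\<dots> = u' \<otimes> (t [^] e \<otimes> a2 \<otimes> \<gamma>)"
        unfolding u(4) nat_pow_mult[OF t_carrier, symmetric] using C(1-3) Cu by algebra
      also have "\<dots> = u' \<otimes> (b \<ominus> ((d \<oplus> t [^] e \<otimes> a) \<oplus> a1 \<otimes> (t [^] e \<otimes> \<alpha>)))"
        unfolding b1 using Ca Cu(2) by algebra
      finally have "t [^] (e + j) \<otimes> \<gamma> \<in> B"
        using cl(4)[OF DB[OF u(2)] cm[OF b cl(5)[OF DB cl(4)[OF DB[OF a(2)] \<alpha>(3)]]]] dy(1) a(1)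
        by auto
      hence hj: "h \<le> e + j" using h_le QI by simp
      define w where "w = t [^] (e + j - h)"
      have w: "w \<in> D" "t [^] e \<otimes> t [^] j = w \<otimes> t [^] h"
        unfolding w_def using hj by (auto simp: nat_pow_mult)
      have "t [^] e \<otimes> a2 \<otimes> \<gamma> = (t [^] e \<otimes> t [^] j) \<otimes> u \<otimes> \<gamma>"
        unfolding u(4) using C Cu by (simp add: m_assoc)
      also have "\<dots> = (w \<otimes> u) \<otimes> (t [^] h \<otimes> \<gamma>)"
        unfolding w(2) using C(2) Cu w(1)[THEN D_carrier] t_pow_carrier[of h] by algebra
      finally show ?thesis using u(1) w(1) by blast
    qed
    then obtain c where c: "c \<in> D" "t [^] e \<otimes> a2 \<otimes> \<gamma> = c \<otimes> (t [^] h \<otimes> \<gamma>)" by blast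
    show "b \<in> tri (t [^] e \<otimes> \<alpha>) (t [^] h \<otimes> \<gamma>)"
      unfolding b1 c(2) using a c dy by (intro tri_I) auto
  next
    fix b assume "b \<in> tri (t [^] e \<otimes> \<alpha>) (t [^] h \<otimes> \<gamma>)"
    moreover have "t [^] h \<otimes> \<gamma> \<in> B" using Qh \<gamma>(1) unfolding Q_def by simp
    ultimately show "b \<in> B" unfolding tri_def using comb \<alpha>(3) by blast
  qed
  have "h \<le> m" using h_le m Q_def by blast
  thus thesis using that[OF \<alpha>(1) \<gamma>(1) pq h2 h1 _ eq] by blast
qed

corollary over_ring_eq_shifted_C_ring:
  assumes "subring B L" "D \<subseteq> B" "B \<subseteq> A" and "\<And>x. x \<in> A \<Longrightarrow> t [^] m \<otimes> x \<in> B"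
  obtains k r \<alpha> p where "r + k \<le> m" "has_val \<alpha> p" "p = (if even r then 1 else 2)"
    "B = (t [^] k <#\<^bsub>L\<^esub> C_ring L D A t r \<alpha>) <+>\<^bsub>L\<^esub> D"
proof -
  obtain e h \<alpha> \<gamma> p q where *: "has_val \<alpha> p" "has_val \<gamma> q" "complementary p q"
    "e + (p - 1) \<le> h" "h \<le> 2 * e + (p - 1)" "h \<le> m" "B = tri (t [^] e \<otimes> \<alpha>) (t [^] h \<otimes> \<gamma>)"
    by (rule over_ring_shape[OF assms])
  \<comment> \<open>The unique solution of k + s = e and k + 2s + (p - 1) = h. The two bounds on h
    say that neither difference is truncated.\<close>
  define s where "s = h - e - (p - 1)"
  define k where "k = 2 * e + (p - 1) - h"
  have ks: "k + s = e" "k + (2 * s + (p - 1)) = h" unfolding s_def k_def using *(4,5) by auto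
  have "B = (t [^] k <#\<^bsub>L\<^esub> C_ring L D A t (2 * s + (p - 1)) \<alpha>) <+>\<^bsub>L\<^esub> D"
    unfolding shifted_C_ring_eq_tri[OF *(1-3) refl] ks by (rule *(7))
  moreover have "2 * s + (p - 1) + k \<le> m" using ks *(6) by simp
  moreover have "p = (if even (2 * s + (p - 1)) then 1 else 2)" using *(3) by auto
  ultimately show thesis using that[OF _ *(1)] by blast
qed

section \<open>Local structure of over-rings\<close>

text \<open>y is x times a unit of \<open>A\<close>, and this unit is congruent to an element of
  \<open>D\<close> modulo \<open>F 1\<close>.\<close>

lemma residue_cancel:
  assumes "has_val x n" "has_val y n" shows "\<exists>d \<in> D. y \<ominus> d \<otimes> x \<in> F (Suc n)"
proof -
  obtain u w where uw: "unit u" "unit w" "x = \<tau> [^] n \<otimes> u" "y = \<tau> [^] n \<otimes> w"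
    using assms unfolding has_val_def by blast
  obtain u' where u': "u' \<in> A" "u \<otimes> u' = \<one>" using uw(1) unfolding unit_def by blast
  obtain d z where dz: "d \<in> D" "z \<in> F 1" "w \<otimes> u' = d \<oplus> z"
    using A_residue[of "w \<otimes> u'"] uw u'(1) by auto
  note C = unit_A[OF uw(1), THEN A_carrier] unit_A[OF uw(2), THEN A_carrier] u'(1)[THEN A_carrier]
    dz(1)[THEN D_carrier] F_A[OF dz(2), THEN A_carrier] A_carrier[OF A_pow[OF tau_in_A, of n]]
  have "w = w \<otimes> (u \<otimes> u')" using C u' by simp
  also have "\<dots> = (w \<otimes> u') \<otimes> u" using C by algebra
  finally have w: "w = (d \<oplus> z) \<otimes> u" unfolding dz(3) .
  have "y \<ominus> d \<otimes> x = \<tau> [^] n \<otimes> (w \<ominus> d \<otimes> u)" unfolding uw(3,4) using C by algebra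
  also have "w \<ominus> d \<otimes> u = z \<otimes> u" unfolding w using C by algebra
  also have "\<tau> [^] n \<otimes> (z \<otimes> u) \<in> F (n + 1)"
    using F_mult[OF F_I[of \<one> n], of "z \<otimes> u" 1] dz(2) uw(1) by simp
  finally show ?thesis using dz(1) by auto
qed

section \<open>Rings between \<open>D\<close> and \<open>A\<close> that contain some
  \<open>t\<^sup>mA\<close>\<close>

context
  fixes B :: "'a set" and m :: nat
  assumes B_subring: "subring B L" and D_le_B: "D \<subseteq> B" and B_le_A: "B \<subseteq> A"
    and conductor: "\<And>x. x \<in> A \<Longrightarrow> t [^] m \<otimes> x \<in> B"
begin

abbreviation BR :: "('a, 'b) ring_scheme" where "BR \<equiv> L\<lparr>carrier := B\<rparr>"

interpretation S: domain BR
  using subdomain_is_domain subdomainI' B_subring by blast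

lemma B_A: "b \<in> B \<Longrightarrow> b \<in> A" and D_B: "d \<in> D \<Longrightarrow> d \<in> B"
  using B_le_A D_le_B by auto

text \<open>A factor \<open>t [^] m\<close> brings the cofactor from \<open>A\<close> into
  \<open>B\<close>.\<close>

lemma overring_divides_t_pow: assumes "x \<in> B" "x \<noteq> \<zero>" shows "\<exists>n::nat. \<exists>y \<in> B. x \<otimes> y = t [^] n"
proof -
  obtain n b where b: "b \<in> A" "x \<otimes> b = t [^] (n::nat)" using divides_t_pow B_A assms by blast
  note C = A_carrier[OF B_A[OF assms(1)]] A_carrier[OF b(1)] t_pow_carrier[of m]
  have "x \<otimes> (t [^] m \<otimes> b) = t [^] m \<otimes> (x \<otimes> b)" using C by algebra
  also have "\<dots> = t [^] (m + n)" unfolding b(2) by (simp add: nat_pow_mult)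
  finally show ?thesis using conductor[OF b(1)] by blast
qed

text \<open>The power lies in \<open>F (3 * (m + 1))\<close>, that is in
  \<open>t\<^sup>m\<^sup>+\<^sup>1A\<close>; of the m + 1 factors t, m are spent on getting from
  \<open>A\<close> into \<open>B\<close>.\<close>

lemma pow_divisible_by_t:
  assumes "y \<in> F 1" shows "\<exists>z \<in> B. y [^] (3 * (m + 1)) = t \<otimes> z"
proof -
  have *: "y [^] n \<in> F n" for n
  proof (induct n)
    case (Suc n) thus ?case using F_mult[OF Suc assms] by simp
  qed simp
  obtain a where a: "a \<in> A" "y [^] (3 * (m + 1)) = t [^] (m + 1) \<otimes> a"
    using * F_eq_t_pow by blast
  have "t [^] (m + 1) \<otimes> a = t \<otimes> (t [^] m \<otimes> a)"
    using A_carrier[OF a(1)] t_carrier t_pow_carrier[of m]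
    by (simp add: m_ac)
  thus ?thesis using a conductor by metis
qed

lemma ideal_of_subringI:
  assumes "I \<subseteq> B" "\<zero> \<in> I" "\<And>x y. x \<in> I \<Longrightarrow> y \<in> I \<Longrightarrow> x \<oplus> y \<in> I" "\<And>b x. b \<in> B \<Longrightarrow> x \<in> I \<Longrightarrow> b \<otimes> x \<in> I"
  shows "ideal I BR"
proof (rule idealI)
  show "ring BR" by (rule S.ring_axioms)
  show "subgroup I (add_monoid BR)"
  proof (rule S.add.subgroupI)
    fix a assume a: "a \<in> I"
    have aB: "a \<in> B" using a assms by blast
    have one: "\<ominus>\<^bsub>BR\<^esub> \<one> \<in> B" using S.a_inv_closed[of \<one>] S.one_closed by simp
    have "\<ominus>\<^bsub>BR\<^esub> a = (\<ominus>\<^bsub>BR\<^esub> \<one>) \<otimes> a"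
      using S.l_minus[of \<one> a] S.one_closed S.l_one[of a] aB by simp
    thus "\<ominus>\<^bsub>BR\<^esub> a \<in> I" using assms(4)[OF one a] by simp
  qed (use assms in auto)
  fix a x assume ax: "a \<in> I" "x \<in> carrier BR"
  thus xa: "x \<otimes>\<^bsub>BR\<^esub> a \<in> I" using assms(4) by simp
  have "a \<in> B" using ax assms(1) by blast
  thus "a \<otimes>\<^bsub>BR\<^esub> x \<in> I" using xa S.m_comm[of a x] ax(2) by simp
qed

text \<open>A nonzero element of \<open>P\<close> divides a power of t, so t is in \<open>P\<close>;
  every element of \<open>B \<inter> F 1\<close> has a power in tB, hence lies in \<open>P\<close>
  too.\<close>

lemma nonzero_prime_contains:
  assumes "primeideal P BR" "P \<noteq> {\<zero>}" shows "B \<inter> F 1 \<subseteq> P"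
proof
  interpret P: primeideal P BR by fact
  have PB: "P \<subseteq> B" using P.a_subset by simp
  have one: "\<one> \<notin> P" using P.one_imp_carrier P.I_notcarr by auto
  have prime: "a \<in> P \<or> b \<in> P" if "a \<in> B" "b \<in> B" "a \<otimes> b \<in> P" for a b
    using P.I_prime[of a b] that by simp
  have pow: "x \<in> P" if "x \<in> B" "x [^] (n::nat) \<in> P" for x n
    using that(2)
  proof (induct n)
    case 0 thus ?case using one by simp
  next
    case (Suc n)
    have "x [^] n \<in> B" using that(1) by (induct n) (use subringE(3,6)[OF B_subring] in auto)
    thus ?case using prime[of "x [^] n" x] Suc that(1) by auto
  qed
  have "\<zero> \<in> P" using P.zero_closed by simp
  then obtain x where x: "x \<in> P" "x \<noteq> \<zero>" using assms(2) by blast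
  have "x \<in> B" using x PB by blast
  then obtain n y where y: "y \<in> B" "x \<otimes> y = t [^] (n::nat)" using overring_divides_t_pow x(2) by blast
  have "t [^] n \<in> P" using P.I_r_closed[OF x(1), of y] y by simp
  hence tP: "t \<in> P" using pow D_B by blast
  fix y assume y: "y \<in> B \<inter> F 1"
  then obtain z where z: "z \<in> B" "y [^] (3 * (m + 1)) = t \<otimes> z" using pow_divisible_by_t by blast
  hence "y [^] (3 * (m + 1)) \<in> P" using P.I_r_closed[OF tP, of z] by simp
  thus "y \<in> P" using pow y by blast
qed

text \<open>Let a proper ideal contain \<open>B \<inter> F 1\<close>. Subtracting from one of its
  elements a suitable part in \<open>F 1\<close> leaves an element of \<open>D\<close> in the ideal,
  which is not invertible and so is divisible by t.\<close>

lemma overring_maximalideal: "maximalideal (B \<inter> F 1) BR"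
proof (rule maximalidealI)
  show "ideal (B \<inter> F 1) BR"
    by (rule ideal_of_subringI) (use subringE(2,6,7)[OF B_subring] B_A in auto)
  have "\<one> \<notin> F 1" using unit_notin_F by simp
  thus "carrier BR \<noteq> B \<inter> F 1" using S.one_closed by auto
  fix I assume I: "ideal I BR" "B \<inter> F 1 \<subseteq> I" "I \<subseteq> carrier BR"
  interpret I: ideal I BR by fact
  show "I = B \<inter> F 1 \<or> I = carrier BR"
  proof (rule disjCI)
    assume "I \<noteq> carrier BR"
    hence one: "\<one> \<notin> I" using I.one_imp_carrier by auto
    have "x \<in> F 1" if x: "x \<in> I" for x
    proof -
      have xB: "x \<in> B" using x I(3) by auto
      obtain d z where dz: "d \<in> D" "z \<in> F 1" "x = d \<oplus> z" using A_residue B_A[OF xB] by blast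
      note C = D_carrier[OF dz(1)] F_A[OF dz(2), THEN A_carrier]
      \<comment> \<open>Negation in \<open>BR\<close> is a different term from negation in
        \<open>L\<close>; a product with \<open>\<ominus> \<one>\<close> avoids it, since the two
        records share their multiplication.\<close>
      have mone: "\<ominus> \<one> \<in> B" using D_B by simp
      have "z = x \<oplus> (\<ominus> \<one>) \<otimes> d" unfolding dz(3) using C by algebra
      hence "z \<in> B" using subringE(6,7)[OF B_subring] xB mone D_B[OF dz(1)] by auto
      hence zI: "z \<in> I" using I(2) dz(2) by blast
      have "d = x \<oplus> (\<ominus> \<one>) \<otimes> z" unfolding dz(3) using C by algebra
      moreover have "(\<ominus> \<one>) \<otimes> z \<in> I" using I.I_l_closed[OF zI, of "\<ominus> \<one>"] mone by simp
      ultimately have dI: "d \<in> I" using I.a_closed[OF x, of "(\<ominus> \<one>) \<otimes> z"] by simp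
      have "\<not> (\<exists>d' \<in> D. d \<otimes> d' = \<one>)"
      proof
        assume "\<exists>d' \<in> D. d \<otimes> d' = \<one>"
        then obtain d' where d': "d' \<in> D" "d \<otimes> d' = \<one>" by blast
        show False using I.I_r_closed[OF dI, of d'] D_B[OF d'(1)] d'(2) one by simp
      qed
      then obtain b where "b \<in> D" "d = t \<otimes> b" using D_cases dz(1) by blast
      moreover have "t \<in> F 1" using t_in_F by simp
      ultimately have "d \<in> F 1" by auto
      thus ?thesis using dz(2,3) by auto
    qed
    thus "I = B \<inter> F 1" using I(2,3) by auto
  qed
qed

lemma t_in_maximalideal: "t \<in> B \<inter> F 1"
  using has_val_F[OF has_val_t, of 1] D_B by simp

lemma overring_maximalideal_unique:
  assumes "maximalideal M BR" shows "M = B \<inter> F 1"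
proof -
  interpret M: maximalideal M BR by fact
  interpret J: maximalideal "B \<inter> F 1" BR by (rule overring_maximalideal)
  have "B \<inter> F 1 \<subseteq> M"
  proof (cases "M = {\<zero>}")
    case True
    hence "M \<subseteq> B \<inter> F 1" using J.zero_closed by simp
    hence "B \<inter> F 1 = M \<or> B \<inter> F 1 = carrier BR"
      using M.I_maximal J.is_ideal by auto
    thus ?thesis using J.I_notcarr by auto
  next
    case False
    thus ?thesis using nonzero_prime_contains S.maximalideal_prime[OF assms] by blast
  qed
  thus ?thesis using J.I_maximal[OF M.is_ideal] M.a_subset M.I_notcarr by auto
qed

lemma overring_local_ring: "local_ring BR"
  unfolding local_ring_def using S.is_cring overring_maximalideal overring_maximalideal_unique by blast

text \<open>The only primes are the zero ideal and \<open>B \<inter> F 1\<close>, by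
  \<open>nonzero_prime_contains\<close>, and t separates them.\<close>

lemma overring_krull_dim: "krull_dim BR = 1"
proof -
  let ?chains = "{Ps. Ps \<noteq> [] \<and> (\<forall>P \<in> set Ps. primeideal P BR) \<and> sorted_wrt (\<subset>) Ps}"
  have J_prime: "primeideal (B \<inter> F 1) BR"
    using S.maximalideal_prime[OF overring_maximalideal] .
  have primes: "P = {\<zero>} \<or> P = B \<inter> F 1" if P: "primeideal P BR" for P
  proof -
    interpret P: primeideal P BR by fact
    interpret J: maximalideal "B \<inter> F 1" BR by (rule overring_maximalideal)
    show ?thesis
      using nonzero_prime_contains[OF P] J.I_maximal[OF P.is_ideal] P.a_subset P.I_notcarr by auto
  qed
  have length: "length Ps \<le> 2"
    if Ps: "\<forall>P \<in> set Ps. primeideal P BR" "sorted_wrt (\<subset>) Ps" for Ps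
  proof -
    have "distinct Ps" using Ps(2) by (induct Ps) auto
    moreover have "set Ps \<subseteq> {{\<zero>}, B \<inter> F 1}" using Ps(1) primes by blast
    hence "card (set Ps) \<le> card {{\<zero>}, B \<inter> F 1}" by (intro card_mono) auto
    moreover have "card {{\<zero>}, B \<inter> F 1} \<le> 2" by (simp add: card_insert_if)
    ultimately show ?thesis by (simp add: distinct_card)
  qed
  have "{\<zero>} \<subset> B \<inter> F 1" using t_in_maximalideal t_nonzero D_B by auto
  hence chain: "[{\<zero>}, B \<inter> F 1] \<in> ?chains"
    using J_prime S.zeroprimeideal by simp
  show ?thesis
    unfolding krull_dim_def
  proof (rule antisym)
    show "(SUP Ps\<in>?chains. enat (length Ps - 1)) \<le> 1"
    proof (rule SUP_least)
      fix Ps assume "Ps \<in> ?chains"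
      hence "length Ps - 1 \<le> 1" using length[of Ps] by auto
      thus "enat (length Ps - 1) \<le> 1" by (simp add: one_enat_def)
    qed
    show "1 \<le> (SUP Ps\<in>?chains. enat (length Ps - 1))"
      using SUP_upper[OF chain, of "\<lambda>Ps. enat (length Ps - 1)"] by (simp add: one_enat_def)
  qed
qed

text \<open>
  An ideal is generated by one of its elements for each small valuation that occurs in it,
  together with generators of a multiple of \<open>A\<close> inside it.
\<close>

lemma overring_noetherian_ring: "noetherian_ring BR"
proof (rule S.noetherian_ringI)
  fix I assume "ideal I BR"
  then interpret I: ideal I BR .
  have IB: "I \<subseteq> B" using I.a_subset by simp
  show "\<exists>G \<subseteq> carrier BR. finite G \<and> I = Idl\<^bsub>BR\<^esub> G"
  proof (cases "I = {\<zero>}")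
    case True
    thus ?thesis using S.genideal_zero S.zero_closed by (intro exI[of _ "{\<zero>}"]) auto
  next
    case False
    then obtain x where x: "x \<in> I" "x \<noteq> \<zero>" using I.zero_closed by auto
    have "x \<in> B" using x IB by blast
    then obtain n y where y: "y \<in> B" "x \<otimes> y = t [^] (n::nat)" using overring_divides_t_pow x(2) by blast
    have tn: "t [^] n \<in> I" using I.I_r_closed[OF x(1), of y] y by simp
    have tnm: "t [^] (n + m) \<otimes> a \<in> I" if "a \<in> A" for a
    proof -
      have "t [^] (n + m) \<otimes> a = t [^] n \<otimes> (t [^] m \<otimes> a)"
        using that by (simp add: nat_pow_mult[symmetric] m_assoc)
      thus ?thesis using I.I_r_closed[OF tn, of "t [^] m \<otimes> a"] conductor[OF that] by simp
    qed
    define N where "N = 3 * (n + m)"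
    \<comment> \<open>If \<open>I\<close> has no element of valuation i, the value
      \<open>w i\<close> is arbitrary; the condition \<open>w i \<in> I\<close> in \<open>G\<close>
      keeps the generators inside \<open>I\<close>.\<close>
    define w where "w i = (SOME w. w \<in> I \<and> has_val w i)" for i
    have w: "w i \<in> I \<and> has_val (w i) i" if "y \<in> I" "has_val y i" for y i
      unfolding w_def using someI[of "\<lambda>w. w \<in> I \<and> has_val w i" y] that by blast
    define G where "G = {w i | i. i < N \<and> w i \<in> I} \<union>
      {t [^] (n + m) \<otimes> \<one>, t [^] (n + m) \<otimes> \<tau>, t [^] (n + m) \<otimes> (\<tau> \<otimes> \<tau>)}"
    have "finite G" unfolding G_def by auto
    have GI: "G \<subseteq> I" unfolding G_def using tnm[of \<one>] tnm[of \<tau>] tnm[of "\<tau> \<otimes> \<tau>"] by auto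
    hence GB: "G \<subseteq> carrier BR" using IB by auto
    let ?G = "Idl\<^bsub>BR\<^esub> G"
    interpret G: ideal ?G BR by (rule S.genideal_ideal[OF GB])
    have GG: "G \<subseteq> ?G" by (rule S.genideal_self[OF GB])
    have mulG: "d \<otimes> g \<in> ?G" if "d \<in> D" "g \<in> G" for d g
      using G.I_l_closed[of g d] GG that D_B by auto
    have addG: "g \<oplus> h \<in> ?G"
      if "g \<in> ?G" "h \<in> ?G" for g h
      using G.a_closed[OF that] by simp
    \<comment> \<open>Cancelling leading terms with the \<open>w i\<close> raises the valuation up
      to N; there y lies in \<open>t\<^sup>n\<^sup>+\<^sup>mA\<close>, which the last three
      generators span over \<open>D\<close>. The induction variable k is the distance to N.\<close>
    have descent: "y \<in> ?G" if "y \<in> I" "y \<in> F (N - k)" "k \<le> N" for y k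
      using that
    proof (induct k arbitrary: y)
      case 0
      then obtain a where a: "a \<in> A" "y = t [^] (n + m) \<otimes> a" using F_eq_t_pow[of "n + m"] unfolding N_def by auto
      obtain a0 a1 a2 where as: "a0 \<in> D" "a1 \<in> D" "a2 \<in> D" "a = a0 \<oplus> a1 \<otimes> \<tau> \<oplus> a2 \<otimes> (\<tau> \<otimes> \<tau>)"
        using A_basis[OF has_val_tau has_val_tau_square _ a(1)] by auto
      have "y = a0 \<otimes> (t [^] (n + m) \<otimes> \<one>) \<oplus> a1 \<otimes> (t [^] (n + m) \<otimes> \<tau>) \<oplus> a2 \<otimes> (t [^] (n + m) \<otimes> (\<tau> \<otimes> \<tau>))"
        unfolding a(2) as(4) using as(1-3)[THEN D_carrier] A_carrier[OF tau_in_A]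
          t_pow_carrier[of "n + m"] by algebra
      also have "\<dots> \<in> ?G"
        using as(1-3) by (intro addG mulG) (auto simp: G_def)
      finally show ?case .
    next
      case (Suc k)
      define i where "i = N - Suc k"
      have i: "i < N" "N - k = Suc i" unfolding i_def using Suc(4) by auto
      show ?case
      proof (cases "y \<in> F (Suc i)")
        case True
        thus ?thesis using Suc i by auto
      next
        case False
        hence v: "has_val y i" using has_valI Suc(3) unfolding i_def by blast
        have wi: "w i \<in> I" "has_val (w i) i" using w[OF Suc(2) v] by auto
        obtain d where d: "d \<in> D" "y \<ominus> d \<otimes> w i \<in> F (Suc i)" using residue_cancel[OF wi(2) v] by blast
        note C = D_carrier[OF d(1)] has_val_carrier[OF v] has_val_carrier[OF wi(2)]
        have wG: "w i \<in> G" unfolding G_def using i(1) wi(1) by blast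
        have "y \<ominus> d \<otimes> w i = y \<oplus> (\<ominus> d) \<otimes> w i" using C by algebra
        also have "\<dots> \<in> I"
          using I.a_closed[OF Suc(2) I.I_l_closed[OF wi(1), of "\<ominus> d"]] d(1) D_B[of "\<ominus> d"] by simp
        finally have "y \<ominus> d \<otimes> w i \<in> ?G"
          using Suc(1) d(2) i(2) Suc(4) by simp
        hence "(y \<ominus> d \<otimes> w i) \<oplus> d \<otimes> w i \<in> ?G"
          using addG mulG[OF d(1) wG] by blast
        moreover have "(y \<ominus> d \<otimes> w i) \<oplus> d \<otimes> w i = y" using C by algebra
        ultimately show ?thesis by simp
      qed
    qed
    have "I \<subseteq> ?G"
    proof
      fix y assume "y \<in> I"
      thus "y \<in> ?G" using descent[of y N] IB B_A by auto
    qed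
    moreover have "?G \<subseteq> I" using S.genideal_minimal[OF I.is_ideal GI] .
    ultimately show ?thesis using \<open>finite G\<close> GB by blast
  qed
qed

end

section \<open>Embedding dimensions\<close>

text \<open>This lets \<open>D\<close> serve as the set \<open>E\<close> of representatives in
  \<open>embedding_dim_representativesI\<close>.\<close>

lemma subring_residue:
  assumes "subring B L" "D \<subseteq> B" "B \<subseteq> A" "b \<in> B"
  shows "\<exists>d \<in> D. \<exists>j \<in> B \<inter> F 1. b = d \<oplus> j"
proof -
  have "b \<in> A" using assms by blast
  then obtain d z where dz: "d \<in> D" "z \<in> F 1" "b = d \<oplus> z" using A_residue by blast
  have "z = b \<oplus> (\<ominus> d)" unfolding dz(3) using D_carrier[OF dz(1)] F_A[OF dz(2), THEN A_carrier] by algebra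
  moreover have "\<ominus> d \<in> B" using assms(2) dz(1) by blast
  ultimately have "z \<in> B" using subringE(7)[OF assms(1) assms(4)] by simp
  thus ?thesis using dz by blast
qed

text \<open>Rules out r = 0 in the classification. With A = D + J and J = \<tau>A, the class of
  \<tau> spans the cotangent space; it is nonzero because products of two elements of J have
  valuation at least 2.\<close>

lemma embedding_dim_A: "embedding_dim (L\<lparr>carrier := A\<rparr>) = 1"
proof -
  let ?R = "L\<lparr>carrier := A\<rparr>"
  let ?J2 = "(A \<inter> F 1) \<cdot>\<^bsub>?R\<^esub> (A \<inter> F 1)"
  have cond: "\<And>x. x \<in> A \<Longrightarrow> t [^] (0::nat) \<otimes> x \<in> A" by simp
  interpret S: domain ?R using subdomain_is_domain subdomainI' A_subring by blast
  have tauF: "\<tau> \<in> F 1" using has_val_F[OF has_val_tau] by simp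
  show ?thesis
  proof (rule S.embedding_dim_eq_1I[of "A \<inter> F 1" D \<tau>])
    show "maximalideal (A \<inter> F 1) ?R" by (rule overring_maximalideal[OF A_subring D_le_A order_refl cond])
    show "\<And>M. maximalideal M ?R \<Longrightarrow> M = A \<inter> F 1"
      by (rule overring_maximalideal_unique[OF A_subring D_le_A order_refl cond])
    show "D \<subseteq> carrier ?R" using D_le_A by simp
    show "\<exists>d\<in>D. \<exists>j\<in>A \<inter> F 1. a = d \<oplus>\<^bsub>?R\<^esub> j" if "a \<in> carrier ?R" for a
      using subring_residue[OF A_subring D_le_A order_refl] that by simp
    show "\<tau> \<in> A \<inter> F 1" using tauF by simp
    fix w assume "w \<in> A \<inter> F 1"
    then obtain a where a: "a \<in> A" "w = \<tau> \<otimes> a" unfolding F_def by auto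
    obtain d j where dj: "d \<in> D" "j \<in> A \<inter> F 1" "a = d \<oplus> j"
      using subring_residue[OF A_subring D_le_A order_refl a(1)] by blast
    have s: "j \<otimes>\<^bsub>?R\<^esub> \<tau> \<in> ?J2"
      using dj(2) tauF by (intro ideal_prod.prod) auto
    have "w = d \<otimes> \<tau> \<oplus> j \<otimes> \<tau>"
      unfolding a(2) dj(3) using D_carrier[OF dj(1)] A_carrier[of j] dj(2) A_carrier[OF tau_in_A]
      by (simp add: m_comm r_distr)
    thus "\<exists>a\<in>D. \<exists>s\<in>?J2. w = a \<otimes>\<^bsub>?R\<^esub> \<tau> \<oplus>\<^bsub>?R\<^esub> s"
      by (intro bexI[OF _ dj(1)] bexI[OF _ s]) simp
  next
    fix a assume a: "a \<in> D" "a \<otimes>\<^bsub>?R\<^esub> \<tau> \<in> ?J2"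
    have "?J2 \<subseteq> F (1 + 1)"
      by (rule ideal_prod_subsetI) (use F_mult[of _ 1 _ 1] in auto)
    moreover have "a \<otimes> \<tau> \<in> ?J2" using a(2) by simp
    ultimately have "a \<otimes> \<tau> \<in> F (1 + 1)" by blast
    hence "a \<in> F (1 + 1 - 1)" by (intro F_cancel_mult[OF has_val_tau]) (use a(1) in auto)
    thus "a \<in> A \<inter> F 1" using a(1) by simp
  qed
qed

section \<open>Coordinates in the modules \<open>tri\<close>\<close>

lemma tri_add:
  assumes "\<beta> \<in> carrier L" "\<omega> \<in> carrier L" "x \<in> tri \<beta> \<omega>" "y \<in> tri \<beta> \<omega>" shows "x \<oplus> y \<in> tri \<beta> \<omega>"
proof -
  obtain a b c a' b' c' where *: "a \<in> D" "b \<in> D" "c \<in> D" "a' \<in> D" "b' \<in> D" "c' \<in> D"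
    "x = a \<oplus> b \<otimes> \<beta> \<oplus> c \<otimes> \<omega>" "y = a' \<oplus> b' \<otimes> \<beta> \<oplus> c' \<otimes> \<omega>" using assms(3,4) unfolding tri_def by blast
  have "x \<oplus> y = (a \<oplus> a') \<oplus> (b \<oplus> b') \<otimes> \<beta> \<oplus> (c \<oplus> c') \<otimes> \<omega>"
    unfolding *(7,8) using *(1-6)[THEN D_carrier] assms(1,2) by algebra
  thus ?thesis using tri_I[of "a \<oplus> a'" "b \<oplus> b'" "c \<oplus> c'"] * by simp
qed

lemma tri_smult:
  assumes "\<beta> \<in> carrier L" "\<omega> \<in> carrier L" "d \<in> D" "x \<in> tri \<beta> \<omega>" shows "d \<otimes> x \<in> tri \<beta> \<omega>"
proof -
  obtain a b c where *: "a \<in> D" "b \<in> D" "c \<in> D" "x = a \<oplus> b \<otimes> \<beta> \<oplus> c \<otimes> \<omega>"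
    using assms(4) unfolding tri_def by blast
  have "d \<otimes> x = (d \<otimes> a) \<oplus> (d \<otimes> b) \<otimes> \<beta> \<oplus> (d \<otimes> c) \<otimes> \<omega>"
    unfolding *(4) using *(1-3)[THEN D_carrier] assms(1,2) D_carrier[OF assms(3)] by algebra
  thus ?thesis using tri_I[of "d \<otimes> a" "d \<otimes> b" "d \<otimes> c"] * assms(3) by simp
qed

lemma D_subset_tri:
  assumes "\<beta> \<in> carrier L" "\<omega> \<in> carrier L" shows "D \<subseteq> tri \<beta> \<omega>"
proof
  fix d assume d: "d \<in> D"
  have "d = d \<oplus> \<zero> \<otimes> \<beta> \<oplus> \<zero> \<otimes> \<omega>" using d assms by simp
  thus "d \<in> tri \<beta> \<omega>" using tri_I[of d \<zero> \<zero> \<beta> \<omega>] d by simp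
qed

lemma tri_coords_zero:
  assumes "has_val \<alpha> p" "has_val \<gamma> q" "complementary p q"
    and abc: "a \<in> D" "b \<in> D" "c \<in> D" "a \<oplus> b \<otimes> (t [^] (e::nat) \<otimes> \<alpha>) \<oplus> c \<otimes> (t [^] (h::nat) \<otimes> \<gamma>) = \<zero>"
  shows "a = \<zero> \<and> b = \<zero> \<and> c = \<zero>"
proof -
  note C = abc(1-3)[THEN D_carrier] assms(1,2)[THEN has_val_carrier]
    t_pow_carrier[of e] t_pow_carrier[of h]
  have "a \<oplus> (b \<otimes> t [^] e) \<otimes> \<alpha> \<oplus> (c \<otimes> t [^] h) \<otimes> \<gamma> = \<zero>"
    using abc(4) C by (simp add: m_assoc)
  hence "a = \<zero> \<and> b \<otimes> t [^] e = \<zero> \<and> c \<otimes> t [^] h = \<zero>"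
    using coords_zero[OF assms(1-3), of a "b \<otimes> t [^] e" "c \<otimes> t [^] h"] abc(1-3) by simp
  thus ?thesis using C by (simp add: integral_iff)
qed

lemma tri_coords_unique:
  assumes "has_val \<alpha> p" "has_val \<gamma> q" "complementary p q"
    and D: "a \<in> D" "b \<in> D" "c \<in> D" "a' \<in> D" "b' \<in> D" "c' \<in> D"
    and eq: "a \<oplus> b \<otimes> (t [^] (e::nat) \<otimes> \<alpha>) \<oplus> c \<otimes> (t [^] (h::nat) \<otimes> \<gamma>) = a' \<oplus> b' \<otimes> (t [^] e \<otimes> \<alpha>) \<oplus> c' \<otimes> (t [^] h \<otimes> \<gamma>)"
  shows "a = a' \<and> b = b' \<and> c = c'"
proof -
  define \<beta> \<omega> where "\<beta> = t [^] e \<otimes> \<alpha>" "\<omega> = t [^] h \<otimes> \<gamma>"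
  have C: "\<beta> \<in> carrier L" "\<omega> \<in> carrier L" using assms(1,2) unfolding \<beta>_\<omega>_def by auto
  note C = C D[THEN D_carrier]
  have "(a \<ominus> a') \<oplus> (b \<ominus> b') \<otimes> \<beta> \<oplus> (c \<ominus> c') \<otimes> \<omega> =
      (a \<oplus> b \<otimes> \<beta> \<oplus> c \<otimes> \<omega>) \<ominus> (a' \<oplus> b' \<otimes> \<beta> \<oplus> c' \<otimes> \<omega>)"
    using C by algebra
  also have "\<dots> = \<zero>" using eq C unfolding \<beta>_\<omega>_def by (simp add: r_neg minus_eq)
  finally have "(a \<ominus> a') \<oplus> (b \<ominus> b') \<otimes> \<beta> \<oplus> (c \<ominus> c') \<otimes> \<omega> = \<zero>" .
  from tri_coords_zero[OF assms(1-3) D_minus[OF D(1,4)] D_minus[OF D(2,5)] D_minus[OF D(3,6)]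
      this[unfolded \<beta>_\<omega>_def]]
  have "a \<ominus> a' = \<zero> \<and> b \<ominus> b' = \<zero> \<and> c \<ominus> c' = \<zero>" .
  thus ?thesis using C by simp
qed

text \<open>The terms with \<beta> and \<omega> are in \<open>F 1\<close>, so the constant term is
  too, and an element of \<open>D\<close> in \<open>F 1\<close> is a multiple of t.\<close>

lemma tri_maximalideal_coords:
  assumes "\<beta> \<in> F 1" "\<omega> \<in> F 1" "x \<in> tri \<beta> \<omega> \<inter> F 1"
  shows "\<exists>a \<in> D. \<exists>b \<in> D. \<exists>c \<in> D. x = t \<otimes> a \<oplus> b \<otimes> \<beta> \<oplus> c \<otimes> \<omega>"
proof -
  obtain a b c where abc: "a \<in> D" "b \<in> D" "c \<in> D" "x = a \<oplus> b \<otimes> \<beta> \<oplus> c \<otimes> \<omega>"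
    using assms(3) unfolding tri_def by blast
  have r: "b \<otimes> \<beta> \<oplus> c \<otimes> \<omega> \<in> F 1" using assms abc by auto
  have "a \<oplus> (b \<otimes> \<beta> \<oplus> c \<otimes> \<omega>) \<in> F 1"
    using assms abc F_A[OF assms(1)] F_A[OF assms(2)] by (auto simp: a_assoc)
  hence "a \<in> F 1" using F_cancel_add[of a "b \<otimes> \<beta> \<oplus> c \<otimes> \<omega>" 1] abc(1) r by simp
  then obtain a' where "a' \<in> D" "a = t \<otimes> a'" using D_F1 abc(1) by blast
  thus ?thesis using abc by blast
qed

lemma t_cancel: "\<lbrakk> t \<otimes> x = t \<otimes> y; x \<in> carrier L; y \<in> carrier L \<rbrakk> \<Longrightarrow> x = y"
  using m_lcancel[of t x y] t_nonzero by simp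

text \<open>
  The upper bound on \<open>h\<close> is strict exactly for the rings \<open>t\<^sup>kC + D\<close> with \<open>k > 0\<close>; in this
  case \<open>J\<^sup>2 = t J\<close> for the maximal ideal \<open>J\<close>.
\<close>

lemma embedding_dim_shifted:
  assumes B: "subring B L" "D \<subseteq> B" "B \<subseteq> A" and val: "has_val \<alpha> p" "has_val \<gamma> q"
    "complementary p q"
    and eh: "e + (p - 1) \<le> h" "h < 2 * e + (p - 1)" and B_eq: "B = tri (t [^] e \<otimes> \<alpha>) (t [^] h \<otimes> \<gamma>)"
  shows "embedding_dim (L\<lparr>carrier := B\<rparr>) = 3"
proof -
  let ?R = "L\<lparr>carrier := B\<rparr>" and ?J = "B \<inter> F 1"
  let ?J2 = "?J \<cdot>\<^bsub>?R\<^esub> ?J"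
  define \<beta> \<omega> where def: "\<beta> = t [^] e \<otimes> \<alpha>" "\<omega> = t [^] h \<otimes> \<gamma>"
  have B_tri: "B = tri \<beta> \<omega>" using B_eq def by simp
  \<comment> \<open>The two bounds on h together force e > 0, hence also h > 0.\<close>
  have e1: "1 \<le> e" "1 \<le> h" "e \<le> h" using eh val(3) by auto
  have tA: "t [^] h \<otimes> x \<in> B" if "x \<in> A" for x
  proof -
    have "t [^] h \<otimes> x = \<zero> \<oplus> \<zero> \<otimes> (t [^] e \<otimes> \<alpha>) \<oplus> t [^] h \<otimes> x" using that val by simp
    thus ?thesis unfolding B_eq tri_eq_with_A[OF val e1(3)] using that D_closed(1) by blast
  qed
  have F3: "\<beta> \<in> F 3" "\<omega> \<in> F 3"
    using has_val_F[OF has_val_mult[OF has_val_t_pow[of e] val(1)], of 3] e1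
      has_val_F[OF has_val_mult[OF has_val_t_pow[of h] val(2)], of 3] unfolding def by auto
  hence F1: "\<beta> \<in> F 1" "\<omega> \<in> F 1" using F_mono[of _ 3 1] by auto
  note C = F_A[OF F1(1), THEN A_carrier] F_A[OF F1(2), THEN A_carrier]
  interpret S: domain ?R using subdomain_is_domain subdomainI' B(1) by blast
  note cl = subringE(6,7)[OF B(1)]
  have DB: "\<And>d. d \<in> D \<Longrightarrow> d \<in> B" using B by blast
  have \<beta>B: "\<beta> \<in> B" unfolding B_tri using tri_I[of \<zero> \<one> \<zero> \<beta> \<omega>] C by simp
  have \<omega>B: "\<omega> \<in> B" unfolding B_tri using tri_I[of \<zero> \<zero> \<one> \<beta> \<omega>] C by simp
  have J_form: "\<exists>a \<in> D. \<exists>b \<in> D. \<exists>c \<in> D. x = t \<otimes> a \<oplus> b \<otimes> \<beta> \<oplus> c \<otimes> \<omega>" if "x \<in> ?J" for x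
    using tri_maximalideal_coords[OF F1] that unfolding B_tri by blast
  have J_comb: "a \<otimes> x \<oplus> b \<otimes> y \<oplus> c \<otimes> z \<in> ?J"
    if "a \<in> D" "b \<in> D" "c \<in> D" "x \<in> ?J" "y \<in> ?J" "z \<in> ?J" for a b c x y z
    using that cl DB by auto
  \<comment> \<open>Since h > 0, \<open>t\<^sup>hA\<close> lies in J, so membership in
    \<open>t\<^sup>h\<^sup>+\<^sup>1A\<close> is enough for membership in tJ.\<close>
  have thA: "\<exists>j \<in> ?J. t [^] (h + 1) \<otimes> x = t \<otimes> j" if "x \<in> A" for x
  proof -
    have "t [^] h \<otimes> x \<in> F (3 * h)" unfolding F_eq_t_pow using that by blast
    hence "t [^] h \<otimes> x \<in> F 1" using F_mono[of _ "3 * h" 1] e1 by simp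
    moreover have "t [^] (h + 1) \<otimes> x = t \<otimes> (t [^] h \<otimes> x)"
      using that by (simp add: m_ac)
    ultimately show ?thesis using tA[OF that] by blast
  qed
  define N where "N = {t \<otimes> j | j. j \<in> ?J}"
  have J2: "?J2 \<subseteq> N"
  proof (rule ideal_prod_subsetI)
    fix x y assume xy: "x \<in> ?J" "y \<in> ?J"
    obtain a b c where abc: "a \<in> D" "b \<in> D" "c \<in> D" "x = t \<otimes> a \<oplus> b \<otimes> \<beta> \<oplus> c \<otimes> \<omega>"
      using J_form[OF xy(1)] by blast
    obtain a' b' c' where abc': "a' \<in> D" "b' \<in> D" "c' \<in> D" "y = t \<otimes> a' \<oplus> b' \<otimes> \<beta> \<oplus> c' \<otimes> \<omega>"
      using J_form[OF xy(2)] by blast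
    note Cx = abc(1-3)[THEN D_carrier] abc'(1-3)[THEN D_carrier] C t_carrier
    have "t \<in> F 3" using t_in_F by simp
    hence "y \<in> F (3 * 1)" unfolding abc'(4) using F3 abc'(1-3) by auto
    then obtain y' where y': "y' \<in> A" "y = t \<otimes> y'" unfolding F_eq_t_pow by auto
    have eq2: "\<omega> \<otimes> y = t [^] (h + 1) \<otimes> (\<gamma> \<otimes> y')"
      unfolding y'(2) def using y'(1)[THEN A_carrier] val(2)[THEN has_val_carrier] by (simp add: m_ac)
    have "\<gamma> \<otimes> y' \<in> A" using y'(1) val(2) by simp
    from thA[OF this] obtain j2 where j2: "j2 \<in> ?J" "\<omega> \<otimes> y = t \<otimes> j2"
      by (rule bexE) (rule that[OF _ trans[OF eq2]])
    have "\<alpha> \<otimes> \<alpha> \<in> F (3 * (p - 1))"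
      unfolding has_val_F[OF has_val_mult[OF val(1) val(1)]] using val(3) by linarith
    then obtain z where z: "z \<in> A" "\<alpha> \<otimes> \<alpha> = t [^] (p - 1) \<otimes> z" unfolding F_eq_t_pow by blast
    \<comment> \<open>One less than the defect in the upper bound on h. The strictness of that bound
      makes it a true difference, which puts \<open>\<beta>\<^sup>2\<close> into
      \<open>t\<^sup>h\<^sup>+\<^sup>1A\<close>.\<close>
    define k where "k = 2 * e + (p - 1) - (h + 1)"
    have k: "e + (e + (p - 1)) = (h + 1) + k" unfolding k_def using eh(2) by simp
    have "\<beta> \<otimes> \<beta> = t [^] e \<otimes> t [^] e \<otimes> (\<alpha> \<otimes> \<alpha>)"
      unfolding def using val(1)[THEN has_val_carrier] t_pow_carrier[of e] by algebra
    also have "\<dots> = t [^] (e + (e + (p - 1))) \<otimes> z"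
      unfolding z(2) using z(1) by (simp add: nat_pow_mult[symmetric] m_assoc)
    also have "\<dots> = t [^] (h + 1) \<otimes> (t [^] k \<otimes> z)"
      unfolding k nat_pow_mult[OF t_carrier, of "h + 1" k, symmetric] using z(1) by (simp add: m_assoc)
    finally have eq1: "\<beta> \<otimes> \<beta> = t [^] (h + 1) \<otimes> (t [^] k \<otimes> z)" .
    have "t [^] k \<otimes> z \<in> A" using z(1) by simp
    from thA[OF this] obtain j1 where j1: "j1 \<in> ?J" "\<beta> \<otimes> \<beta> = t \<otimes> j1"
      by (rule bexE) (rule that[OF _ trans[OF eq1]])
    \<comment> \<open>For the mixed product the spare factor t beyond \<open>t\<^sup>h\<close> comes
      from e > 0.\<close>
    have ee: "t [^] e = t \<otimes> t [^] (e - 1)" using e1(1) by (cases e) (auto simp: m_comm)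
    have eq3: "\<beta> \<otimes> \<omega> = t [^] (h + 1) \<otimes> (t [^] (e - 1) \<otimes> (\<alpha> \<otimes> \<gamma>))"
      unfolding def ee using val(1,2)[THEN has_val_carrier] by (simp add: m_ac)
    have "t [^] (e - 1) \<otimes> (\<alpha> \<otimes> \<gamma>) \<in> A" using val(1,2) by simp
    from thA[OF this] obtain j3 where j3: "j3 \<in> ?J" "\<beta> \<otimes> \<omega> = t \<otimes> j3"
      by (rule bexE) (rule that[OF _ trans[OF eq3]])
    have \<beta>J: "\<beta> \<in> ?J" using \<beta>B F1 by blast
    define j4 where "j4 = a' \<otimes> \<beta> \<oplus> b' \<otimes> j1 \<oplus> c' \<otimes> j3"
    have j4: "j4 \<in> ?J" unfolding j4_def using J_comb abc'(1-3) \<beta>J j1(1) j3(1) by blast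
    have Cj: "j1 \<in> carrier L" "j3 \<in> carrier L" "j2 \<in> carrier L" "j4 \<in> carrier L" "y \<in> carrier L"
      using j1(1) j2(1) j3(1) j4 xy(2) by (auto simp: F_A[of _ 1])
    have "\<beta> \<otimes> y = t \<otimes> (a' \<otimes> \<beta>) \<oplus> b' \<otimes> (\<beta> \<otimes> \<beta>) \<oplus> c' \<otimes> (\<beta> \<otimes> \<omega>)"
      unfolding abc'(4) using Cx by algebra
    also have "\<dots> = t \<otimes> j4"
      unfolding j1(2) j3(2) j4_def using Cx Cj by algebra
    finally have \<beta>y: "\<beta> \<otimes> y = t \<otimes> j4" .
    have "x \<otimes> y = t \<otimes> (a \<otimes> y) \<oplus> b \<otimes> (\<beta> \<otimes> y) \<oplus> c \<otimes> (\<omega> \<otimes> y)"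
      unfolding abc(4) using Cx Cj by algebra
    also have "\<dots> = t \<otimes> (a \<otimes> y \<oplus> b \<otimes> j4 \<oplus> c \<otimes> j2)"
      unfolding \<beta>y j2(2) using Cx Cj by algebra
    finally show "x \<otimes>\<^bsub>?R\<^esub> y \<in> N"
      unfolding N_def using J_comb[OF abc(1-3) xy(2) j4 j2(1)] by auto
  next
    fix x y assume "x \<in> N" "y \<in> N"
    then obtain i j where ij: "i \<in> ?J" "j \<in> ?J" "x = t \<otimes> i" "y = t \<otimes> j" unfolding N_def by blast
    have "x \<oplus> y = t \<otimes> (i \<oplus> j)" using ij F_A[THEN A_carrier, of _ 1] by (auto simp: r_distr)
    moreover have "i \<oplus> j \<in> ?J" using ij cl by auto
    ultimately show "x \<oplus>\<^bsub>?R\<^esub> y \<in> N" unfolding N_def by auto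
  qed
  show ?thesis
  proof (rule S.embedding_dim_eq_3I[of ?J D t \<beta> \<omega>])
    show "maximalideal ?J ?R" by (rule overring_maximalideal[OF B tA])
    show "\<And>M. maximalideal M ?R \<Longrightarrow> M = ?J" by (rule overring_maximalideal_unique[OF B tA])
    show "D \<subseteq> carrier ?R" using B(2) by simp
    show "\<exists>d\<in>D. \<exists>j\<in>?J. a = d \<oplus>\<^bsub>?R\<^esub> j" if "a \<in> carrier ?R" for a
      using subring_residue[OF B] that by simp
    show "t \<in> ?J" "\<beta> \<in> ?J" "\<omega> \<in> ?J" using t_in_F(1) DB[OF t_in_D] \<beta>B \<omega>B F1 by auto
    fix w assume w: "w \<in> ?J"
    then obtain a b c where abc: "a \<in> D" "b \<in> D" "c \<in> D" "w = t \<otimes> a \<oplus> b \<otimes> \<beta> \<oplus> c \<otimes> \<omega>"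
      using J_form by blast
    have "\<zero> \<in> ?J" using DB[OF D_closed(1)] by simp
    hence "\<zero> \<otimes>\<^bsub>?R\<^esub> \<zero> \<in> ?J2" by (intro ideal_prod.prod)
    hence z: "\<zero> \<in> ?J2" by simp
    have "w = a \<otimes> t \<oplus> b \<otimes> \<beta> \<oplus> c \<otimes> \<omega> \<oplus> \<zero>"
      unfolding abc(4) using abc(1-3)[THEN D_carrier] C t_carrier by (simp add: m_comm)
    thus "\<exists>a\<in>D. \<exists>b\<in>D. \<exists>c\<in>D. \<exists>s\<in>?J2.
        w = a \<otimes>\<^bsub>?R\<^esub> t \<oplus>\<^bsub>?R\<^esub> b \<otimes>\<^bsub>?R\<^esub> \<beta> \<oplus>\<^bsub>?R\<^esub> c \<otimes>\<^bsub>?R\<^esub> \<omega> \<oplus>\<^bsub>?R\<^esub> s"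
      by (intro bexI[OF _ abc(1)] bexI[OF _ abc(2)] bexI[OF _ abc(3)] bexI[OF _ z]) simp
  next
    fix a b c assume abc: "a \<in> D" "b \<in> D" "c \<in> D"
      "a \<otimes>\<^bsub>?R\<^esub> t \<oplus>\<^bsub>?R\<^esub> b \<otimes>\<^bsub>?R\<^esub> \<beta> \<oplus>\<^bsub>?R\<^esub> c \<otimes>\<^bsub>?R\<^esub> \<omega> \<in> ?J2"
    then obtain j where j: "j \<in> ?J" "a \<otimes> t \<oplus> b \<otimes> \<beta> \<oplus> c \<otimes> \<omega> = t \<otimes> j" using J2 unfolding N_def by auto
    obtain a' b' c' where abc': "a' \<in> D" "b' \<in> D" "c' \<in> D" "j = t \<otimes> a' \<oplus> b' \<otimes> \<beta> \<oplus> c' \<otimes> \<omega>"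
      using J_form[OF j(1)] by blast
    note Cx = abc'(1-3)[THEN D_carrier] C t_carrier
    \<comment> \<open>The coordinates of an element of tJ lie in \<open>t\<^sup>2D\<close>, tD and
      tD. The constant coordinate on the other side is a t, so comparison makes a, b and c multiples
      of t.\<close>
    have "t \<otimes> j = t \<otimes> (t \<otimes> a') \<oplus> (t \<otimes> b') \<otimes> \<beta> \<oplus> (t \<otimes> c') \<otimes> \<omega>"
      unfolding abc'(4) using Cx by algebra
    hence "a \<otimes> t = t \<otimes> (t \<otimes> a') \<and> b = t \<otimes> b' \<and> c = t \<otimes> c'"
      using j(2) abc(1-3) abc'(1-3) unfolding def
      by (intro tri_coords_unique[OF val, of _ _ _ _ _ _ e h]) auto
    hence eq: "t \<otimes> a = t \<otimes> (t \<otimes> a')" "b = t \<otimes> b'" "c = t \<otimes> c'"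
      using m_comm[of a t] abc(1) by auto
    have "a = t \<otimes> a'" by (rule t_cancel[OF eq(1)]) (use abc(1) abc'(1) in auto)
    thus "a \<in> ?J \<and> b \<in> ?J \<and> c \<in> ?J" using eq(2,3) abc(1-3) abc'(1-3) t_in_F(1) DB by auto
  qed
qed

section \<open>Spans and freeness over \<open>D\<close>\<close>

lemma Span_three:
  assumes L: "u \<in> carrier L" "v \<in> carrier L" "w \<in> carrier L"
  shows "Span D [u, v, w] = {a \<otimes> u \<oplus> b \<otimes> v \<oplus> c \<otimes> w | a b c. a \<in> D \<and> b \<in> D \<and> c \<in> D}"
proof (intro equalityI subsetI)
  have Span: "Span D [u, v, w] = line_extension D u (line_extension D v (line_extension D w {\<zero>}))" by simp
  have sum: "a \<otimes> u \<oplus> (b \<otimes> v \<oplus> (c \<otimes> w \<oplus> \<zero>)) = a \<otimes> u \<oplus> b \<otimes> v \<oplus> c \<otimes> w"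
    if "a \<in> D" "b \<in> D" "c \<in> D" for a b c
    using L that by (simp add: a_assoc)
  {
    fix x assume "x \<in> Span D [u, v, w]"
    then obtain a y where y: "a \<in> D" "y \<in> line_extension D v (line_extension D w {\<zero>})" "x = a \<otimes> u \<oplus> y"
      unfolding Span line_extension_mem_iff[of x] by (elim bexE) (rule that)
    obtain b z where z: "b \<in> D" "z \<in> line_extension D w {\<zero>}" "y = b \<otimes> v \<oplus> z"
      using y(2) unfolding line_extension_mem_iff[of y] by (elim bexE) (rule that)
    obtain c where c: "c \<in> D" "z = c \<otimes> w \<oplus> \<zero>"
      using z(2) unfolding line_extension_mem_iff[of z] by (elim bexE singletonE) (simp add: that)
    show "x \<in> {a \<otimes> u \<oplus> b \<otimes> v \<oplus> c \<otimes> w | a b c. a \<in> D \<and> b \<in> D \<and> c \<in> D}"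
      unfolding y(3) z(3) c(2) sum[OF y(1) z(1) c(1)] using y(1) z(1) c(1) by blast
  }
  {
    fix x assume "x \<in> {a \<otimes> u \<oplus> b \<otimes> v \<oplus> c \<otimes> w | a b c. a \<in> D \<and> b \<in> D \<and> c \<in> D}"
    then obtain a b c where abc: "a \<in> D" "b \<in> D" "c \<in> D" "x = a \<otimes> u \<oplus> b \<otimes> v \<oplus> c \<otimes> w" by blast
    have "c \<otimes> w \<oplus> \<zero> \<in> line_extension D w {\<zero>}"
      unfolding line_extension_mem_iff by (intro bexI[OF _ abc(3)] bexI[of _ \<zero>]) simp_all
    hence "b \<otimes> v \<oplus> (c \<otimes> w \<oplus> \<zero>) \<in> line_extension D v (line_extension D w {\<zero>})"
      unfolding line_extension_mem_iff[of _ D v]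
      by (intro bexI[OF _ abc(2)] bexI[of _ "c \<otimes> w \<oplus> \<zero>"]) simp_all
    thus "x \<in> Span D [u, v, w]"
      unfolding abc(4) Span line_extension_mem_iff[of _ D u] sum[OF abc(1-3), symmetric]
      by (intro bexI[OF _ abc(1)] bexI[of _ "b \<otimes> v \<oplus> (c \<otimes> w \<oplus> \<zero>)"]) simp_all
  }
qed

lemma free_of_rank_tri:
  assumes val: "has_val \<alpha> p" "has_val \<gamma> q" "complementary p q"
  shows "free_of_rank L D 3 (tri (t [^] (e::nat) \<otimes> \<alpha>) (t [^] (h::nat) \<otimes> \<gamma>))"
proof -
  define \<beta> \<omega> where def: "\<beta> = t [^] e \<otimes> \<alpha>" "\<omega> = t [^] h \<otimes> \<gamma>"
  have C: "\<beta> \<in> carrier L" "\<omega> \<in> carrier L" using val unfolding def by auto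
  have "{a \<otimes> \<one> \<oplus> b \<otimes> \<beta> \<oplus> c \<otimes> \<omega> | a b c. a \<in> D \<and> b \<in> D \<and> c \<in> D} = tri \<beta> \<omega>"
    unfolding tri_def by (intro Collect_cong iff_exI) auto
  hence span: "tri \<beta> \<omega> = Span D [\<one>, \<beta>, \<omega>]" using Span_three[of \<one> \<beta> \<omega>] C by simp
  have "set Ks \<subseteq> {\<zero>}" if Ks: "length Ks = 3" "set Ks \<subseteq> D" "combine Ks [\<one>, \<beta>, \<omega>] = \<zero>" for Ks
  proof -
    obtain a b c where abc: "Ks = [a, b, c]"
      using Ks(1) by (auto simp: numeral_3_eq_3 length_Suc_conv)
    have D: "a \<in> D" "b \<in> D" "c \<in> D" using Ks(2) unfolding abc by auto
    have "a \<oplus> b \<otimes> \<beta> \<oplus> c \<otimes> \<omega> = \<zero>" using Ks(3) D C unfolding abc by (simp add: a_assoc)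
    thus ?thesis using tri_coords_zero[OF val D] unfolding abc def by simp
  qed
  thus ?thesis unfolding free_of_rank_def def[symmetric] using span C
    by (intro exI[of _ "[\<one>, \<beta>, \<omega>]"]) simp
qed

section \<open>The rings \<open>D[\<beta>]\<close>, which are the case k = 0\<close>

context
  fixes \<alpha> \<gamma> \<beta> \<omega> :: 'a and p q r s :: nat
  assumes val: "has_val \<alpha> p" "has_val \<gamma> q" and pq: "complementary p q"
    and sq: "\<alpha> \<otimes> \<alpha> = t [^] (p - 1) \<otimes> \<gamma>" and rs: "r = 2 * s + (p - 1)" and r_pos: "1 \<le> r"
    and \<beta>: "\<beta> = t [^] s \<otimes> \<alpha>" and \<omega>: "\<omega> = t [^] r \<otimes> \<gamma>"
begin

lemma \<beta>_val: "has_val \<beta> (3 * s + p)" and \<omega>_val: "has_val \<omega> (3 * r + q)"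
  unfolding \<beta> \<omega> using has_val_mult[OF has_val_t_pow] val by auto

text \<open>By \<open>tri_eq_with_A\<close> the module does not depend on \<gamma>, so \<gamma> can
  be fixed by \<open>sq\<close>; the exponents then match because r = s + (s + (p - 1)).\<close>

lemma \<omega>_eq_square: "\<omega> = \<beta> \<otimes> \<beta>"
proof -
  have "\<beta> \<otimes> \<beta> = t [^] s \<otimes> t [^] s \<otimes> (\<alpha> \<otimes> \<alpha>)"
    unfolding \<beta> using val(1)[THEN has_val_carrier] t_pow_carrier[of s] by algebra
  also have "\<dots> = t [^] (s + (s + (p - 1))) \<otimes> \<gamma>"
    unfolding sq using has_val_carrier[OF val(2)] by (simp add: nat_pow_mult[symmetric] m_assoc)
  also have "s + (s + (p - 1)) = r" using rs by simp
  finally show ?thesis unfolding \<omega> by simp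
qed

text \<open>
  Since \<open>\<omega> = \<beta>\<^sup>2\<close>, the ring is \<open>D[\<beta>]\<close>, and the valuation of \<open>\<beta>\<^sup>3\<close> is so large that the first two
  coefficients of its expansion are divisible by \<open>t\<^sup>2\<close> and \<open>t\<close>.
\<close>

lemma cube_in_maximalideal_square: "\<exists>a \<in> D. \<exists>b \<in> D. \<exists>c \<in> D. \<beta> \<otimes> \<omega> = t \<otimes> (t \<otimes> a) \<oplus> (t \<otimes> b) \<otimes> \<beta> \<oplus> c \<otimes> \<omega>"
proof -
  define n where "n = (3 * s + p) + (3 * r + q)"
  have n: "has_val (\<beta> \<otimes> \<omega>) n" unfolding n_def using has_val_mult[OF \<beta>_val \<omega>_val] .
  obtain a b c where abc: "a \<in> D" "b \<in> D" "c \<in> D" "\<beta> \<otimes> \<omega> = a \<oplus> b \<otimes> \<alpha> \<oplus> c \<otimes> \<gamma>"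
    using A_basis[OF val pq has_val_A[OF n]] by blast
  have "a \<oplus> b \<otimes> \<alpha> \<oplus> c \<otimes> \<gamma> \<in> F n" unfolding abc(4)[symmetric] has_val_F[OF n] by simp
  hence F: "a \<in> F n" "b \<otimes> \<alpha> \<in> F n" "c \<otimes> \<gamma> \<in> F n"
    using coords_F[OF val pq abc(1-3)] by blast+
  have b: "b \<in> F (n - p)" using F_cancel_mult[OF val(1) D_A[OF abc(2)] F(2)] .
  have c: "c \<in> F (n - q)" using F_cancel_mult[OF val(2) D_A[OF abc(3)] F(3)] .
  \<comment> \<open>Here n = 3(r + s + 1), because p + q = 3. As r \<ge> 1, the exponents 2, s + 1
    and r are within reach of \<open>D_F_t_pow\<close>. The factors \<open>t\<^sup>s\<close> and
    \<open>t\<^sup>r\<close> turn \<alpha> and \<gamma> into \<beta> and \<omega>, which leaves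
    \<open>t\<^sup>2\<close> before 1 and t before \<beta>.\<close>
  have "3 * 2 \<le> n + 2" "3 * (s + 1) \<le> (n - p) + 2" "3 * r \<le> (n - q) + 2"
    using pq rs r_pos unfolding n_def by auto
  then obtain a' b' c' where d: "a' \<in> D" "b' \<in> D" "c' \<in> D"
    "a = t [^] (2::nat) \<otimes> a'" "b = t [^] (s + 1) \<otimes> b'" "c = t [^] r \<otimes> c'"
    using D_F_t_pow[OF abc(1) F(1), of 2] D_F_t_pow[OF abc(2) b, of "s + 1"] D_F_t_pow[OF abc(3) c, of r]
    by blast
  note C = d(1-3)[THEN D_carrier] val[THEN has_val_carrier] t_carrier
    t_pow_carrier[of s] t_pow_carrier[of r]
  have "a = t \<otimes> (t \<otimes> a')" unfolding d(4) using C by (simp add: numeral_2_eq_2 m_assoc)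
  moreover have "b \<otimes> \<alpha> = (t \<otimes> b') \<otimes> \<beta>"
  proof -
    have "b = t [^] s \<otimes> t \<otimes> b'" unfolding d(5) by simp
    thus ?thesis unfolding \<beta> using C by (simp add: m_ac)
  qed
  moreover have "c \<otimes> \<gamma> = c' \<otimes> \<omega>" unfolding d(6) \<omega> using C by (simp add: m_ac)
  ultimately have "\<beta> \<otimes> \<omega> = t \<otimes> (t \<otimes> a') \<oplus> (t \<otimes> b') \<otimes> \<beta> \<oplus> c' \<otimes> \<omega>"
    unfolding abc(4) by simp
  thus ?thesis using d(1-3) by blast
qed

lemma \<beta>_\<omega>_carrier: "\<beta> \<in> carrier L" "\<omega> \<in> carrier L"
  using \<beta>_val \<omega>_val has_val_carrier by blast+

text \<open>As \<omega> is the square of \<beta>, stability under \<beta> is what makes the module a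
  ring; the only product that is not visibly in it is the cube of \<beta>.\<close>

lemma \<beta>_mult_tri: assumes "x \<in> tri \<beta> \<omega>" shows "\<beta> \<otimes> x \<in> tri \<beta> \<omega>"
proof -
  obtain a b c where abc: "a \<in> D" "b \<in> D" "c \<in> D" "x = a \<oplus> b \<otimes> \<beta> \<oplus> c \<otimes> \<omega>"
    using assms unfolding tri_def by blast
  obtain a' b' c' where d: "a' \<in> D" "b' \<in> D" "c' \<in> D"
    "\<beta> \<otimes> \<omega> = t \<otimes> (t \<otimes> a') \<oplus> (t \<otimes> b') \<otimes> \<beta> \<oplus> c' \<otimes> \<omega>" using cube_in_maximalideal_square by blast
  have cub: "\<beta> \<otimes> \<omega> \<in> tri \<beta> \<omega>" unfolding d(4) using d(1-3) by (intro tri_I) auto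
  note C = abc(1-3)[THEN D_carrier] \<beta>_\<omega>_carrier
  have "\<beta> \<otimes> x = (\<zero> \<oplus> a \<otimes> \<beta> \<oplus> b \<otimes> (\<beta> \<otimes> \<beta>)) \<oplus> c \<otimes> (\<beta> \<otimes> \<omega>)"
    unfolding abc(4) using C by algebra
  moreover have "\<zero> \<oplus> a \<otimes> \<beta> \<oplus> b \<otimes> (\<beta> \<otimes> \<beta>) \<in> tri \<beta> \<omega>"
    unfolding \<omega>_eq_square[symmetric] using abc(1-3) by (intro tri_I) auto
  moreover have "c \<otimes> (\<beta> \<otimes> \<omega>) \<in> tri \<beta> \<omega>"
    by (rule tri_smult[OF \<beta>_\<omega>_carrier abc(3) cub])
  ultimately show ?thesis using tri_add[OF \<beta>_\<omega>_carrier] by simp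
qed

lemma subring_tri: "subring (tri \<beta> \<omega>) L"
proof (rule subringI)
  note C = \<beta>_\<omega>_carrier
  show "tri \<beta> \<omega> \<subseteq> carrier L" unfolding tri_def using C by auto
  show "\<one> \<in> tri \<beta> \<omega>" using D_subset_tri[OF C] by auto
  fix x assume x: "x \<in> tri \<beta> \<omega>"
  have xc: "x \<in> carrier L" using x C unfolding tri_def by auto
  have "(\<ominus> \<one>) \<otimes> x \<in> tri \<beta> \<omega>" by (rule tri_smult[OF C _ x]) simp
  moreover have "(\<ominus> \<one>) \<otimes> x = \<ominus> x" using xc by algebra
  ultimately show "\<ominus> x \<in> tri \<beta> \<omega>" by simp
  fix y assume y: "y \<in> tri \<beta> \<omega>"
  have yc: "y \<in> carrier L" using y C unfolding tri_def by auto
  show "x \<oplus> y \<in> tri \<beta> \<omega>" by (rule tri_add[OF C x y])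
  obtain a b c where abc: "a \<in> D" "b \<in> D" "c \<in> D" "x = a \<oplus> b \<otimes> \<beta> \<oplus> c \<otimes> \<omega>"
    using x unfolding tri_def by blast
  have "x \<otimes> y = (a \<otimes> y \<oplus> b \<otimes> (\<beta> \<otimes> y)) \<oplus> c \<otimes> (\<beta> \<otimes> (\<beta> \<otimes> y))"
    unfolding abc(4) \<omega>_eq_square using abc(1-3)[THEN D_carrier] C(1) yc by algebra
  thus "x \<otimes> y \<in> tri \<beta> \<omega>"
    using tri_add[OF C tri_add[OF C tri_smult[OF C abc(1) y] tri_smult[OF C abc(2) \<beta>_mult_tri[OF y]]]
      tri_smult[OF C abc(3) \<beta>_mult_tri[OF \<beta>_mult_tri[OF y]]]] by simp
qed

lemma tri_subset_A: "tri \<beta> \<omega> \<subseteq> A"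
  unfolding tri_def using \<beta>_val \<omega>_val by auto

lemma conductor_tri: assumes "x \<in> A" shows "t [^] r \<otimes> x \<in> tri \<beta> \<omega>"
proof -
  have "s \<le> r" using rs by simp
  have "t [^] r \<otimes> x = \<zero> \<oplus> \<zero> \<otimes> (t [^] s \<otimes> \<alpha>) \<oplus> t [^] r \<otimes> x" using assms val by simp
  thus ?thesis unfolding \<beta> \<omega> tri_eq_with_A[OF val pq \<open>s \<le> r\<close>] using assms D_closed(1) by blast
qed

text \<open>Over \<open>D\<close> the ideal J is generated by \<open>t, \<beta>, \<omega>\<close>,
  and \<omega> is a square of an element of J, so t and \<beta> span the cotangent space. They are
  independent because elements of \<open>J\<^sup>2\<close> have their first two coordinates in
  \<open>t\<^sup>2D\<close> and tD.\<close>

lemma embedding_dim_C_ring: "embedding_dim (L\<lparr>carrier := tri \<beta> \<omega>\<rparr>) = 2"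
proof -
  let ?B = "tri \<beta> \<omega>" and ?R = "L\<lparr>carrier := tri \<beta> \<omega>\<rparr>" and ?J = "tri \<beta> \<omega> \<inter> F 1"
  let ?J2 = "?J \<cdot>\<^bsub>?R\<^esub> ?J"
  note C = \<beta>_\<omega>_carrier
  note B = subring_tri D_subset_tri[OF C] tri_subset_A
  interpret S: domain ?R using subdomain_is_domain subdomainI' B(1) by blast
  note cl = subringE(6,7)[OF B(1)]
  have F1: "\<beta> \<in> F 1" "\<omega> \<in> F 1"
    using has_val_F[OF \<beta>_val, of 1] has_val_F[OF \<omega>_val, of 1] pq by auto
  have DB: "\<And>d. d \<in> D \<Longrightarrow> d \<in> ?B" using B by blast
  have \<beta>B: "\<beta> \<in> ?B" using tri_I[of \<zero> \<one> \<zero> \<beta> \<omega>] C by simp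
  have J_form: "\<exists>a \<in> D. \<exists>b \<in> D. \<exists>c \<in> D. x = t \<otimes> a \<oplus> b \<otimes> \<beta> \<oplus> c \<otimes> \<omega>" if "x \<in> ?J" for x
    using tri_maximalideal_coords[OF F1] that by blast
  define N where "N = {t \<otimes> (t \<otimes> a) \<oplus> (t \<otimes> b) \<otimes> \<beta> \<oplus> c \<otimes> \<omega> | a b c. a \<in> D \<and> b \<in> D \<and> c \<in> D}"
  have N_I: "t \<otimes> (t \<otimes> a) \<oplus> (t \<otimes> b) \<otimes> \<beta> \<oplus> c \<otimes> \<omega> \<in> N" if "a \<in> D" "b \<in> D" "c \<in> D" for a b c
    unfolding N_def using that by blast
  have N_add: "x \<oplus> y \<in> N" if xy: "x \<in> N" "y \<in> N" for x y
  proof -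
    obtain a b c where *: "a \<in> D" "b \<in> D" "c \<in> D" "x = t \<otimes> (t \<otimes> a) \<oplus> (t \<otimes> b) \<otimes> \<beta> \<oplus> c \<otimes> \<omega>"
      using xy(1) unfolding N_def by blast
    obtain a' b' c' where **: "a' \<in> D" "b' \<in> D" "c' \<in> D" "y = t \<otimes> (t \<otimes> a') \<oplus> (t \<otimes> b') \<otimes> \<beta> \<oplus> c' \<otimes> \<omega>"
      using xy(2) unfolding N_def by blast
    have "x \<oplus> y = t \<otimes> (t \<otimes> (a \<oplus> a')) \<oplus> (t \<otimes> (b \<oplus> b')) \<otimes> \<beta> \<oplus> (c \<oplus> c') \<otimes> \<omega>"
      unfolding *(4) **(4) using *(1-3)[THEN D_carrier] **(1-3)[THEN D_carrier] C t_carrier by algebra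
    thus ?thesis using N_I[of "a \<oplus> a'" "b \<oplus> b'" "c \<oplus> c'"] * ** by simp
  qed
  have N_smult: "d \<otimes> x \<in> N" if d: "d \<in> D" and x: "x \<in> N" for d x
  proof -
    obtain a b c where *: "a \<in> D" "b \<in> D" "c \<in> D" "x = t \<otimes> (t \<otimes> a) \<oplus> (t \<otimes> b) \<otimes> \<beta> \<oplus> c \<otimes> \<omega>"
      using x unfolding N_def by blast
    have "d \<otimes> x = t \<otimes> (t \<otimes> (d \<otimes> a)) \<oplus> (t \<otimes> (d \<otimes> b)) \<otimes> \<beta> \<oplus> (d \<otimes> c) \<otimes> \<omega>"
      unfolding *(4) using *(1-3)[THEN D_carrier] D_carrier[OF d] C t_carrier by algebra
    thus ?thesis using N_I[of "d \<otimes> a" "d \<otimes> b" "d \<otimes> c"] * d by simp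
  qed
  have N_cube: "\<beta> \<otimes> \<omega> \<in> N" using cube_in_maximalideal_square unfolding N_def by blast
  have \<beta>J: "\<beta> \<otimes> x \<in> N" if x: "x \<in> ?J" for x
  proof -
    obtain a b c where *: "a \<in> D" "b \<in> D" "c \<in> D" "x = t \<otimes> a \<oplus> b \<otimes> \<beta> \<oplus> c \<otimes> \<omega>"
      using J_form[OF x] by blast
    have "\<beta> \<otimes> x = (t \<otimes> (t \<otimes> \<zero>) \<oplus> (t \<otimes> a) \<otimes> \<beta> \<oplus> b \<otimes> (\<beta> \<otimes> \<beta>)) \<oplus> c \<otimes> (\<beta> \<otimes> \<omega>)"
      unfolding *(4) using *(1-3)[THEN D_carrier] C t_carrier by algebra
    thus ?thesis unfolding \<omega>_eq_square[symmetric]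
      using N_add[OF N_I[of \<zero> a b] N_smult[OF *(3) N_cube]] * by simp
  qed
  have tJ: "t \<otimes> x \<in> N" if x: "x \<in> ?J" for x
  proof -
    obtain a b c where *: "a \<in> D" "b \<in> D" "c \<in> D" "x = t \<otimes> a \<oplus> b \<otimes> \<beta> \<oplus> c \<otimes> \<omega>"
      using J_form[OF x] by blast
    have "t \<otimes> x = t \<otimes> (t \<otimes> a) \<oplus> (t \<otimes> b) \<otimes> \<beta> \<oplus> (t \<otimes> c) \<otimes> \<omega>"
      unfolding *(4) using *(1-3)[THEN D_carrier] C t_carrier by algebra
    thus ?thesis using N_I[of a b "t \<otimes> c"] * by simp
  qed
  \<comment> \<open>Multiplying by \<omega> means multiplying by \<beta> twice, so the intermediate
    product has to stay in J.\<close>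
  have \<beta>y: "\<beta> \<otimes> y \<in> ?J" if "y \<in> ?J" for y
    using that \<beta>_mult_tri F1(1) F_A by auto
  have J2: "?J2 \<subseteq> N"
  proof (rule ideal_prod_subsetI)
    fix x y assume xy: "x \<in> ?J" "y \<in> ?J"
    obtain a b c where *: "a \<in> D" "b \<in> D" "c \<in> D" "x = t \<otimes> a \<oplus> b \<otimes> \<beta> \<oplus> c \<otimes> \<omega>"
      using J_form[OF xy(1)] by blast
    have yc: "y \<in> carrier L" using xy(2) F_A[of y 1] by simp
    have "x \<otimes> y = (a \<otimes> (t \<otimes> y) \<oplus> b \<otimes> (\<beta> \<otimes> y)) \<oplus> c \<otimes> (\<beta> \<otimes> (\<beta> \<otimes> y))"
      unfolding *(4) \<omega>_eq_square using *(1-3)[THEN D_carrier] C(1) yc t_carrier by algebra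
    thus "x \<otimes>\<^bsub>?R\<^esub> y \<in> N"
      using N_add[OF N_add[OF N_smult[OF *(1) tJ[OF xy(2)]] N_smult[OF *(2) \<beta>J[OF xy(2)]]]
        N_smult[OF *(3) \<beta>J[OF \<beta>y[OF xy(2)]]]] by simp
  qed (use N_add in simp)
  show ?thesis
  proof (rule S.embedding_dim_eq_2I[of ?J D t \<beta>])
    show "maximalideal ?J ?R" by (rule overring_maximalideal[OF B conductor_tri])
    show "\<And>M. maximalideal M ?R \<Longrightarrow> M = ?J" by (rule overring_maximalideal_unique[OF B conductor_tri])
    show "D \<subseteq> carrier ?R" using B(2) by simp
    show "\<exists>d\<in>D. \<exists>j\<in>?J. a = d \<oplus>\<^bsub>?R\<^esub> j" if "a \<in> carrier ?R" for a
      using subring_residue[OF B] that by simp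
    show "t \<in> ?J" "\<beta> \<in> ?J" using t_in_F(1) DB[OF t_in_D] \<beta>B F1 by auto
    fix w assume w: "w \<in> ?J"
    obtain a b c where abc: "a \<in> D" "b \<in> D" "c \<in> D" "w = t \<otimes> a \<oplus> b \<otimes> \<beta> \<oplus> c \<otimes> \<omega>"
      using J_form[OF w] by blast
    have "c \<otimes> \<beta> \<in> ?J" using cl(1)[OF DB[OF abc(3)] \<beta>B] F1(1) abc(3) by simp
    hence "(c \<otimes> \<beta>) \<otimes>\<^bsub>?R\<^esub> \<beta> \<in> ?J2" using \<beta>B F1(1) by (intro ideal_prod.prod) auto
    moreover have "(c \<otimes> \<beta>) \<otimes> \<beta> = c \<otimes> \<omega>"
      unfolding \<omega>_eq_square using D_carrier[OF abc(3)] C(1) by (simp add: m_assoc)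
    ultimately have z: "c \<otimes> \<omega> \<in> ?J2" by simp
    have "w = a \<otimes> t \<oplus> b \<otimes> \<beta> \<oplus> c \<otimes> \<omega>"
      unfolding abc(4) using abc(1-3)[THEN D_carrier] C t_carrier by (simp add: m_comm)
    thus "\<exists>a\<in>D. \<exists>b\<in>D. \<exists>s\<in>?J2. w = a \<otimes>\<^bsub>?R\<^esub> t \<oplus>\<^bsub>?R\<^esub> b \<otimes>\<^bsub>?R\<^esub> \<beta> \<oplus>\<^bsub>?R\<^esub> s"
      by (intro bexI[OF _ abc(1)] bexI[OF _ abc(2)] bexI[OF _ z]) simp
  next
    fix a b assume ab: "a \<in> D" "b \<in> D" "a \<otimes>\<^bsub>?R\<^esub> t \<oplus>\<^bsub>?R\<^esub> b \<otimes>\<^bsub>?R\<^esub> \<beta> \<in> ?J2"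
    have "a \<otimes> t \<oplus> b \<otimes> \<beta> \<in> ?J2" using ab(3) by simp
    hence "a \<otimes> t \<oplus> b \<otimes> \<beta> \<in> N" using J2 by blast
    then obtain a' b' c' where n: "a' \<in> D" "b' \<in> D" "c' \<in> D"
      "a \<otimes> t \<oplus> b \<otimes> \<beta> = t \<otimes> (t \<otimes> a') \<oplus> (t \<otimes> b') \<otimes> \<beta> \<oplus> c' \<otimes> \<omega>" unfolding N_def by blast
    have "a \<otimes> t \<oplus> b \<otimes> \<beta> = a \<otimes> t \<oplus> b \<otimes> \<beta> \<oplus> \<zero> \<otimes> \<omega>" using ab(1,2) C by simp
    hence "a \<otimes> t = t \<otimes> (t \<otimes> a') \<and> b = t \<otimes> b' \<and> \<zero> = c'"
      using n ab(1,2) unfolding \<beta> \<omega>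
      by (intro tri_coords_unique[OF val pq, of _ _ _ _ _ _ s r]) auto
    hence eq: "t \<otimes> a = t \<otimes> (t \<otimes> a')" "b = t \<otimes> b'"
      using m_comm[of a t] ab(1) by auto
    have "a = t \<otimes> a'" by (rule t_cancel[OF eq(1)]) (use ab(1) n(1) in auto)
    thus "a \<in> ?J \<and> b \<in> ?J" using eq(2) ab(1,2) n(1,2) t_in_F(1) DB by auto
  qed
qed

end

section \<open>Cubic rings\<close>

lemma cubic_ring_basis:
  assumes "cubic_ring L D C"
  obtains u v w where "u \<in> carrier L" "v \<in> carrier L" "w \<in> carrier L"
    "C = {a \<otimes> u \<oplus> b \<otimes> v \<oplus> c \<otimes> w | a b c. a \<in> D \<and> b \<in> D \<and> c \<in> D}"
    "\<forall>a \<in> D. \<forall>b \<in> D. \<forall>c \<in> D. a \<otimes> u \<oplus> b \<otimes> v \<oplus> c \<otimes> w = \<zero> \<longrightarrow> a = \<zero> \<and> b = \<zero> \<and> c = \<zero>"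
proof -
  obtain Us where Us: "length Us = 3" "set Us \<subseteq> carrier L" "C = Span D Us"
    "\<And>Ks. \<lbrakk> length Ks = 3; set Ks \<subseteq> D; combine Ks Us = \<zero> \<rbrakk> \<Longrightarrow> set Ks \<subseteq> {\<zero>}"
    using assms unfolding cubic_ring_def free_of_rank_def by blast
  obtain u v w where uvw: "Us = [u, v, w]"
    using Us(1) by (auto simp: numeral_3_eq_3 length_Suc_conv)
  have L: "u \<in> carrier L" "v \<in> carrier L" "w \<in> carrier L" using Us(2) unfolding uvw by auto
  have "C = {a \<otimes> u \<oplus> b \<otimes> v \<oplus> c \<otimes> w | a b c. a \<in> D \<and> b \<in> D \<and> c \<in> D}"
    unfolding Us(3) uvw by (rule Span_three[OF L])
  moreover have "a = \<zero> \<and> b = \<zero> \<and> c = \<zero>"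
    if D: "a \<in> D" "b \<in> D" "c \<in> D" and z: "a \<otimes> u \<oplus> b \<otimes> v \<oplus> c \<otimes> w = \<zero>" for a b c
  proof -
    have "combine [a, b, c] Us = \<zero>" unfolding uvw using D z L by (simp add: a_assoc)
    thus ?thesis using Us(4)[of "[a, b, c]"] D by simp
  qed
  ultimately show thesis by (intro that[OF L] ballI impI) auto
qed

text \<open>
  The valuations of the powers of an element outside \<open>A\<close> are unbounded below. This replaces the
  Cayley-Hamilton argument for the integrality of cubic rings.
\<close>

lemma in_A_if_powers_bounded:
  assumes x: "x \<in> carrier L" and bd: "\<And>n::nat. t [^] (N::nat) \<otimes> x [^] n \<in> A" shows "x \<in> A"
proof -
  define y where "y = t [^] N \<otimes> x"
  have yA: "y \<in> A" using bd[of 1] x unfolding y_def by simp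
  show ?thesis
  proof (cases "y = \<zero>")
    case True
    hence "x = \<zero>" unfolding y_def using x integral_iff[of "t [^] N" x] by simp
    thus ?thesis by simp
  next
    case False
    then obtain i where i: "has_val y i" using has_val_ex yA by blast
    have "3 * N \<le> i"
    proof (rule ccontr)
      assume "\<not> 3 * N \<le> i"
      \<comment> \<open>If i < 3N, comparing valuations in \<open>t\<^sup>Ny\<^sup>n\<close> gives
        (3N - i) n \<le> 3N, hence n \<le> 3N; so 3N + 1 is large enough for a
        contradiction.\<close>
      define n where "n = 3 * N + 1"
      have v: "has_val ((t [^] N) [^] n) (3 * N * n)" using has_val_pow[OF has_val_t_pow] .
      have "(t [^] N) [^] n \<otimes> (t [^] N \<otimes> x [^] n) = t [^] N \<otimes> y [^] n"
        unfolding y_def using x by (simp add: nat_pow_distrib m_ac)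
      moreover have "(t [^] N) [^] n \<otimes> (t [^] N \<otimes> x [^] n) \<in> F (3 * N * n)"
        using has_val_F[OF v, of "3 * N * n"] bd[of n] F_closed(4) by blast
      ultimately have "t [^] N \<otimes> y [^] n \<in> F (3 * N * n)" by simp
      hence le: "3 * N * n \<le> 3 * N + i * n"
        unfolding has_val_F[OF has_val_mult[OF has_val_t_pow has_val_pow[OF i]]] .
      have "Suc i * n \<le> 3 * N * n" by (rule mult_le_mono1) (use \<open>\<not> 3 * N \<le> i\<close> in simp)
      hence "n \<le> 3 * N" using le by simp
      thus False unfolding n_def by simp
    qed
    hence "y \<in> F (3 * N)" using has_val_F[OF i] by simp
    then obtain a where a: "a \<in> A" "y = t [^] N \<otimes> a" unfolding F_eq_t_pow by blast
    hence "x = a" using m_lcancel[of "t [^] N" x a] x unfolding y_def by simp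
    thus ?thesis using a by simp
  qed
qed

text \<open>All powers of x lie in \<open>C\<close>, and one power of t clears the denominators of
  the three generators, so the powers of x have a common denominator.\<close>

lemma cubic_ring_subset_A:
  assumes C: "cubic_ring L D C" shows "C \<subseteq> A"
proof
  fix x assume x: "x \<in> C"
  have sub: "subring C L" using C unfolding cubic_ring_def by blast
  obtain u v w where uvw: "u \<in> carrier L" "v \<in> carrier L" "w \<in> carrier L"
    "C = {a \<otimes> u \<oplus> b \<otimes> v \<oplus> c \<otimes> w | a b c. a \<in> D \<and> b \<in> D \<and> c \<in> D}"
    "\<forall>a \<in> D. \<forall>b \<in> D. \<forall>c \<in> D. a \<otimes> u \<oplus> b \<otimes> v \<oplus> c \<otimes> w = \<zero> \<longrightarrow> a = \<zero> \<and> b = \<zero> \<and> c = \<zero>"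
    by (rule cubic_ring_basis[OF C])
  obtain i j k where ijk: "t [^] (i::nat) \<otimes> u \<in> A" "t [^] (j::nat) \<otimes> v \<in> A" "t [^] (k::nat) \<otimes> w \<in> A"
    using t_pow_mult_in_A uvw(1-3) by meson
  have bd: "t [^] (i + j + k) \<otimes> y \<in> A" if y: "y \<in> C" for y
  proof -
    obtain a b c where abc: "a \<in> D" "b \<in> D" "c \<in> D" "y = a \<otimes> u \<oplus> b \<otimes> v \<oplus> c \<otimes> w" using y uvw(4) by blast
    define p q r where "p = t [^] i" "q = t [^] j" "r = t [^] k"
    have pqr: "p \<in> D" "q \<in> D" "r \<in> D" unfolding p_q_r_def by auto
    have "t [^] (i + j + k) \<otimes> y = (p \<otimes> q \<otimes> r) \<otimes> (a \<otimes> u \<oplus> b \<otimes> v \<oplus> c \<otimes> w)"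
      unfolding abc(4) p_q_r_def by (simp add: nat_pow_mult)
    also have "\<dots> = (q \<otimes> r \<otimes> a) \<otimes> (p \<otimes> u) \<oplus> (p \<otimes> r \<otimes> b) \<otimes> (q \<otimes> v) \<oplus> (p \<otimes> q \<otimes> c) \<otimes> (r \<otimes> w)"
      using pqr[THEN D_carrier] abc(1-3)[THEN D_carrier] uvw(1-3) by algebra
    also have "\<dots> \<in> A" using ijk pqr abc(1-3) unfolding p_q_r_def[symmetric] by simp
    finally show ?thesis .
  qed
  have "x [^] n \<in> C" for n :: nat
    by (induct n) (use x subringE(3,6)[OF sub] in auto)
  hence "\<And>n::nat. t [^] (i + j + k) \<otimes> x [^] n \<in> A" using bd by blast
  moreover have "x \<in> carrier L" using x subringE(1)[OF sub] by blast
  ultimately show "x \<in> A" by (rule in_A_if_powers_bounded[rotated])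
qed

text \<open>Supplies the m of \<open>over_ring_shape\<close> for an arbitrary cubic ring. By
  freeness, the coefficient of x in a relation with the three generators is nonzero, and up to a
  unit it is a power of t. It suffices to treat \<tau> and its square, because \<open>D\<close> is
  contained in \<open>C\<close>.\<close>

lemma cubic_ring_conductor:
  assumes C: "cubic_ring L D C" shows "\<exists>m::nat. \<forall>x \<in> A. t [^] m \<otimes> x \<in> C"
proof -
  have sub: "subring C L" and DC: "\<And>d. d \<in> D \<Longrightarrow> d \<in> C" using C unfolding cubic_ring_def by auto
  note cl = subringE(6,7)[OF sub]
  obtain u v w where uvw: "u \<in> carrier L" "v \<in> carrier L" "w \<in> carrier L"
    "C = {a \<otimes> u \<oplus> b \<otimes> v \<oplus> c \<otimes> w | a b c. a \<in> D \<and> b \<in> D \<and> c \<in> D}"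
    "\<forall>a \<in> D. \<forall>b \<in> D. \<forall>c \<in> D. a \<otimes> u \<oplus> b \<otimes> v \<oplus> c \<otimes> w = \<zero> \<longrightarrow> a = \<zero> \<and> b = \<zero> \<and> c = \<zero>"
    by (rule cubic_ring_basis[OF C])
  have ex: "\<exists>n::nat. t [^] n \<otimes> x \<in> C" if x: "x \<in> carrier L" for x
  proof -
    obtain a b c e where abce: "a \<in> D" "b \<in> D" "c \<in> D" "e \<in> D"
      "\<not> (a = \<zero> \<and> b = \<zero> \<and> c = \<zero> \<and> e = \<zero>)"
      "a \<otimes> u \<oplus> b \<otimes> v \<oplus> c \<otimes> w \<oplus> e \<otimes> x = \<zero>"
      using four_dependent[OF uvw(1-3) x] by blast
    have "e \<noteq> \<zero>"
    proof
      assume "e = \<zero>"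
      hence "a \<otimes> u \<oplus> b \<otimes> v \<oplus> c \<otimes> w = \<zero>" using abce uvw(1-3) x by simp
      thus False using uvw(5) abce(1-3,5) \<open>e = \<zero>\<close> by blast
    qed
    then obtain q y y' where y: "y \<in> D" "y' \<in> D" "y \<otimes> y' = \<one>" "e = t [^] (q::nat) \<otimes> y"
      using D_factor[OF abce(4)] by blast
    note C' = abce(1-4)[THEN D_carrier] y(1,2)[THEN D_carrier] uvw(1-3) x t_pow_carrier[of q]
    have "t [^] q \<otimes> x = (y \<otimes> y') \<otimes> (t [^] q \<otimes> x)" using C' y by simp
    also have "\<dots> = (\<ominus> (y' \<otimes> a)) \<otimes> u \<oplus> (\<ominus> (y' \<otimes> b)) \<otimes> v \<oplus> (\<ominus> (y' \<otimes> c)) \<otimes> w \<oplus>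
        y' \<otimes> (a \<otimes> u \<oplus> b \<otimes> v \<oplus> c \<otimes> w \<oplus> e \<otimes> x)"
      unfolding y(4) using C' by algebra
    also have "\<dots> = (\<ominus> (y' \<otimes> a)) \<otimes> u \<oplus> (\<ominus> (y' \<otimes> b)) \<otimes> v \<oplus> (\<ominus> (y' \<otimes> c)) \<otimes> w"
      unfolding abce(6) using C' by simp
    finally have "t [^] q \<otimes> x \<in> C" unfolding uvw(4) using abce(1-3) y(2) by blast
    thus ?thesis by blast
  qed
  obtain i j where ij: "t [^] (i::nat) \<otimes> \<tau> \<in> C" "t [^] (j::nat) \<otimes> (\<tau> \<otimes> \<tau>) \<in> C"
    using ex[of \<tau>] ex[of "\<tau> \<otimes> \<tau>"] by auto
  have "t [^] (i + j) \<otimes> x \<in> C" if x: "x \<in> A" for x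
  proof -
    obtain a b c where abc: "a \<in> D" "b \<in> D" "c \<in> D" "x = a \<oplus> b \<otimes> \<tau> \<oplus> c \<otimes> (\<tau> \<otimes> \<tau>)"
      using A_basis[OF has_val_tau has_val_tau_square _ x] by auto
    define p q where "p = t [^] i" "q = t [^] j"
    have pq: "p \<in> D" "q \<in> D" unfolding p_q_def by auto
    have "t [^] (i + j) \<otimes> x = (p \<otimes> q) \<otimes> (a \<oplus> b \<otimes> \<tau> \<oplus> c \<otimes> (\<tau> \<otimes> \<tau>))"
      unfolding abc(4) p_q_def by (simp add: nat_pow_mult)
    also have "\<dots> = (p \<otimes> q \<otimes> a) \<oplus> (q \<otimes> b) \<otimes> (p \<otimes> \<tau>) \<oplus> (p \<otimes> c) \<otimes> (q \<otimes> (\<tau> \<otimes> \<tau>))"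
      using pq[THEN D_carrier] abc(1-3)[THEN D_carrier] A_carrier[OF tau_in_A] by algebra
    finally show ?thesis
      using ij pq abc(1-3) DC unfolding p_q_def[symmetric] by (simp add: cl)
  qed
  thus ?thesis by blast
qed

section \<open>Admissibility in terms of \<open>has_val\<close>\<close>

lemma normalized_valuation_eq_iff:
  assumes "\<alpha> \<in> A"
  shows "normalized_valuation (L\<lparr>carrier := A\<rparr>) \<tau> \<alpha> = enat n \<longleftrightarrow> has_val \<alpha> n"
proof -
  have PIdl: "\<alpha> \<in> PIdl\<^bsub>L\<lparr>carrier := A\<rparr>\<^esub> (\<tau> [^]\<^bsub>L\<lparr>carrier := A\<rparr>\<^esub> k) \<longleftrightarrow> \<alpha> \<in> F k" for k :: nat
  proof -
    have "a \<otimes> \<tau> [^] k = \<tau> [^] k \<otimes> a" if "a \<in> A" for a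
      using that by (simp add: m_comm)
    hence "(\<exists>a. \<alpha> = a \<otimes> \<tau> [^] k \<and> a \<in> A) \<longleftrightarrow> (\<exists>a. \<alpha> = \<tau> [^] k \<otimes> a \<and> a \<in> A)"
      by metis
    thus ?thesis unfolding nat_pow_subring cgenideal_subring F_def by simp
  qed
  have v: "normalized_valuation (L\<lparr>carrier := A\<rparr>) \<tau> \<alpha> = (SUP k \<in> {k. \<alpha> \<in> F k}. enat k)"
    unfolding normalized_valuation_def PIdl ..
  have val: "normalized_valuation (L\<lparr>carrier := A\<rparr>) \<tau> \<alpha> = enat k" if k: "has_val \<alpha> k" for k
    unfolding v has_val_F[OF k]
  proof (rule antisym)
    show "(SUP i \<in> {i. i \<le> k}. enat i) \<le> enat k" by (rule SUP_least) simp
    show "enat k \<le> (SUP i \<in> {i. i \<le> k}. enat i)" by (rule SUP_upper) simp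
  qed
  show ?thesis
  proof
    assume eq: "normalized_valuation (L\<lparr>carrier := A\<rparr>) \<tau> \<alpha> = enat n"
    \<comment> \<open>For \<alpha> = 0 the supremum runs over all k, so it exceeds n.\<close>
    have "\<alpha> \<noteq> \<zero>"
    proof
      assume "\<alpha> = \<zero>"
      hence "enat (Suc n) \<le> normalized_valuation (L\<lparr>carrier := A\<rparr>) \<tau> \<alpha>"
        unfolding v by (intro SUP_upper) simp
      thus False unfolding eq by simp
    qed
    then obtain k where k: "has_val \<alpha> k" using has_val_ex assms by blast
    thus "has_val \<alpha> n" using val[OF k] eq by simp
  qed (rule val)
qed

lemma admissible_iff:
  "admissible A (normalized_valuation (L\<lparr>carrier := A\<rparr>) \<tau>) r \<alpha> \<longleftrightarrow> has_val \<alpha> (if even r then 1 else 2)"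
proof -
  have "(1::enat) = enat 1" "(2::enat) = enat 2" by (simp_all add: one_enat_def numeral_eq_enat)
  hence "admissible A (normalized_valuation (L\<lparr>carrier := A\<rparr>) \<tau>) r \<alpha> \<longleftrightarrow>
      \<alpha> \<in> A \<and> normalized_valuation (L\<lparr>carrier := A\<rparr>) \<tau> \<alpha> = enat (if even r then 1 else 2)"
    unfolding admissible_def by simp
  thus ?thesis using normalized_valuation_eq_iff has_val_A by blast
qed

lemma C_ring_0: assumes "\<alpha> \<in> A" shows "C_ring L D A t 0 \<alpha> = A"
proof (intro equalityI subsetI)
  have mem: "x \<in> C_ring L D A t 0 \<alpha> \<longleftrightarrow> (\<exists>d \<in> D. \<exists>d' \<in> D. \<exists>a \<in> A. x = d \<oplus> t [^] (0::nat) \<otimes> \<alpha> \<otimes> d' \<oplus> t [^] (0::nat) \<otimes> a)" for x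
    unfolding C_ring_def div_0 mem_set_add_iff mem_l_coset_iff Bex_def by blast
  fix x
  show "x \<in> C_ring L D A t 0 \<alpha> \<Longrightarrow> x \<in> A" unfolding mem using assms by auto
  assume "x \<in> A"
  moreover have "x = \<zero> \<oplus> t [^] (0::nat) \<otimes> \<alpha> \<otimes> \<zero> \<oplus> t [^] (0::nat) \<otimes> x" using \<open>x \<in> A\<close> assms by simp
  ultimately show "x \<in> C_ring L D A t 0 \<alpha>" unfolding mem using D_closed(1) by blast
qed

lemma over_ring_A_ring:
  assumes "over_ring L D (A_ring L D A t m) B"
  shows "\<exists>k r \<alpha>. r + k \<le> m \<and> has_val \<alpha> (if even r then 1 else 2) \<and>
    B = (t [^] k <#\<^bsub>L\<^esub> C_ring L D A t r \<alpha>) <+>\<^bsub>L\<^esub> D"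
proof -
  have cub: "cubic_ring L D B" and sub: "A_ring L D A t m \<subseteq> B" using assms unfolding over_ring_def by auto
  have B: "subring B L" "D \<subseteq> B" using cub unfolding cubic_ring_def by auto
  have cond: "t [^] m \<otimes> x \<in> B" if "x \<in> A" for x
  proof -
    have "t [^] m \<otimes> x \<in> t [^] m <#\<^bsub>L\<^esub> A" unfolding mem_l_coset_iff using that by blast
    moreover have "t [^] m \<otimes> x = t [^] m \<otimes> x \<oplus> \<zero>" using that by simp
    ultimately have "t [^] m \<otimes> x \<in> A_ring L D A t m"
      unfolding A_ring_def mem_set_add_iff using D_closed(1) by blast
    thus ?thesis using sub by blast
  qed
  obtain k r \<alpha> p where "r + k \<le> m" "has_val \<alpha> p" "p = (if even r then 1 else 2)"
    "B = (t [^] k <#\<^bsub>L\<^esub> C_ring L D A t r \<alpha>) <+>\<^bsub>L\<^esub> D"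
    by (rule over_ring_eq_shifted_C_ring[OF B cubic_ring_subset_A[OF cub] cond])
  thus ?thesis by blast
qed

lemma C_ring_plane_curve_singularity:
  assumes val: "has_val \<alpha> (if even r then 1 else 2)" and r: "1 \<le> r"
  shows "cubic_ring L D (C_ring L D A t r \<alpha>)"
    and "plane_curve_singularity (L\<lparr>carrier := C_ring L D A t r \<alpha>\<rparr>)"
proof -
  define p :: nat where "p = (if even r then 1 else 2)"
  define s where "s = r div 2"
  have p: "has_val \<alpha> p" "p = 1 \<or> p = 2" using val unfolding p_def by auto
  have rs: "r = 2 * s + (p - 1)" unfolding p_def s_def by presburger
  \<comment> \<open>\<open>C_ring\<close> does not mention \<gamma>; this choice makes the third
    generator the square of the second.\<close>
  obtain \<gamma> where \<gamma>: "has_val \<gamma> (3 - p)" "\<alpha> \<otimes> \<alpha> = t [^] (p - 1) \<otimes> \<gamma>"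
    using has_val_square_factor[OF p] by blast
  have pq: "complementary p (3 - p)" using p(2) by auto
  have eq: "C_ring L D A t r \<alpha> = tri (t [^] s \<otimes> \<alpha>) (t [^] r \<otimes> \<gamma>)"
    by (rule C_ring_eq_tri[OF p(1) \<gamma>(1) pq rs])
  have B: "subring (C_ring L D A t r \<alpha>) L" "D \<subseteq> C_ring L D A t r \<alpha>" "C_ring L D A t r \<alpha> \<subseteq> A"
    unfolding eq using subring_tri[OF p(1) \<gamma>(1) pq \<gamma>(2) rs r refl refl]
      tri_subset_A[OF p(1) \<gamma>(1) pq \<gamma>(2) rs r refl refl] D_subset_tri p(1) \<gamma>(1) by auto
  have cond: "\<And>x. x \<in> A \<Longrightarrow> t [^] r \<otimes> x \<in> C_ring L D A t r \<alpha>"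
    unfolding eq by (rule conductor_tri[OF p(1) \<gamma>(1) pq \<gamma>(2) rs r refl refl])
  show "cubic_ring L D (C_ring L D A t r \<alpha>)"
    unfolding cubic_ring_def using B(1,2) free_of_rank_tri[OF p(1) \<gamma>(1) pq, of s r] unfolding eq by blast
  have "embedding_dim (L\<lparr>carrier := C_ring L D A t r \<alpha>\<rparr>) = 2"
    unfolding eq by (rule embedding_dim_C_ring[OF p(1) \<gamma>(1) pq \<gamma>(2) rs r refl refl])
  thus "plane_curve_singularity (L\<lparr>carrier := C_ring L D A t r \<alpha>\<rparr>)"
    unfolding plane_curve_singularity_def
    using overring_local_ring[OF B cond] overring_noetherian_ring[OF B cond] overring_krull_dim[OF B cond] by blast
qed

text \<open>Embedding dimension 2 excludes a strict upper bound on h, where it is 3, and h = 0,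
  where the ring is \<open>A\<close> and it is 1. With equality in the bound the normal form is that
  of \<open>C_ring\<close> with r = h.\<close>

lemma plane_curve_singularity_eq_C_ring:
  assumes cub: "cubic_ring L D C" and sing: "plane_curve_singularity (L\<lparr>carrier := C\<rparr>)"
  shows "\<exists>r \<alpha>. C = C_ring L D A t r \<alpha> \<and> 1 \<le> r \<and> has_val \<alpha> (if even r then 1 else 2)"
proof -
  have B: "subring C L" "D \<subseteq> C" "C \<subseteq> A"
    using cub cubic_ring_subset_A unfolding cubic_ring_def by auto
  obtain m where cond: "\<And>x. x \<in> A \<Longrightarrow> t [^] (m::nat) \<otimes> x \<in> C" using cubic_ring_conductor[OF cub] by blast
  obtain e h \<alpha> \<gamma> p q where *: "has_val \<alpha> p" "has_val \<gamma> q" "complementary p q"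
    "e + (p - 1) \<le> h" "h \<le> 2 * e + (p - 1)" "h \<le> m" "C = tri (t [^] e \<otimes> \<alpha>) (t [^] h \<otimes> \<gamma>)"
    by (rule over_ring_shape[OF B cond])
  have ed: "embedding_dim (L\<lparr>carrier := C\<rparr>) = 2" using sing unfolding plane_curve_singularity_def by blast
  have "\<not> h < 2 * e + (p - 1)" using embedding_dim_shifted[OF B *(1-4) _ *(7)] ed by auto
  hence h: "h = 2 * e + (p - 1)" using *(5) by simp
  have C: "C = C_ring L D A t h \<alpha>" using C_ring_eq_tri[OF *(1-3) h] *(7) by simp
  have "h \<noteq> 0"
  proof
    assume "h = 0"
    hence "C = A" using C C_ring_0 has_val_A[OF *(1)] by simp
    thus False using ed embedding_dim_A by simp
  qed
  moreover have "p = (if even h then 1 else 2)" using *(3) h by auto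
  ultimately show ?thesis using C *(1) by (intro exI[of _ h] exI[of _ \<alpha>]) auto
qed

end

section \<open>The classification\<close>

lemma totally_ramified_cubicI:
  fixes L :: "('a, 'b) ring_scheme" (structure)
  assumes field: "field L" and D: "subring D L" and dvr: "discrete_valuation_ring (L\<lparr>carrier := D\<rparr>)"
    and t: "t \<in> D" "maximalideal (PIdl\<^bsub>L\<lparr>carrier := D\<rparr>\<^esub> t) (L\<lparr>carrier := D\<rparr>)"
    and complete: "adically_complete (L\<lparr>carrier := D\<rparr>) t"
    and dim: "ring.dimension L 3 (field_of_fractions L D) (carrier L)"
    and A: "A = integral_closure L D"
    and \<tau>: "\<tau> \<in> A" "maximalideal (PIdl\<^bsub>L\<lparr>carrier := A\<rparr>\<^esub> \<tau>) (L\<lparr>carrier := A\<rparr>)"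
    and ram: "PIdl\<^bsub>L\<lparr>carrier := A\<rparr>\<^esub> t = PIdl\<^bsub>L\<lparr>carrier := A\<rparr>\<^esub> (\<tau> [^] (3::nat))"
  shows "totally_ramified_cubic L D A t \<tau>"
proof -
  interpret field L by fact
  let ?A = "L\<lparr>carrier := A\<rparr>"
  have "A \<subseteq> carrier L" unfolding A integral_closure_def by blast
  \<comment> \<open>The predicate \<open>ideal\<close> includes that the ambient structure is a
    ring, so the ring structure on \<open>A\<close> comes with its maximal ideal.\<close>
  hence A_sub: "subring A L"
    using subring_iff ideal.axioms(2)[OF maximalideal.axioms(1)[OF \<tau>(2)]] by blast
  interpret SA: domain ?A using subdomain_is_domain subdomainI' A_sub by blast
  interpret P: maximalideal "PIdl\<^bsub>?A\<^esub> \<tau>" ?A by (rule \<tau>(2))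
  interpret P: primeideal "PIdl\<^bsub>?A\<^esub> \<tau>" ?A by (rule SA.maximalideal_prime[OF \<tau>(2)])
  note cl = subringE(6)[OF A_sub]
  have DA: "D \<subseteq> A" unfolding A by (rule integral_closure_contains[OF D])
  have AL: "\<And>x. x \<in> A \<Longrightarrow> x \<in> carrier L" using subringE(1)[OF A_sub] by blast
  have tA: "t \<in> A" using t(1) DA by blast
  have t0: "t \<noteq> \<zero>" by (rule discrete_valuation_ring_cases(1)[OF field D dvr t])
  note D_cases = discrete_valuation_ring_cases(2)[OF field D dvr t]
  have pow_A: "x [^] (n::nat) \<in> A" if "x \<in> A" for x n
    by (induct n) (use that cl subringE(3)[OF A_sub] in auto)
  have P_mem: "x \<in> PIdl\<^bsub>?A\<^esub> \<tau> \<longleftrightarrow> (\<exists>a \<in> A. x = a \<otimes> \<tau>)" for x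
    unfolding cgenideal_subring by blast
  have "t \<in> PIdl\<^bsub>?A\<^esub> (\<tau> [^] (3::nat))" using SA.cgenideal_self[of t] tA ram by simp
  then obtain e where e: "e \<in> A" "t = e \<otimes> \<tau> [^] (3::nat)" unfolding cgenideal_subring by blast
  have "\<tau> [^] (3::nat) \<in> PIdl\<^bsub>?A\<^esub> t" using SA.cgenideal_self[of "\<tau> [^] (3::nat)"] pow_A[OF \<tau>(1)] ram by simp
  then obtain e' where e': "e' \<in> A" "\<tau> [^] (3::nat) = e' \<otimes> t" unfolding cgenideal_subring by blast
  have "t \<otimes> (e \<otimes> e') = e \<otimes> (e' \<otimes> t)" using AL e(1) e'(1) tA by (simp add: m_ac)
  also have "\<dots> = t \<otimes> \<one>" using e'(2) e(2) AL[OF tA] by simp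
  finally have ee': "e \<otimes> e' = \<one>" using m_lcancel[of t "e \<otimes> e'" \<one>] t0 AL e(1) e'(1) tA by simp
  have t_\<tau>: "t = \<tau> [^] (3::nat) \<otimes> e" using e(2) m_comm[of e "\<tau> [^] (3::nat)"] AL e(1) pow_A[OF \<tau>(1)] by simp
  have \<tau>0: "\<tau> \<noteq> \<zero>" using t_\<tau> t0 AL[OF e(1)] by (auto simp: numeral_3_eq_3)
  have \<tau>n0: "\<tau> [^] (n::nat) \<noteq> \<zero>" for n
    using \<tau>0 AL[OF \<tau>(1)] by (induct n) (auto simp: integral_iff)
  have D_factor: "\<exists>n::nat. \<exists>u \<in> D. \<exists>u' \<in> D. u \<otimes> u' = \<one> \<and> d = t [^] n \<otimes> u" if d: "d \<in> D" "d \<noteq> \<zero>" for d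
  proof -
    let ?Q = "\<lambda>n::nat. \<exists>b \<in> D. d = t [^] n \<otimes> b"
    \<comment> \<open>Completeness enters here: a nonzero d is not divisible by all powers of t, and
      the last power that divides it leaves a unit as cofactor.\<close>
    have "\<exists>n. \<not> ?Q n" using adically_complete_separated[OF D field complete t(1) d(1)] d(2) by blast
    then obtain n where n: "\<not> ?Q n" "\<forall>i<n. ?Q i" using exists_least_iff[of "\<lambda>n. \<not> ?Q n"] by blast
    have "?Q 0" using d(1) DA AL by (intro bexI[of _ d]) auto
    then obtain k where k: "n = Suc k" using n(1) by (cases n) auto
    obtain b where b: "b \<in> D" "d = t [^] k \<otimes> b" using n(2) k by blast
    have "\<not> (\<exists>c \<in> D. b = t \<otimes> c)"
    proof
      assume "\<exists>c \<in> D. b = t \<otimes> c"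
      then obtain c where c: "c \<in> D" "b = t \<otimes> c" by blast
      have "d = t [^] n \<otimes> c" unfolding k b(2) c(2) using AL tA c(1) DA by (simp add: m_assoc subset_iff)
      thus False using n(1) c(1) by blast
    qed
    then obtain u' where "u' \<in> D" "b \<otimes> u' = \<one>" using D_cases[OF b(1)] by blast
    thus ?thesis using b by blast
  qed
  \<comment> \<open>An integral a divides a nonzero element of \<open>D\<close>, obtained from its
    equation, and this is a power of t up to a unit.\<close>
  have divides: "\<exists>n::nat. \<exists>b \<in> A. a \<otimes> b = t [^] n" if a: "a \<in> A" "a \<noteq> \<zero>" for a
  proof -
    obtain p where p: "polynomial D p" "p \<noteq> []" "lead_coeff p = \<one>" "eval p a = \<zero>"
      using a(1) unfolding A integral_closure_def by blast
    have "set p \<subseteq> D" using p(1) unfolding polynomial_def by auto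
    then obtain y d where yd: "y \<in> A" "d \<in> D" "d \<noteq> \<zero>" "a \<otimes> y = d"
      using integral_divides_D[OF D A_sub DA a _ p(2-4)] by blast
    obtain n u u' where u: "u \<in> D" "u' \<in> D" "u \<otimes> u' = \<one>" "d = t [^] (n::nat) \<otimes> u"
      using D_factor[OF yd(2,3)] by blast
    have uA: "u \<in> A" "u' \<in> A" using u DA by auto
    have "a \<otimes> (y \<otimes> u') = d \<otimes> u'" unfolding yd(4)[symmetric] using AL a yd(1) uA by (simp add: m_assoc)
    also have "\<dots> = t [^] n" unfolding u(4) using AL uA tA u(3) by (simp add: m_assoc)
    finally show ?thesis using cl[OF yd(1) uA(2)] by blast
  qed
  show ?thesis
  proof (intro totally_ramified_cubic.intro totally_ramified_cubic_axioms.intro)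
    show "field L" "subring D L" "subring A L" "D \<subseteq> A" "t \<in> D" "t \<noteq> \<zero>" "\<tau> \<in> A"
      by (fact field D A_sub DA t(1) t0 \<tau>(1))+
    show "\<exists>e\<in>A. \<exists>e'\<in>A. e \<otimes> e' = \<one> \<and> t = \<tau> [^] (3::nat) \<otimes> e"
      using e(1) e'(1) ee' t_\<tau> by blast
    show "\<tau> \<otimes> a \<noteq> \<one>" if a: "a \<in> A" for a
    proof
      assume "\<tau> \<otimes> a = \<one>"
      hence "\<one> = a \<otimes> \<tau>" using m_comm AL a \<tau>(1) by simp
      hence "\<one> \<in> PIdl\<^bsub>?A\<^esub> \<tau>" unfolding P_mem using a by blast
      thus False using P.one_imp_carrier P.I_notcarr by simp
    qed
    show "(\<exists>b\<in>D. d = t \<otimes> b) \<or> (\<exists>b\<in>D. d \<otimes> b = \<one>)" if "d \<in> D" for d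
      using D_cases[OF that] .
    show "\<exists>n::nat. \<exists>b\<in>A. a \<otimes> b = t [^] n" if "a \<in> A" "a \<noteq> \<zero>" for a
      by (rule divides[OF that])
    show "\<exists>a\<in>D. \<exists>b\<in>D. \<exists>c\<in>D. \<exists>d\<in>D. \<not> (a = \<zero> \<and> b = \<zero> \<and> c = \<zero> \<and> d = \<zero>) \<and>
        a \<otimes> w \<oplus> b \<otimes> x \<oplus> c \<otimes> y \<oplus> d \<otimes> z = \<zero>"
      if "w \<in> carrier L" "x \<in> carrier L" "y \<in> carrier L" "z \<in> carrier L" for w x y z
      by (rule four_dependent_over_subring[OF D dim that])
    fix a assume a: "a \<in> A"
    show "(\<exists>b\<in>A. a = \<tau> \<otimes> b) \<or> (\<exists>b\<in>A. a \<otimes> b = \<one>)"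
    proof (cases "a \<in> PIdl\<^bsub>?A\<^esub> \<tau>")
      case True
      thus ?thesis using m_comm AL \<tau>(1) unfolding P_mem by blast
    next
      case False
      have a0: "a \<noteq> \<zero>" using False P.zero_closed by auto
      obtain n y where y: "y \<in> A" "a \<otimes> y = t [^] (n::nat)" using divides[OF a a0] by blast
      have "(\<tau> [^] (3::nat)) [^] n = \<tau> [^] (3 * n)" using AL[OF \<tau>(1)] by (simp add: nat_pow_pow)
      hence ay: "a \<otimes> y = \<tau> [^] (3 * n) \<otimes> e [^] n"
        unfolding y(2) t_\<tau> using AL \<tau>(1) e(1) by (simp add: nat_pow_distrib)
      \<comment> \<open>The ideal of \<tau> is prime and does not contain a, so each of the 3n
        factors \<tau> of \<open>a \<otimes> y\<close> can be split off from y. What then remains of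
        the product is the unit \<open>e [^] n\<close>.\<close>
      have "\<exists>z \<in> A. y = \<tau> [^] k \<otimes> z" if "k \<le> 3 * n" for k
        using that
      proof (induct k)
        case 0 thus ?case using y(1) AL by (intro bexI[of _ y]) auto
      next
        case (Suc k)
        then obtain z where z: "z \<in> A" "y = \<tau> [^] k \<otimes> z" by auto
        define i where "i = 3 * n - Suc k"
        have i: "3 * n = k + (1 + i)" unfolding i_def using Suc(2) by simp
        have "\<tau> [^] (3 * n) = \<tau> [^] k \<otimes> (\<tau> \<otimes> \<tau> [^] i)"
          unfolding i nat_pow_mult[OF AL[OF \<tau>(1)], symmetric] using AL[OF \<tau>(1)] by simp
        hence "\<tau> [^] k \<otimes> (a \<otimes> z) = \<tau> [^] k \<otimes> ((\<tau> [^] i \<otimes> e [^] n) \<otimes> \<tau>)"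
          using ay unfolding z(2) using AL a z(1) \<tau>(1) e(1) by (simp add: m_ac)
        hence "a \<otimes> z = (\<tau> [^] i \<otimes> e [^] n) \<otimes> \<tau>"
          using m_lcancel[of "\<tau> [^] k"] \<tau>n0 AL a z(1) \<tau>(1) e(1) by simp
        moreover have "\<tau> [^] i \<otimes> e [^] n \<in> A" using cl pow_A \<tau>(1) e(1) by blast
        ultimately have "a \<otimes> z \<in> PIdl\<^bsub>?A\<^esub> \<tau>" unfolding P_mem by blast
        hence "z \<in> PIdl\<^bsub>?A\<^esub> \<tau>" using P.I_prime[of a z] a z(1) False by auto
        then obtain z' where z': "z' \<in> A" "z = z' \<otimes> \<tau>" unfolding P_mem by blast
        have "y = \<tau> [^] Suc k \<otimes> z'" unfolding z(2) z'(2) using AL z'(1) \<tau>(1) by (simp add: m_ac)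
        thus ?case using z'(1) by blast
      qed
      then obtain z where z: "z \<in> A" "y = \<tau> [^] (3 * n) \<otimes> z" by blast
      have "\<tau> [^] (3 * n) \<otimes> (a \<otimes> z) = \<tau> [^] (3 * n) \<otimes> e [^] n"
        using ay unfolding z(2) using AL a z(1) \<tau>(1) by (simp add: m_ac)
      hence az: "a \<otimes> z = e [^] n"
        using m_lcancel[of "\<tau> [^] (3 * n)"] \<tau>n0 AL a z(1) \<tau>(1) e(1) by simp
      have "a \<otimes> (z \<otimes> e' [^] n) = (e \<otimes> e') [^] n"
        unfolding nat_pow_distrib[OF AL[OF e(1)] AL[OF e'(1)]] az[symmetric] using AL a z(1) e'(1) by (simp add: m_assoc)
      also have "\<dots> = \<one>" unfolding ee' by simp
      finally show ?thesis using cl[OF z(1) pow_A[OF e'(1)]] by blast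
    qed
  qed
qed

theorem theorem2p1:
  fixes L :: "('a, 'b) ring_scheme" (structure)
    and D K A :: "'a set" and t \<tau> :: 'a and v :: "'a \<Rightarrow> enat"
  assumes "field L"
    and "subring D L"
    and "discrete_valuation_ring (L\<lparr>carrier := D\<rparr>)"
    and "t \<in> D" and "maximalideal (PIdl\<^bsub>L\<lparr>carrier := D\<rparr>\<^esub> t) (L\<lparr>carrier := D\<rparr>)"
    and "adically_complete (L\<lparr>carrier := D\<rparr>) t"
    and "K = field_of_fractions L D"
    and "ring.dimension L 3 K (carrier L)"
    and "A = integral_closure L D"
    and "finitely_generated_over L D A"
    and "\<tau> \<in> A" and "{M. maximalideal M (L\<lparr>carrier := A\<rparr>)} = {PIdl\<^bsub>L\<lparr>carrier := A\<rparr>\<^esub> \<tau>}"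
    and "(L\<lparr>carrier := A\<rparr> Quot PIdl\<^bsub>L\<lparr>carrier := A\<rparr>\<^esub> \<tau>) \<simeq>
         (L\<lparr>carrier := D\<rparr> Quot PIdl\<^bsub>L\<lparr>carrier := D\<rparr>\<^esub> t)"
    and "PIdl\<^bsub>L\<lparr>carrier := A\<rparr>\<^esub> t = PIdl\<^bsub>L\<lparr>carrier := A\<rparr>\<^esub> (\<tau> [^] (3::nat))"
    and "v = normalized_valuation (L\<lparr>carrier := A\<rparr>) \<tau>"
  shows "(\<forall>\<alpha>. admissible A v 0 \<alpha> \<longrightarrow> C_ring L D A t 0 \<alpha> = A)
    \<and> (\<forall>m B. over_ring L D (A_ring L D A t m) B \<longrightarrow>
          (\<exists>k r \<alpha>. r + k \<le> m \<and> admissible A v r \<alpha> \<and>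
                   B = ((t [^] k) <# C_ring L D A t r \<alpha>) <+> D))
    \<and> {C. cubic_ring L D C \<and> plane_curve_singularity (L\<lparr>carrier := C\<rparr>)} =
        {C_ring L D A t r \<alpha> | r \<alpha>. r \<ge> 1 \<and> admissible A v r \<alpha>}"
proof -
  have maximal: "maximalideal (PIdl\<^bsub>L\<lparr>carrier := A\<rparr>\<^esub> \<tau>) (L\<lparr>carrier := A\<rparr>)"
    using assms(12) by blast
  interpret totally_ramified_cubic L D A t \<tau>
    by (rule totally_ramified_cubicI[OF assms(1-6) assms(8)[unfolded assms(7)] assms(9,11) maximal assms(14)])
  note adm = admissible_iff[folded assms(15)]
  show ?thesis
  proof (intro conjI allI impI)
    show "C_ring L D A t 0 \<alpha> = A" if "admissible A v 0 \<alpha>" for \<alpha>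
      by (rule C_ring_0) (use that in \<open>simp add: admissible_def\<close>)
    show "\<exists>k r \<alpha>. r + k \<le> m \<and> admissible A v r \<alpha> \<and> B = ((t [^] k) <#\<^bsub>L\<^esub> C_ring L D A t r \<alpha>) <+>\<^bsub>L\<^esub> D"
      if "over_ring L D (A_ring L D A t m) B" for m B
      using over_ring_A_ring[OF that] unfolding adm .
    show "{C. cubic_ring L D C \<and> plane_curve_singularity (L\<lparr>carrier := C\<rparr>)} =
        {C_ring L D A t r \<alpha> | r \<alpha>. r \<ge> 1 \<and> admissible A v r \<alpha>}"
      unfolding adm using C_ring_plane_curve_singularity plane_curve_singularity_eq_C_ring by blast
  qed
qed

end
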